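(* Let $d,m$ be positive integers, $X,Y$ finite sets such that $\nu(|X|,|Y|)\ge d+1$, and $W=X\times Y$. For each $w\in W$, let $X^w=\{x^w_1,\dots,x^w_m\}\subset\mathbb{R}^{d-1}$ be an (indexed) set of points. For every $w\in W$ and $i\in[m]$, let $A^w_i$ be a closed subset of $S^d$. Assume that: (1) for all $W'\subseteq W$ such that $W'$ intersects every subset of $W$ isomorphic to some $(a,b,d+1)$-stair, where $a\le|X|$, $b\le|Y|$ are integers satisfying $\nu(a,b)\ge d+1$, $a\le2d+1$ and $b\le2d+1$, we have $S^d=\bigcup_{w\in W'}\bigcup_{i=1}^m\left(A^w_i\cup(-A^w_i)\right)$; (2) for every pair of elements $u=(x,y)$, $w=(x',y')$ of $W$ such that $x\neq x'$ and $y\neq y'$, and every $i\in[m]$, we have $A^u_i\cap(-A^w_i)=\emptyset$. Then there exist $x\in S^d$ and two nonempty disjoint sets $P_+,P_-\subseteq W\times[m]$ such that: (a) $\operatorname{conv}\{x^w_i:(w,i)\in P_+\}\cap\operatorname{conv}\{x^w_i:(w,i)\in P_-\}\neq\emptyset$; (b) $x\in\left(\bigcap_{(w,i)\in P_+}A^w_i\right)\cap\left(\bigcap_{(w,i)\in P_-}(-A^w_i)\right)$; (c) the projection $\pi_1:P_+\cup P_-\to W=X\times Y$ is injective and $\pi_1(P_+\cup P_-)$ corresponds to a placement of $d+1$ non-taking rooks; and the projection $\pi_2:W\times[m]\to[m]$ satisfies $\pi_2(P_+)\cap\pi_2(P_-)=\emptyset$.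
   Context: Notation: $[m]=\{1,\dots,m\}$; $S^d$ is the unit sphere in $\mathbb{R}^{d+1}$ and $-A=\{-x:x\in A\}$. For integers $a,b$, $\nu(a,b)=\min\{a,b,\lfloor\frac{a+b+1}{3}\rfloor\}$. For integers $a,b,d$ with $\nu(a,b)\ge d+1$, $a\le2d+1$, $b\le2d+1$, the $(a,b,d+1)$-stair is the set of squares $(i,j)\in[a]\times[b]$ such that $a-(2d+1)\le j-i\le(2d+1)-b$. A subset of $X\times Y$ is isomorphic to the $(a,b,d+1)$-stair if it is the image of the stair under a map $(i,j)\mapsto(\alpha(i),\beta(j))$ with $\alpha:[a]\to X$ and $\beta:[b]\to Y$ injective. A placement of $d+1$ non-taking rooks in $X\times Y$ is a set of $d+1$ elements of $X\times Y$ on which both coordinate projections (to $X$ and to $Y$) are injective. $\pi_1$ and $\pi_2$ on subsets of $W\times[m]$ denote projections onto the first coordinate (in $W$) and second coordinate (in $[m]$).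
   Formalization: The stair is taken with a-(2d+1) ≤ i-j ≤ (2d+1)-b for (i,j) in [a]×[b], instead of the same bounds on j-i; with the printed bounds the claim fails for d=m=1, |X|=2, |Y|=3. *)

theory Defs
  imports "HOL-Analysis.Analysis" "HOL-Library.Function_Algebras"
begin

text \<open>
  Points of \<open>\<real>\<^sup>n\<close> are functions \<open>nat \<Rightarrow> real\<close> that vanish from index \<open>n\<close> on, as in
  \<^const>\<open>Euclidean_space\<close> and \<^const>\<open>nsphere\<close>; this includes \<open>n = 0\<close>, which the type-indexed
  spaces exclude. The pointwise vector space structure below makes \<open>convex hull\<close> available
  for such points.
\<close>

instantiation "fun" :: (type, real_vector) real_vector
begin

definition scaleR_fun :: "real \<Rightarrow> ('a \<Rightarrow> 'b) \<Rightarrow> 'a \<Rightarrow> 'b"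
  where "scaleR_fun c f = (\<lambda>i. c *\<^sub>R f i)"

instance
  by standard (simp_all add: scaleR_fun_def fun_eq_iff algebra_simps)

end

definition nu :: "int \<Rightarrow> int \<Rightarrow> int"
  where "nu a b = min (min a b) ((a + b + 1) div 3)"

text \<open>
  The \<open>(a, b, r)\<close>-stair; for \<open>r = d + 1\<close> the number \<open>2 * r - 1\<close> is \<open>2 * d + 1\<close>.

  The band condition \<open>a - (2 * d + 1) \<le> j - i \<le> (2 * d + 1) - b\<close> belongs to board coordinates with
  \<open>i\<close> the column (\<open>i \<le> b\<close>) and \<open>j\<close> the row (\<open>j \<le> a\<close>). Here, a pair is (row, column), with row
  \<open>\<in> [a]\<close> and column \<open>\<in> [b]\<close>, so the bounds apply to the difference row minus column. The band then
  runs from corner to corner of the board: the \<open>(2, 3, 2)\<close>-stair is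
  \<open>{(1, 1), (1, 2), (2, 2), (2, 3)}\<close>. With the bounds on column minus row it would be
  \<open>{(1, 1), (2, 1), (2, 2)}\<close>, which misses a column, and whose complex of non-taking rooks is
  disconnected; the theorem stated with these sets fails already for \<open>d = m = 1\<close> on a
  2-by-3 board. So the source's combination of \<open>j - i\<close> with \<open>(i, j) \<in> [a] \<times> [b]\<close> is read as a
  transposition slip. For \<open>a = b\<close> the two agree.
\<close>

definition stair :: "int \<Rightarrow> int \<Rightarrow> int \<Rightarrow> (int \<times> int) set"
  where "stair a b r =
    {(i, j). i \<in> {1..a} \<and> j \<in> {1..b} \<and> a - (2 * r - 1) \<le> i - j \<and> i - j \<le> (2 * r - 1) - b}"

definition isomorphic_to_stair ::
    "int \<Rightarrow> int \<Rightarrow> int \<Rightarrow> 'x set \<Rightarrow> 'y set \<Rightarrow> ('x \<times> 'y) set \<Rightarrow> bool"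
  where "isomorphic_to_stair a b r X Y S \<longleftrightarrow>
    (\<exists>\<alpha> \<beta>. \<alpha> \<in> {1..a} \<rightarrow> X \<and> inj_on \<alpha> {1..a} \<and> \<beta> \<in> {1..b} \<rightarrow> Y \<and> inj_on \<beta> {1..b} \<and>
      S = (\<lambda>(i, j). (\<alpha> i, \<beta> j)) ` stair a b r)"

definition rook_placement :: "nat \<Rightarrow> 'x set \<Rightarrow> 'y set \<Rightarrow> ('x \<times> 'y) set \<Rightarrow> bool"
  where "rook_placement k X Y R \<longleftrightarrow>
    R \<subseteq> X \<times> Y \<and> finite R \<and> card R = k \<and> inj_on fst R \<and> inj_on snd R"

end

theory Submission
  imports Defs "HOL-Library.Z2"
begin

text \<open>
  Write \<open>K(T)\<close> for the complex of non-taking rooks on a set \<open>T\<close> of squares. For a point \<open>x\<close> of the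
  sphere let \<open>W\<^sub>x\<close> be the set of squares \<open>w\<close> for which some \<open>A w i \<union> - A w i\<close> contains \<open>x\<close>. The covering
  hypothesis, applied to \<open>W - W\<^sub>x\<close>, says that \<open>W\<^sub>x\<close> contains a stair, and sets that
  contain a \<open>(d+1)\<close>-stair have a \<open>(d-1)\<close>-connected complex of non-taking rooks. This is proved in a
  homological, vertex-decomposability form: a stair is built up from a cone with apex in its corner by
  adding squares whose links contain \<open>d\<close>-stairs, and then further squares are added
  (\<open>has_stair_imp_rook_decomposable\<close>). The property survives when every square is replaced by several
  copies that attack each other. The copies used here are the labels \<open>((w, i), s)\<close> with \<open>i \<in> [m]\<close> and
  a sign \<open>s\<close>; the labels available at \<open>x\<close> are those for which the signed set contains \<open>x\<close>.

  Changing the sign is a free involution on labels that corresponds to \<open>x \<mapsto> - x\<close>. On a fine antipodal cell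
  structure of the sphere, the complexes of labels available somewhere on a cell form an equivariant
  acyclic carrier, so there is an equivariant chain map modulo 2 from the cells to the labels
  (\<open>equivariant_acyclic_carrier\<close>). Every label \<open>((w, i), s)\<close> also has a position in
  \<open>\<real>\<^sup>d\<close>, namely \<open>\<plusminus> (p w i, 1)\<close>, and this assignment is odd. The images of the hemispheres of dimensions
  \<open>0, \<dots>, d\<close> then give a chain version of the Borsuk-Ulam theorem: some \<open>d\<close>-simplex of labels has the
  origin in the convex hull of its positions (\<open>odd_chains_cross_origin\<close>). For generic positions the number of
  such simplices is odd, by induction on the dimension; arbitrary positions are a limit of generic ones.

  A simplex of labels with \<open>d + 1\<close> vertices is a placement of \<open>d + 1\<close> non-taking rooks with an index and
  a sign for each rook. Refining the cells and passing to a limit gives one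
  point \<open>x\<close> that lies in all the signed sets of such a simplex (\<open>colored_antipodal_point\<close>). The last coordinate
  \<open>\<plusminus> 1\<close> turns the vanishing convex combination into a common point of the convex hulls of the positive and of
  the negative points. Finally the disjointness hypothesis rules out that the two signs share an index.
\<close>

section \<open>Decomposing stairs and the sets that contain them\<close>

definition nonattacking :: "'x \<times> 'y \<Rightarrow> 'x \<times> 'y \<Rightarrow> bool"
  where "nonattacking u q \<longleftrightarrow> fst u \<noteq> fst q \<and> snd u \<noteq> snd q"

text \<open>
  Vertex decomposability of the skeleton of dimension \<open>r - 1\<close> of the complex of non-taking rooks, in terms of
  the set of squares alone. The link of a square \<open>q\<close> is the complex on the squares that \<open>q\<close> does not
  attack, so in the second rule \<open>q\<close> is the apex of a cone.
\<close>
inductive rook_decomposable :: "nat \<Rightarrow> ('x \<times> 'y) set \<Rightarrow> bool" where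
  trivial: "finite S \<Longrightarrow> rook_decomposable 0 S"
| cone: "rook_decomposable r S \<Longrightarrow> \<forall>u\<in>S. nonattacking u q \<Longrightarrow> rook_decomposable (Suc r) (insert q S)"
| shed: "rook_decomposable (Suc r) S \<Longrightarrow> q \<notin> S \<Longrightarrow> rook_decomposable r {u \<in> S. nonattacking u q} \<Longrightarrow>
    rook_decomposable (Suc r) (insert q S)"

text \<open>
  The rows and columns of the stair may go anywhere and further squares are allowed, so the property is
  stable under permutations of rows and of columns and passes to larger sets.
\<close>
definition has_stair :: "nat \<Rightarrow> ('x \<times> 'y) set \<Rightarrow> bool"
  where "has_stair r T \<longleftrightarrow> (\<exists>a b \<alpha> \<beta>. nu a b \<ge> int r \<and> a \<le> 2 * int r - 1 \<and> b \<le> 2 * int r - 1 \<and>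
    inj_on \<alpha> {1..a} \<and> inj_on \<beta> {1..b} \<and> (\<forall>(i, j) \<in> stair a b (int r). (\<alpha> i, \<beta> j) \<in> T))"

lemma has_stair_mono: "has_stair r S \<Longrightarrow> S \<subseteq> T \<Longrightarrow> has_stair r T"
  unfolding has_stair_def by (elim exE conjE, intro exI conjI) (assumption | blast)+

lemma stair_iff: "(i, j) \<in> stair a b r \<longleftrightarrow> 1 \<le> i \<and> i \<le> a \<and> 1 \<le> j \<and> j \<le> b \<and>
    a - 2 * r + 1 \<le> i - j \<and> i - j \<le> 2 * r - 1 - b"
  by (auto simp: stair_def)

lemma stair_swap: "(i, j) \<in> stair a b r \<longleftrightarrow> (j, i) \<in> stair b a r"
  by (auto simp: stair_iff)

lemma nu_swap: "nu a b = nu b a"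
  by (simp add: nu_def min.commute add.commute)

lemma nu_ge_iff: "nu a b \<ge> r \<longleftrightarrow> a \<ge> r \<and> b \<ge> r \<and> a + b + 1 \<ge> 3 * r"
  by (auto simp: nu_def)

lemma has_stair_swap_imp:
  assumes "has_stair r S" shows "has_stair r (prod.swap ` S)"
proof -
  obtain a b \<alpha> \<beta> where *: "nu a b \<ge> int r" "a \<le> 2 * int r - 1" "b \<le> 2 * int r - 1"
    "inj_on \<alpha> {1..a}" "inj_on \<beta> {1..b}" "\<forall>(i, j) \<in> stair a b (int r). (\<alpha> i, \<beta> j) \<in> S"
    using assms unfolding has_stair_def by metis
  have "\<forall>(j, i) \<in> stair b a (int r). (\<beta> j, \<alpha> i) \<in> prod.swap ` S"
    using *(6) stair_swap by fastforce
  then show ?thesis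
    unfolding has_stair_def using * nu_swap by metis
qed

lemma has_stairI:
  fixes f g :: "int \<Rightarrow> int"
  assumes nu: "nu a' b' \<ge> int r" "a' \<le> 2 * int r - 1" "b' \<le> 2 * int r - 1"
    and f: "\<And>i. 1 \<le> i \<Longrightarrow> i \<le> a' \<Longrightarrow> 1 \<le> f i \<and> f i \<le> a"
    and g: "\<And>j. 1 \<le> j \<Longrightarrow> j \<le> b' \<Longrightarrow> 1 \<le> g j \<and> g j \<le> b"
    and "inj f" "inj g" and \<alpha>: "inj_on \<alpha> {1..a}" and \<beta>: "inj_on \<beta> {1..b}"
    and T: "\<And>i j. (i, j) \<in> stair a' b' (int r) \<Longrightarrow> (\<alpha> (f i), \<beta> (g j)) \<in> T"
  shows "has_stair r T"
proof -
  have "inj_on (\<alpha> \<circ> f) {1..a'}"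
    using \<open>inj f\<close> f \<alpha> by (intro comp_inj_on) (auto intro: inj_on_subset)
  moreover have "inj_on (\<beta> \<circ> g) {1..b'}"
    using \<open>inj g\<close> g \<beta> by (intro comp_inj_on) (auto intro: inj_on_subset)
  ultimately show ?thesis
    unfolding has_stair_def using nu T
    by (intro exI[of _ a'] exI[of _ b'] exI[of _ "\<alpha> \<circ> f"] exI[of _ "\<beta> \<circ> g"]) auto
qed

text \<open>
  The increasing enumerations of the integers without \<open>n\<close>, and of the integers without the distinct
  numbers \<open>l < h\<close> (without \<open>l\<close> and \<open>l + 1\<close> if \<open>l = h\<close>). They relabel the rows and columns that are left after a deletion.
\<close>
definition skip :: "int \<Rightarrow> int \<Rightarrow> int"
  where "skip n i = (if i < n then i else i + 1)"

definition skip2 :: "int \<Rightarrow> int \<Rightarrow> int \<Rightarrow> int"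
  where "skip2 l h i = (if i < l then i else if i < h - 1 then i + 1 else i + 2)"

lemma inj_skip: "inj (skip n)"
  by (rule injI) (auto simp: skip_def split: if_splits)

lemma inj_skip2: "l \<le> h \<Longrightarrow> inj (skip2 l h)"
  by (rule injI) (auto simp: skip2_def split: if_splits)

text \<open>
  This serves for a square of the first row in column \<open>j0\<close>; such squares exist only under the bound on \<open>a\<close>.
  Deleting the first row and the columns \<open>1\<close> and \<open>j0\<close> shifts the difference of row and column by \<open>0\<close> or \<open>-1\<close>,
  and the lower bound of the band of the smaller stair is larger by \<open>1\<close>.
\<close>
lemma has_stair_delete_corner:
  assumes nu: "nu a b \<ge> int (Suc r)" "a \<le> 2 * int (Suc r) - 1" "b \<le> 2 * int (Suc r) - 1"
    and \<alpha>: "inj_on \<alpha> {1..a}" and \<beta>: "inj_on \<beta> {1..b}"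
    and a: "a \<le> 2 * int r" and j0: "j0 \<ge> 2"
    and T: "\<And>i j. (i, j) \<in> stair a b (int (Suc r)) \<Longrightarrow> i \<ge> 2 \<Longrightarrow> j \<ge> 2 \<Longrightarrow> j \<noteq> j0 \<Longrightarrow> (\<alpha> i, \<beta> j) \<in> T"
  shows "has_stair r T"
proof (rule has_stairI[of r "a - 1" "b - 2" "\<lambda>i. i + 1" a "\<lambda>j. skip j0 (j + 1)" b \<alpha> \<beta>])
  show "inj (\<lambda>j. skip j0 (j + 1))"
    by (rule injI) (auto dest: injD[OF inj_skip])
  show "(\<alpha> (i + 1), \<beta> (skip j0 (j + 1))) \<in> T" if "(i, j) \<in> stair (a - 1) (b - 2) (int r)" for i j
    using that j0 nu by (intro T) (auto simp: stair_iff skip_def)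
qed (use assms in \<open>auto simp: nu_ge_iff skip_def inj_def\<close>)

text \<open>
  The row and the column of a square outside the stair can be deleted, at the price of one rank. If a side
  has the maximal length \<open>2r + 1\<close>, a second line in that direction must go as well, because a stair of rank \<open>r\<close>
  has sides of length at most \<open>2r - 1\<close>. If there are \<open>2r + 1\<close> rows and \<open>i0 \<le> j0\<close>, the last row is dropped; if
  \<open>i0 > j0\<close>, it is the row \<open>j0\<close>, and then the position of the deleted square, outside the band, guarantees that no square
  of the smaller stair to the left of column \<open>j0\<close> lies beyond both deleted rows. If both sides are maximal, the
  stair is a diagonal. For squares of the stair itself the claim can fail. A row or column that the stair
  does not meet gets the fictitious number \<open>6r + 6\<close>, which lies beyond the whole board.
\<close>
lemma has_stair_delete_cross:
  assumes nu: "nu a b \<ge> int (Suc r)" "a \<le> 2 * int (Suc r) - 1" "b \<le> 2 * int (Suc r) - 1" "r > 0"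
    and \<alpha>: "inj_on \<alpha> {1..a}" and \<beta>: "inj_on \<beta> {1..b}"
    and off: "(i0, j0) \<notin> stair a b (int (Suc r))"
    and i0: "1 \<le> i0" "i0 \<le> a \<or> i0 = 6 * int r + 6" and j0: "1 \<le> j0" "j0 \<le> b \<or> j0 = 6 * int r + 6"
    and T: "\<And>i j. (i, j) \<in> stair a b (int (Suc r)) \<Longrightarrow> i \<noteq> i0 \<Longrightarrow> j \<noteq> j0 \<Longrightarrow> (\<alpha> i, \<beta> j) \<in> T"
  shows "has_stair r T"
proof -
  consider "a \<le> 2 * int r" "b \<le> 2 * int r" | "a = 2 * int r + 1" "b \<le> 2 * int r" 
    | "a \<le> 2 * int r" "b = 2 * int r + 1" | "a = 2 * int r + 1" "b = 2 * int r + 1"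
    using nu by (cases "a \<le> 2 * int r"; cases "b \<le> 2 * int r"; simp; linarith)
  then show ?thesis
  proof cases
    case 1
    show ?thesis
    proof (rule has_stairI[of r "a - 1" "b - 1" "skip i0" a "skip j0" b \<alpha> \<beta>])
      show "(\<alpha> (skip i0 i), \<beta> (skip j0 j)) \<in> T" if "(i, j) \<in> stair (a - 1) (b - 1) (int r)" for i j
        using that nu by (intro T) (auto simp: stair_iff skip_def)
    qed (use assms 1 in \<open>auto simp: nu_ge_iff skip_def inj_skip\<close>)
  next
    case 2
    show ?thesis
    proof (cases "i0 \<le> j0")
      case True
      show ?thesis
      proof (rule has_stairI[of r "a - 2" "b - 1" "skip i0" a "skip j0" b \<alpha> \<beta>])
        show "(\<alpha> (skip i0 i), \<beta> (skip j0 j)) \<in> T" if "(i, j) \<in> stair (a - 2) (b - 1) (int r)" for i j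
          using that nu 2 True by (intro T) (auto simp: stair_iff skip_def)
      qed (use assms 2 in \<open>auto simp: nu_ge_iff skip_def inj_skip\<close>)
    next
      case False
      then have far: "i0 - j0 > 2 * int r + 1 - b"
        using off i0 j0 nu 2 by (auto simp: stair_iff nu_ge_iff)
      show ?thesis
      proof (rule has_stairI[of r "a - 2" "b - 1" "skip2 j0 i0" a "skip j0" b \<alpha> \<beta>])
        show "(\<alpha> (skip2 j0 i0 i), \<beta> (skip j0 j)) \<in> T" if "(i, j) \<in> stair (a - 2) (b - 1) (int r)" for i j
          using that nu 2 False far by (intro T) (auto simp: stair_iff skip_def skip2_def)
      qed (use assms 2 False in \<open>auto simp: nu_ge_iff skip_def skip2_def inj_skip intro!: inj_skip2\<close>)
    qed
  next
    case 3
    show ?thesis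
    proof (cases "j0 \<le> i0")
      case True
      show ?thesis
      proof (rule has_stairI[of r "a - 1" "b - 2" "skip i0" a "skip j0" b \<alpha> \<beta>])
        show "(\<alpha> (skip i0 i), \<beta> (skip j0 j)) \<in> T" if "(i, j) \<in> stair (a - 1) (b - 2) (int r)" for i j
          using that nu 3 True by (intro T) (auto simp: stair_iff skip_def)
      qed (use assms 3 in \<open>auto simp: nu_ge_iff skip_def inj_skip\<close>)
    next
      case False
      then have far: "j0 - i0 > 2 * int r + 1 - a"
        using off i0 j0 nu 3 by (auto simp: stair_iff nu_ge_iff)
      show ?thesis
      proof (rule has_stairI[of r "a - 1" "b - 2" "skip i0" a "skip2 i0 j0" b \<alpha> \<beta>])
        show "(\<alpha> (skip i0 i), \<beta> (skip2 i0 j0 j)) \<in> T" if "(i, j) \<in> stair (a - 1) (b - 2) (int r)" for i j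
          using that nu 3 False far by (intro T) (auto simp: stair_iff skip_def skip2_def)
      qed (use assms 3 False in \<open>auto simp: nu_ge_iff skip_def skip2_def inj_skip intro!: inj_skip2\<close>)
    qed
  next
    case 4
    define f where "f = skip2 (min i0 j0) (max i0 j0)"
    show ?thesis
    proof (rule has_stairI[of r "a - 2" "b - 2" f a f b \<alpha> \<beta>])
      show "(\<alpha> (f i), \<beta> (f j)) \<in> T" if "(i, j) \<in> stair (a - 2) (b - 2) (int r)" for i j
        using that nu 4 i0 j0 by (intro T) (auto simp: stair_iff f_def skip2_def min_def max_def)
    qed (use assms 4 in \<open>auto simp: nu_ge_iff f_def skip2_def min_def max_def intro!: inj_skip2\<close>)
  qed
qed

lemma has_stair_delete_corner_transposed:
  assumes nu: "nu a b \<ge> int (Suc r)" "a \<le> 2 * int (Suc r) - 1" "b \<le> 2 * int (Suc r) - 1"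
    and \<alpha>: "inj_on \<alpha> {1..a}" and \<beta>: "inj_on \<beta> {1..b}"
    and b: "b \<le> 2 * int r" and i0: "i0 \<ge> 2"
    and T: "\<And>i j. (i, j) \<in> stair a b (int (Suc r)) \<Longrightarrow> i \<ge> 2 \<Longrightarrow> j \<ge> 2 \<Longrightarrow> i \<noteq> i0 \<Longrightarrow> (\<alpha> i, \<beta> j) \<in> T"
  shows "has_stair r T"
proof -
  have "has_stair r (prod.swap ` T)"
  proof (rule has_stair_delete_corner[of r b a \<beta> \<alpha> i0])
    show "(\<beta> i, \<alpha> j) \<in> prod.swap ` T"
      if "(i, j) \<in> stair b a (int (Suc r))" "i \<ge> 2" "j \<ge> 2" "j \<noteq> i0" for i j
      using T[of j i] that stair_swap[of i j] by (force simp: image_iff)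
  qed (use assms nu_swap in \<open>simp_all add: nu_swap\<close>)
  from has_stair_swap_imp[OF this] show ?thesis
    by (simp add: image_image)
qed

lemma rook_decomposable_finite: "rook_decomposable r S \<Longrightarrow> finite S"
  by (induction rule: rook_decomposable.induct) auto

text \<open>
  The squares of \<open>T - S\<close> are added one at a time, in any order. The hypothesis on links is monotone in the
  set of squares, so the squares added before do no harm.
\<close>
lemma rook_decomposable_superset:
  assumes S: "rook_decomposable (Suc r) S" and "finite T" "S \<subseteq> T"
    and link: "\<And>q U. q \<in> T - S \<Longrightarrow> finite U \<Longrightarrow> {u \<in> S. nonattacking u q} \<subseteq> U \<Longrightarrow> rook_decomposable r U"
  shows "rook_decomposable (Suc r) T"
proof -
  have "rook_decomposable (Suc r) (S \<union> D)" if "finite D" "D \<subseteq> T - S" for D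
    using that
  proof (induction D rule: finite_induct)
    case empty
    then show ?case using S by simp
  next
    case (insert q D)
    have "rook_decomposable r {u \<in> S \<union> D. nonattacking u q}"
      using insert rook_decomposable_finite[OF S] by (intro link) auto
    with insert show ?case
      using rook_decomposable.shed[of r "S \<union> D" q] by auto
  qed
  from this[of "T - S"] assms show ?thesis
    by (simp add: Un_absorb1)
qed

text \<open>
  By induction on the rank, in three stages. The squares outside the first row and the first column,
  together with the corner, form a cone. The other squares of the first row and column are added next;
  their links contain smaller stairs that avoid the first row and the first column altogether, so the order
  in which these squares come is immaterial. This gives
  the stair itself, and squares outside the stair have links that contain smaller stairs by
  \<open>has_stair_delete_cross\<close>.
\<close>
lemma has_stair_imp_rook_decomposable:
  "finite T \<Longrightarrow> r = 0 \<or> has_stair r T \<Longrightarrow> rook_decomposable r T"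
proof (induction r arbitrary: T)
  case 0
  then show ?case by (simp add: rook_decomposable.trivial)
next
  case (Suc r)
  then have "has_stair (Suc r) T" by simp
  then obtain a b \<alpha> \<beta> where nu: "nu a b \<ge> int (Suc r)" "a \<le> 2 * int (Suc r) - 1" "b \<le> 2 * int (Suc r) - 1"
    and \<alpha>: "inj_on \<alpha> {1..a}" and \<beta>: "inj_on \<beta> {1..b}"
    and T: "\<And>i j. (i, j) \<in> stair a b (int (Suc r)) \<Longrightarrow> (\<alpha> i, \<beta> j) \<in> T"
    unfolding has_stair_def by fast
  let ?st = "stair a b (int (Suc r))"
  let ?sq = "\<lambda>(i, j). (\<alpha> i, \<beta> j)"
  \<comment> \<open>The stair, and its part \<open>C\<close> outside the first row and the first column.\<close>
  define S where "S = ?sq ` ?st"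
  define C where "C = {(i, j) \<in> ?st. i \<ge> 2 \<and> j \<ge> 2}"
  have ST: "S \<subseteq> T" using T by (auto simp: S_def)
  have finS: "finite S" using ST Suc.prems finite_subset by blast
  have CS: "?sq ` C \<subseteq> S" by (auto simp: C_def S_def)
  have finC: "finite (?sq ` C)" using CS finS finite_subset by blast
  have one: "(1, 1) \<in> ?st" using nu by (auto simp: stair_iff nu_ge_iff)
  have \<alpha>_eq: "\<alpha> i = \<alpha> i' \<longleftrightarrow> i = i'" if "1 \<le> i" "i \<le> a" "1 \<le> i'" "i' \<le> a" for i i'
    using \<alpha> that by (auto simp: inj_on_def)
  have \<beta>_eq: "\<beta> j = \<beta> j' \<longleftrightarrow> j = j'" if "1 \<le> j" "j \<le> b" "1 \<le> j'" "j' \<le> b" for j j'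
    using \<beta> that by (auto simp: inj_on_def)
  have linkC: "r = 0 \<or> has_stair r (?sq ` C)"
  proof (cases "r = 0")
    case False
    consider "a \<le> 2 * int r" | "b \<le> 2 * int r" | "a = 2 * int r + 1" "b = 2 * int r + 1"
      using nu by (cases "a \<le> 2 * int r"; cases "b \<le> 2 * int r"; simp; linarith)
    then have "has_stair r (?sq ` C)"
    proof cases
      case 1
      show ?thesis
        by (rule has_stair_delete_corner[OF nu \<alpha> \<beta> 1, of 2]) (auto simp: C_def)
    next
      case 2
      show ?thesis
        by (rule has_stair_delete_corner_transposed[OF nu \<alpha> \<beta> 2, of 2]) (auto simp: C_def)
    next
      case 3
      show ?thesis
      proof (rule has_stairI[of r "a - 2" "b - 2" "\<lambda>i. i + 1" a "\<lambda>i. i + 1" b \<alpha> \<beta>])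
        show "(\<alpha> (i + 1), \<beta> (j + 1)) \<in> ?sq ` C" if "(i, j) \<in> stair (a - 2) (b - 2) (int r)" for i j
          using that 3 by (intro image_eqI[of _ _ "(i + 1, j + 1)"]) (auto simp: C_def stair_iff)
      qed (use nu 3 \<alpha> \<beta> False in \<open>auto simp: nu_ge_iff inj_def\<close>)
    qed
    then show ?thesis ..
  qed simp
  have "rook_decomposable r (?sq ` C)"
    using Suc.IH linkC finC by blast
  then have "rook_decomposable (Suc r) (insert (?sq (1, 1)) (?sq ` C))"
    by (rule rook_decomposable.cone) (use nu in \<open>auto simp: C_def nonattacking_def stair_iff \<alpha>_eq \<beta>_eq\<close>)
  then have S_dec: "rook_decomposable (Suc r) S"
  proof (rule rook_decomposable_superset)
    show "insert (?sq (1, 1)) (?sq ` C) \<subseteq> S"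
      using CS one by (auto simp: S_def)
    fix q U
    assume q: "q \<in> S - insert (?sq (1, 1)) (?sq ` C)" and U: "finite U"
      and sub: "{u \<in> insert (?sq (1, 1)) (?sq ` C). nonattacking u q} \<subseteq> U"
    obtain i j where ij: "(i, j) \<in> ?st" "q = (\<alpha> i, \<beta> j)"
      using q by (auto simp: S_def)
    have U': "(\<alpha> i', \<beta> j') \<in> U" if "(i', j') \<in> ?st" "i' \<ge> 2" "j' \<ge> 2" "i' \<noteq> i" "j' \<noteq> j" for i' j'
    proof (rule subsetD[OF sub], intro CollectI conjI)
      show "(\<alpha> i', \<beta> j') \<in> insert (?sq (1, 1)) (?sq ` C)"
        using that by (auto simp: C_def)
      show "nonattacking (\<alpha> i', \<beta> j') q"
        using that ij by (auto simp: nonattacking_def stair_iff \<alpha>_eq \<beta>_eq)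
    qed
    have "(i, j) \<notin> C" "(i, j) \<noteq> (1, 1)" using q ij by auto
    then consider "i = 1" "j \<ge> 2" | "j = 1" "i \<ge> 2"
      using ij by (auto simp: C_def stair_iff; linarith)
    then have "has_stair r U"
    proof cases
      case 1
      then have "a \<le> 2 * int r" using ij by (auto simp: stair_iff)
      then show ?thesis
        by (rule has_stair_delete_corner[OF nu \<alpha> \<beta> _ \<open>j \<ge> 2\<close>]) (use U' 1 in auto)
    next
      case 2
      then have "b \<le> 2 * int r" using ij by (auto simp: stair_iff)
      then show ?thesis
        by (rule has_stair_delete_corner_transposed[OF nu \<alpha> \<beta> _ \<open>i \<ge> 2\<close>]) (use U' 2 in auto)
    qed
    then show "rook_decomposable r U"
      using Suc.IH U by blast
  qed (use finS in auto)
  show ?case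
  proof (rule rook_decomposable_superset[OF S_dec _ ST])
    fix q U
    assume q: "q \<in> T - S" and U: "finite U" "{u \<in> S. nonattacking u q} \<subseteq> U"
    \<comment> \<open>The position of \<open>q\<close> relative to the stair, with a number beyond the board for a row or column that the stair does not meet.\<close>
    define i0 where "i0 = (if fst q \<in> \<alpha> ` {1..a} then inv_into {1..a} \<alpha> (fst q) else 6 * int r + 6)"
    define j0 where "j0 = (if snd q \<in> \<beta> ` {1..b} then inv_into {1..b} \<beta> (snd q) else 6 * int r + 6)"
    have i0: "1 \<le> i0" "i0 \<le> a \<or> i0 = 6 * int r + 6"
      using inv_into_into[of "fst q" \<alpha> "{1..a}"] by (auto simp: i0_def)
    have j0: "1 \<le> j0" "j0 \<le> b \<or> j0 = 6 * int r + 6"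
      using inv_into_into[of "snd q" \<beta> "{1..b}"] by (auto simp: j0_def)
    have row: "\<alpha> i \<noteq> fst q" if "i \<noteq> i0" "1 \<le> i" "i \<le> a" for i
    proof
      assume *: "\<alpha> i = fst q"
      have "fst q \<in> \<alpha> ` {1..a}" using * that by (auto intro!: image_eqI[of _ _ i])
      moreover have "inv_into {1..a} \<alpha> (fst q) = i"
        using * that \<alpha> by (intro inv_into_f_eq) auto
      ultimately show False using that by (simp add: i0_def)
    qed
    have col: "\<beta> j \<noteq> snd q" if "j \<noteq> j0" "1 \<le> j" "j \<le> b" for j
    proof
      assume *: "\<beta> j = snd q"
      have "snd q \<in> \<beta> ` {1..b}" using * that by (auto intro!: image_eqI[of _ _ j])
      moreover have "inv_into {1..b} \<beta> (snd q) = j"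
        using * that \<beta> by (intro inv_into_f_eq) auto
      ultimately show False using that by (simp add: j0_def)
    qed
    have off: "(i0, j0) \<notin> ?st"
    proof
      assume *: "(i0, j0) \<in> ?st"
      then have "fst q \<in> \<alpha> ` {1..a}" "snd q \<in> \<beta> ` {1..b}"
        using nu by (auto simp: i0_def j0_def stair_iff split: if_splits)
      then have "\<alpha> i0 = fst q" "\<beta> j0 = snd q"
        by (auto simp: i0_def j0_def f_inv_into_f)
      then show False using * q by (auto simp: S_def image_iff)
    qed
    have "r = 0 \<or> has_stair r U"
    proof (cases "r = 0")
      case False
      then have "has_stair r U"
        by (intro has_stair_delete_cross[OF nu _ \<alpha> \<beta> off i0 j0] subsetD[OF U(2)])
          (auto simp: S_def nonattacking_def stair_iff row col)
      then show ?thesis ..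
    qed simp
    then show "rook_decomposable r U"
      using Suc.IH U by blast
  qed (use Suc.prems in auto)
qed

section \<open>Acyclicity of complexes of non-taking rooks\<close>

(* These simplification rules would turn sums over the two-element field into bit operations, and x ~= 0 into x = 1. *)
declare add_bit_eq_xor [simp del] mult_bit_eq_and [simp del] bit_not_zero_iff [simp del]

text \<open>
  Chains with coefficients modulo 2 are functions on finite sets of vertices. The boundary is written as a sum over
  cofaces within the vertex set \<open>V\<close>. The empty set counts as a simplex, so this is the
  augmented complex, and the coefficient of \<open>{}\<close> in the boundary of a 0-chain is its parity.
\<close>
definition bd :: "'v set \<Rightarrow> ('v set \<Rightarrow> bit) \<Rightarrow> 'v set \<Rightarrow> bit"
  where "bd V z f = (\<Sum>v\<in>V - f. z (insert v f))"

text \<open>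
  The degree \<open>k\<close> is the number of vertices of the simplices, one more than their dimension.
\<close>
definition chain_space :: "'v set set \<Rightarrow> nat \<Rightarrow> ('v set \<Rightarrow> bit) set"
  where "chain_space K k = {z. \<forall>\<sigma>. z \<sigma> \<noteq> 0 \<longrightarrow> \<sigma> \<in> K \<and> finite \<sigma> \<and> card \<sigma> = k}"

text \<open>
  The vertices lie over squares via \<open>sq\<close>, which need not be injective. Distinct vertices over the same square attack
  each other, as they share their row.
\<close>
definition rooks :: "('q \<Rightarrow> 'x \<times> 'y) \<Rightarrow> 'q set \<Rightarrow> 'q set set"
  where "rooks sq Q = {\<sigma>. \<sigma> \<subseteq> Q \<and> pairwise (\<lambda>u v. nonattacking (sq u) (sq v)) \<sigma>}"

definition acyclic_upto :: "'q set \<Rightarrow> ('q \<Rightarrow> 'x \<times> 'y) \<Rightarrow> nat \<Rightarrow> 'q set \<Rightarrow> bool"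
  where "acyclic_upto V sq r Q \<longleftrightarrow> (\<forall>k<r. \<forall>z\<in>chain_space (rooks sq Q) k.
    bd V z = 0 \<longrightarrow> (\<exists>y\<in>chain_space (rooks sq Q) (Suc k). bd V y = z))"

definition cone_over :: "'v \<Rightarrow> ('v set \<Rightarrow> bit) \<Rightarrow> 'v set \<Rightarrow> bit"
  where "cone_over q y \<sigma> = (if q \<in> \<sigma> then y (\<sigma> - {q}) else 0)"

lemma bit_add_self [simp]: "x + x = (0::bit)"
  by (cases x) simp_all

lemma bit_fun_add_self [simp]: "z + z = (0::'a \<Rightarrow> bit)"
  by (simp add: fun_eq_iff)

lemma bit_fun_add_eq_0_iff: "y + z = (0::'a \<Rightarrow> bit) \<longleftrightarrow> y = z"
  using add_left_cancel[of y y z] by (metis bit_fun_add_self add_left_cancel)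

lemma bd_add: "bd V (y + z) = bd V y + bd V z"
  by (rule ext) (simp add: bd_def sum.distrib)

lemma bd_0 [simp]: "bd V 0 = 0"
  by (rule ext) (simp add: bd_def)

lemma chain_space_add: "y \<in> chain_space K k \<Longrightarrow> z \<in> chain_space K k \<Longrightarrow> y + z \<in> chain_space K k"
  unfolding chain_space_def by (simp, metis add_0)

lemma chain_space_mono: "z \<in> chain_space K k \<Longrightarrow> K \<subseteq> L \<Longrightarrow> z \<in> chain_space L k"
  by (auto simp: chain_space_def)

lemma rooks_mono: "Q \<subseteq> R \<Longrightarrow> rooks sq Q \<subseteq> rooks sq R"
  by (auto simp: rooks_def)

lemma bd_cone_over:
  assumes "finite V" "q \<in> V" and y: "\<And>\<sigma>. q \<in> \<sigma> \<Longrightarrow> y \<sigma> = 0"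
  shows "bd V (cone_over q y) = y + cone_over q (bd V y)"
proof (rule ext)
  fix f
  show "bd V (cone_over q y) f = (y + cone_over q (bd V y)) f"
  proof (cases "q \<in> f")
    case True
    have "V - (f - {q}) = insert q (V - f)" using True assms by auto
    then have "bd V y (f - {q}) = y (insert q (f - {q})) + (\<Sum>v\<in>V - f. y (insert v (f - {q})))"
      using True assms by (simp add: bd_def)
    also have "y (insert q (f - {q})) = 0"
      using y by blast
    also have "0 + (\<Sum>v\<in>V - f. y (insert v (f - {q}))) = (\<Sum>v\<in>V - f. y (insert v f - {q}))"
      using True by (auto simp: insert_Diff_if intro!: sum.cong)
    also have "\<dots> = bd V (cone_over q y) f"
      using True by (simp add: bd_def cone_over_def)
    finally show ?thesis using True y by (simp add: cone_over_def)
  next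
    case False
    have "bd V (cone_over q y) f = (\<Sum>v\<in>V - f. if v = q then y f else 0)"
      unfolding bd_def using False by (intro sum.cong) (auto simp: cone_over_def)
    also have "\<dots> = y f" using assms False by simp
    finally show ?thesis using False by (simp add: cone_over_def)
  qed
qed

text \<open>
  A cycle is the sum of its part \<open>z0\<close> that avoids \<open>q\<close> and a cone with apex \<open>q\<close> over a chain \<open>u\<close> in the link of
  \<open>q\<close>. Comparing the coefficients of simplices with and without \<open>q\<close> in the boundary shows that \<open>u\<close> is a
  cycle and that it bounds \<open>z0\<close>.
\<close>
lemma split_cycle:
  assumes "finite V" "q \<in> V" and z: "z \<in> chain_space (rooks sq (insert q Q)) k" and "bd V z = 0" "q \<notin> Q"
  obtains z0 u where "z0 \<in> chain_space (rooks sq Q) k" "z = z0 + cone_over q u" "bd V z0 = u" "bd V u = 0"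
    "\<And>k'. k = Suc k' \<Longrightarrow> u \<in> chain_space (rooks sq {v \<in> Q. nonattacking (sq v) (sq q)}) k'" "k = 0 \<Longrightarrow> u = 0"
proof -
  define z0 where "z0 = (\<lambda>\<sigma>. if q \<in> \<sigma> then 0 else z \<sigma>)"
  define u where "u = (\<lambda>\<sigma>. if q \<in> \<sigma> then 0 else z (insert q \<sigma>))"
  have z_eq: "z = z0 + cone_over q u"
    by (auto simp: fun_eq_iff z0_def u_def cone_over_def insert_absorb)
  have 1: "bd V z0 + (u + cone_over q (bd V u)) = 0"
    using assms bd_cone_over[of V q u] by (simp add: z_eq bd_add u_def)
  have z0q: "bd V z0 f = 0" if "q \<in> f" for f
    using that by (simp add: bd_def z0_def)
  have uq: "bd V u f = 0" if "q \<in> f" for f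
    using that by (simp add: bd_def u_def)
  have bdu: "bd V u = 0"
  proof
    fix f
    show "bd V u f = 0 f"
    proof (cases "q \<in> f")
      case False
      then show ?thesis
        using fun_cong[OF 1, of "insert q f"] z0q[of "insert q f"] by (simp add: cone_over_def u_def)
    qed (simp add: uq)
  qed
  have "cone_over q (bd V u) = 0"
    by (auto simp: bdu cone_over_def)
  then have bdz0: "bd V z0 = u"
    using 1 by (simp add: bit_fun_add_eq_0_iff)
  show ?thesis
  proof (rule that[OF _ z_eq bdz0 bdu])
    show "z0 \<in> chain_space (rooks sq Q) k"
      using z by (auto simp: chain_space_def rooks_def z0_def)
    have u_supp: "insert q \<sigma> \<in> rooks sq (insert q Q) \<and> finite \<sigma> \<and> card (insert q \<sigma>) = k \<and> q \<notin> \<sigma>"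
      if "u \<sigma> \<noteq> 0" for \<sigma>
      using that z by (auto simp: chain_space_def u_def split: if_splits)
    show "u \<in> chain_space (rooks sq {v \<in> Q. nonattacking (sq v) (sq q)}) k'" if k: "k = Suc k'" for k'
    proof -
      have "\<sigma> \<in> rooks sq {v \<in> Q. nonattacking (sq v) (sq q)} \<and> finite \<sigma> \<and> card \<sigma> = k'" if "u \<sigma> \<noteq> 0" for \<sigma>
        using u_supp[OF that] k by (auto simp: rooks_def pairwise_insert nonattacking_def)
      then show ?thesis by (auto simp: chain_space_def)
    qed
    show "u = 0" if "k = 0"
    proof (rule ext, rule ccontr)
      fix \<sigma> assume "u \<sigma> \<noteq> 0 \<sigma>"
      then have "u \<sigma> \<noteq> 0" by simp
      then show False using u_supp[of \<sigma>] that by (metis card_0_eq finite_insert insert_not_empty)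
    qed
  qed
qed

lemma cone_over_in_chain_space:
  assumes "y \<in> chain_space (rooks sq {v \<in> Q. nonattacking (sq v) (sq q)}) k"
  shows "cone_over q y \<in> chain_space (rooks sq (insert q Q)) (Suc k)"
proof -
  have "\<sigma> \<in> rooks sq (insert q Q) \<and> finite \<sigma> \<and> card \<sigma> = Suc k" if "cone_over q y \<sigma> \<noteq> 0" for \<sigma>
  proof -
    have q: "q \<in> \<sigma>" and y: "y (\<sigma> - {q}) \<noteq> 0"
      using that by (auto simp: cone_over_def split: if_splits)
    define \<tau> where "\<tau> = \<sigma> - {q}"
    have \<sigma>: "\<sigma> = insert q \<tau>" "q \<notin> \<tau>" using q by (auto simp: \<tau>_def)
    have "\<tau> \<in> rooks sq {v \<in> Q. nonattacking (sq v) (sq q)}" "finite \<tau>" "card \<tau> = k"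
      using y assms by (auto simp: \<tau>_def chain_space_def)
    then show ?thesis unfolding \<sigma>
      using \<sigma>(2) by (auto simp: rooks_def pairwise_insert nonattacking_def)
  qed
  then show ?thesis by (auto simp: chain_space_def)
qed

lemma acyclic_upto_cone:
  assumes "finite V" "q \<in> V" "q \<notin> Q" and cone: "\<forall>v\<in>Q. nonattacking (sq v) (sq q)"
  shows "acyclic_upto V sq r (insert q Q)"
  unfolding acyclic_upto_def
proof (intro allI impI ballI)
  fix k z
  assume z: "z \<in> chain_space (rooks sq (insert q Q)) k" "bd V z = 0"
  obtain z0 u where z0: "z0 \<in> chain_space (rooks sq Q) k" "z = z0 + cone_over q u" "bd V z0 = u"
    using split_cycle[OF assms(1,2) z \<open>q \<notin> Q\<close>] by metis
  have Q: "{v \<in> Q. nonattacking (sq v) (sq q)} = Q" using cone by auto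
  have "z0 \<sigma> = 0" if "q \<in> \<sigma>" for \<sigma>
    using z0(1) that \<open>q \<notin> Q\<close> by (auto simp: chain_space_def rooks_def)
  then have "bd V (cone_over q z0) = z"
    using bd_cone_over[OF assms(1,2)] z0 by simp
  moreover have "cone_over q z0 \<in> chain_space (rooks sq (insert q Q)) (Suc k)"
    using cone_over_in_chain_space[of z0 sq Q q k] z0 by (simp add: Q)
  ultimately show "\<exists>y\<in>chain_space (rooks sq (insert q Q)) (Suc k). bd V y = z" by blast
qed

text \<open>
  The Mayer-Vietoris argument for attaching a cone over the link of \<open>q\<close>: fill the cycle \<open>u\<close> of the link by
  \<open>y\<close> within the link, and then the cycle \<open>z0 + y\<close> within the old complex.
\<close>
lemma acyclic_upto_insert:
  assumes "finite V" "q \<in> V" "q \<notin> Q" and Q: "acyclic_upto V sq (Suc r) Q"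
    and link: "acyclic_upto V sq r {v \<in> Q. nonattacking (sq v) (sq q)}"
  shows "acyclic_upto V sq (Suc r) (insert q Q)"
  unfolding acyclic_upto_def
proof (intro allI impI ballI)
  fix k z
  assume k: "k < Suc r" and z: "z \<in> chain_space (rooks sq (insert q Q)) k" "bd V z = 0"
  obtain z0 u where z0: "z0 \<in> chain_space (rooks sq Q) k" "z = z0 + cone_over q u" "bd V z0 = u" "bd V u = 0"
    and u: "\<And>k'. k = Suc k' \<Longrightarrow> u \<in> chain_space (rooks sq {v \<in> Q. nonattacking (sq v) (sq q)}) k'" "k = 0 \<Longrightarrow> u = 0"
    by (rule split_cycle[OF assms(1,2) z \<open>q \<notin> Q\<close>], rule that)
  have "\<exists>y\<in>chain_space (rooks sq {v \<in> Q. nonattacking (sq v) (sq q)}) k. bd V y = u"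
  proof (cases k)
    case 0
    then show ?thesis using u(2) by (intro bexI[of _ 0]) (auto simp: chain_space_def)
  next
    case (Suc k')
    then show ?thesis using link u(1) z0(4) k unfolding acyclic_upto_def by auto
  qed
  then obtain y where y: "y \<in> chain_space (rooks sq {v \<in> Q. nonattacking (sq v) (sq q)}) k" "bd V y = u" by blast
  have "y \<in> chain_space (rooks sq Q) k"
    using y(1) by (rule chain_space_mono) (rule rooks_mono, auto)
  then have "z0 + y \<in> chain_space (rooks sq Q) k" "bd V (z0 + y) = 0"
    using z0 y chain_space_add by (auto simp: bd_add)
  then obtain y' where y': "y' \<in> chain_space (rooks sq Q) (Suc k)" "bd V y' = z0 + y"
    using Q k unfolding acyclic_upto_def by blast
  have "y \<sigma> = 0" if "q \<in> \<sigma>" for \<sigma>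
    using y(1) that \<open>q \<notin> Q\<close> by (auto simp: chain_space_def rooks_def)
  then have "bd V (cone_over q y) = y + cone_over q u"
    using bd_cone_over[OF assms(1,2)] y by simp
  then have "bd V (y' + cone_over q y) = z0 + (y + y) + cone_over q u"
    by (simp only: bd_add y' add.assoc)
  then have "bd V (y' + cone_over q y) = z"
    using z0 by simp
  moreover have "y' + cone_over q y \<in> chain_space (rooks sq (insert q Q)) (Suc k)"
    using y' cone_over_in_chain_space[OF y(1)] rooks_mono[of Q "insert q Q" sq]
    by (intro chain_space_add) (auto intro: chain_space_mono)
  ultimately show "\<exists>y\<in>chain_space (rooks sq (insert q Q)) (Suc k). bd V y = z" by blast
qed

lemma acyclic_upto_0: "acyclic_upto V sq 0 Q"
  by (simp add: acyclic_upto_def)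

text \<open>
  Copies of the same square do not occur in each other's links, so all of them have the same link.
\<close>
lemma acyclic_upto_add_copies:
  assumes "finite V" "finite D" "D \<subseteq> V" "D \<inter> Q = {}" and D: "\<And>q. q \<in> D \<Longrightarrow> sq q = s"
    and Q: "acyclic_upto V sq (Suc r) Q"
    and link: "acyclic_upto V sq r {v \<in> Q. nonattacking (sq v) s}"
  shows "acyclic_upto V sq (Suc r) (Q \<union> D)"
  using assms(2-5)
proof (induction D rule: finite_induct)
  case empty
  then show ?case using Q by simp
next
  case (insert q D)
  have "{v \<in> Q \<union> D. nonattacking (sq v) (sq q)} = {v \<in> Q. nonattacking (sq v) s}"
    using insert by (auto simp: nonattacking_def)
  then show ?case
    using acyclic_upto_insert[of V q "Q \<union> D" sq r] insert assms(1) link by auto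
qed

lemma rook_decomposable_imp_acyclic:
  assumes "rook_decomposable r S" "finite V" "Q \<subseteq> V" "sq ` Q = S"
  shows "acyclic_upto V sq r Q"
  using assms(1,3,4)
proof (induction arbitrary: Q rule: rook_decomposable.induct)
  case (trivial S)
  then show ?case by (simp add: acyclic_upto_0)
next
  case (cone r S q)
  define R where "R = {v \<in> Q. sq v \<in> S}"
  have fin: "finite Q" using cone.prems assms(2) finite_subset by blast
  have qS: "q \<notin> S" using cone.hyps by (auto simp: nonattacking_def)
  have "q \<in> sq ` Q" using cone.prems by simp
  then obtain q0 where q0: "q0 \<in> Q" "sq q0 = q" by auto
  define D where "D = {v \<in> Q. sq v = q} - {q0}"
  have QD: "Q = insert q0 R \<union> D" using cone.prems q0 by (auto simp: R_def D_def)
  have R: "acyclic_upto V sq r R"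
    using cone.prems by (intro cone.IH) (auto simp: R_def image_iff, metis imageE insertI2)
  have "{v \<in> insert q0 R. nonattacking (sq v) q} = R"
    using q0 cone.hyps(2) by (auto simp: R_def nonattacking_def)
  with R have "acyclic_upto V sq (Suc r) (insert q0 R \<union> D)"
    using q0 qS cone.prems cone.hyps fin assms(2)
    by (intro acyclic_upto_add_copies[where s = q] acyclic_upto_cone) (auto simp: D_def R_def)
  then show ?case by (simp only: QD)
next
  case (shed r S q)
  define R where "R = {v \<in> Q. sq v \<in> S}"
  define D where "D = {v \<in> Q. sq v = q}"
  have fin: "finite Q" using shed.prems assms(2) finite_subset by blast
  have QD: "Q = R \<union> D" using shed.prems by (auto simp: R_def D_def)
  have "sq ` R = S" using shed.prems shed.hyps(2) by (auto simp: R_def)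
  then have R: "acyclic_upto V sq (Suc r) R"
    using shed.prems by (intro shed.IH(1)) (auto simp: R_def)
  have Rq: "sq ` {v \<in> R. nonattacking (sq v) q} = {u \<in> S. nonattacking u q}"
    using \<open>sq ` R = S\<close> by blast
  have "acyclic_upto V sq r {v \<in> R. nonattacking (sq v) q}"
    using Rq shed.prems by (intro shed.IH(2)) (auto simp: R_def)
  with R have "acyclic_upto V sq (Suc r) (R \<union> D)"
    using shed.prems shed.hyps(2) fin assms(2)
    by (intro acyclic_upto_add_copies[where s = q]) (auto simp: D_def R_def)
  then show ?case by (simp only: QD)
qed

section \<open>Parity of crossings for generic positions\<close>

definition relation_upto :: "('v \<Rightarrow> nat \<Rightarrow> real) \<Rightarrow> nat \<Rightarrow> 'v set \<Rightarrow> ('v \<Rightarrow> real) \<Rightarrow> bool"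
  where "relation_upto F k \<sigma> \<alpha> \<longleftrightarrow> (\<forall>j<k. (\<Sum>v\<in>\<sigma>. \<alpha> v * F v j) = 0)"

definition convex_weights :: "'v set \<Rightarrow> ('v \<Rightarrow> real) \<Rightarrow> bool"
  where "convex_weights \<sigma> \<alpha> \<longleftrightarrow> (\<forall>v\<in>\<sigma>. \<alpha> v \<ge> 0) \<and> sum \<alpha> \<sigma> = 1"

text \<open>
  The convex hull of the positions \<open>F v\<close>, \<open>v \<in> \<sigma>\<close>, meets the coordinate subspace of codimension \<open>k\<close> on
  which the first \<open>k\<close> coordinates vanish.
\<close>
definition crosses :: "('v \<Rightarrow> nat \<Rightarrow> real) \<Rightarrow> nat \<Rightarrow> 'v set \<Rightarrow> bool"
  where "crosses F k \<sigma> \<longleftrightarrow> (\<exists>\<alpha>. convex_weights \<sigma> \<alpha> \<and> relation_upto F k \<sigma> \<alpha>)"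

text \<open>
  The same for the half of that subspace with positive next coordinate. The boundary of this half is
  the subspace of codimension \<open>k + 1\<close>.
\<close>
definition crosses_above :: "('v \<Rightarrow> nat \<Rightarrow> real) \<Rightarrow> nat \<Rightarrow> 'v set \<Rightarrow> bool"
  where "crosses_above F k \<sigma> \<longleftrightarrow>
    (\<exists>\<alpha>. convex_weights \<sigma> \<alpha> \<and> relation_upto F k \<sigma> \<alpha> \<and> (\<Sum>v\<in>\<sigma>. \<alpha> v * F v k) > 0)"

text \<open>
  Any \<open>k\<close> of the vectors, for \<open>k \<le> d\<close>, are linearly independent already after projection to the first \<open>k\<close>
  coordinates. So a simplex with at most \<open>k\<close> vertices does not meet the subspace of codimension \<open>k\<close>.
\<close>
definition generic :: "('v \<Rightarrow> nat \<Rightarrow> real) \<Rightarrow> nat \<Rightarrow> 'v set \<Rightarrow> bool"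
  where "generic F d \<sigma> \<longleftrightarrow> (\<forall>k\<le>d. \<forall>\<rho>\<subseteq>\<sigma>. card \<rho> \<le> k \<longrightarrow>
    (\<forall>\<alpha>. relation_upto F k \<rho> \<alpha> \<longrightarrow> (\<forall>v\<in>\<rho>. \<alpha> v = 0)))"

text \<open>Gaussian elimination: a homogeneous system with more unknowns than equations.\<close>
lemma nontrivial_solution:
  fixes M :: "'v \<Rightarrow> 'e \<Rightarrow> real"
  assumes "finite E" "finite \<rho>" "card E < card \<rho>"
  shows "\<exists>\<mu>. (\<forall>e\<in>E. (\<Sum>v\<in>\<rho>. \<mu> v * M v e) = 0) \<and> (\<exists>v\<in>\<rho>. \<mu> v \<noteq> 0)"
  using assms
proof (induction E arbitrary: \<rho> M rule: finite_induct)
  case empty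
  then have "\<rho> \<noteq> {}" by auto
  then show ?case by (intro exI[of _ "\<lambda>_. 1"]) auto
next
  case (insert e E)
  show ?case
  proof (cases "\<forall>v\<in>\<rho>. M v e = 0")
    case True
    then show ?thesis
      using insert.IH[of \<rho> M] insert.prems insert.hyps by auto
  next
    case False
    then obtain p where p: "p \<in> \<rho>" "M p e \<noteq> 0" by blast
    define \<rho>' where "\<rho>' = \<rho> - {p}"
    define M' where "M' = (\<lambda>v j. M v j - M v e / M p e * M p j)"
    have "card E < card \<rho>'" "finite \<rho>'"
      using insert.prems insert.hyps p by (auto simp: \<rho>'_def)
    then obtain \<mu> where \<mu>: "\<And>e. e \<in> E \<Longrightarrow> (\<Sum>v\<in>\<rho>'. \<mu> v * M' v e) = 0" "\<exists>v\<in>\<rho>'. \<mu> v \<noteq> 0"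
      using insert.IH[of \<rho>' M'] by blast
    define \<nu> where "\<nu> = \<mu>(p := - (\<Sum>v\<in>\<rho>'. \<mu> v * M v e) / M p e)"
    have split: "(\<Sum>v\<in>\<rho>. \<nu> v * M v j) = (\<Sum>v\<in>\<rho>'. \<mu> v * M' v j)" for j
    proof -
      have "(\<Sum>v\<in>\<rho>. \<nu> v * M v j) = \<nu> p * M p j + (\<Sum>v\<in>\<rho>'. \<mu> v * M v j)"
        using insert.prems p by (subst sum.remove[of _ p]) (auto simp: \<rho>'_def \<nu>_def intro!: sum.cong)
      also have "\<nu> p * M p j = - (\<Sum>v\<in>\<rho>'. \<mu> v * (M v e / M p e * M p j))"
        by (simp add: \<nu>_def sum_distrib_right sum_divide_distrib mult.assoc)
      also have "\<dots> + (\<Sum>v\<in>\<rho>'. \<mu> v * M v j) = (\<Sum>v\<in>\<rho>'. \<mu> v * M' v j)"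
        by (simp add: M'_def algebra_simps sum_subtractf)
      finally show ?thesis .
    qed
    have "M' v e = 0" for v
      using p by (simp add: M'_def)
    then have "\<forall>j\<in>insert e E. (\<Sum>v\<in>\<rho>. \<nu> v * M v j) = 0"
      using split \<mu> by simp
    moreover have "\<exists>v\<in>\<rho>. \<nu> v \<noteq> 0"
      using \<mu>(2) by (auto simp: \<nu>_def \<rho>'_def)
    ultimately show ?thesis by blast
  qed
qed

lemma relation_upto_combine:
  assumes "relation_upto F k \<sigma> \<alpha>" "relation_upto F k \<sigma> \<mu>"
  shows "relation_upto F k \<sigma> (\<lambda>v. a * \<alpha> v + b * \<mu> v)"
proof -
  have "(\<Sum>v\<in>\<sigma>. (a * \<alpha> v + b * \<mu> v) * F v j) = a * (\<Sum>v\<in>\<sigma>. \<alpha> v * F v j) + b * (\<Sum>v\<in>\<sigma>. \<mu> v * F v j)" for j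
    by (simp add: algebra_simps sum.distrib sum_distrib_left)
  then show ?thesis using assms by (simp add: relation_upto_def)
qed

lemma relation_upto_support:
  assumes "finite \<sigma>" "\<rho> \<subseteq> \<sigma>" "\<And>v. v \<in> \<sigma> - \<rho> \<Longrightarrow> \<alpha> v = 0"
  shows "relation_upto F k \<rho> \<alpha> \<longleftrightarrow> relation_upto F k \<sigma> \<alpha>"
proof -
  have "(\<Sum>v\<in>\<rho>. \<alpha> v * F v j) = (\<Sum>v\<in>\<sigma>. \<alpha> v * F v j)" for j
    using assms by (intro sum.mono_neutral_left) auto
  then show ?thesis by (simp add: relation_upto_def)
qed

lemma generic_vanish:
  assumes "generic F d \<sigma>" "finite \<sigma>" "k \<le> d" "relation_upto F k \<sigma> \<alpha>"
    "\<And>v. v \<in> Z \<Longrightarrow> \<alpha> v = 0" "Z \<subseteq> \<sigma>" "card \<sigma> \<le> k + card Z" "v \<in> \<sigma>"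
  shows "\<alpha> v = 0"
proof (cases "v \<in> Z")
  case False
  have "relation_upto F k (\<sigma> - Z) \<alpha>"
    using assms by (subst relation_upto_support[of \<sigma>]) auto
  moreover have "card (\<sigma> - Z) \<le> k"
    using assms finite_subset[of Z \<sigma>] by (simp add: card_Diff_subset)
  ultimately show ?thesis
    using assms(1,3,8) False unfolding generic_def by (meson Diff_iff Diff_subset)
qed (use assms in auto)

lemma convex_weights_normalize:
  assumes "finite \<sigma>" "\<forall>v\<in>\<sigma>. \<alpha> v \<ge> 0" "u \<in> \<sigma>" "\<alpha> u > 0"
  shows "sum \<alpha> \<sigma> > 0" "convex_weights \<sigma> (\<lambda>v. \<alpha> v / sum \<alpha> \<sigma>)"
proof -
  show "sum \<alpha> \<sigma> > 0" using assms by (intro sum_pos2[of _ u]) auto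
  then show "convex_weights \<sigma> (\<lambda>v. \<alpha> v / sum \<alpha> \<sigma>)"
    using assms by (simp add: convex_weights_def flip: sum_divide_distrib)
qed

lemma pivot_step:
  fixes \<alpha> \<mu> :: "'v \<Rightarrow> real"
  assumes "finite \<sigma>" "\<forall>v\<in>\<sigma>. \<alpha> v \<ge> 0" "u0 \<in> \<sigma>" "\<mu> u0 < 0" "\<And>v. v \<in> \<sigma> \<Longrightarrow> \<mu> v < 0 \<Longrightarrow> \<alpha> v > 0"
  obtains t u where "t > 0" "u \<in> \<sigma>" "\<mu> u < 0" "\<alpha> u + t * \<mu> u = 0" "\<And>v. v \<in> \<sigma> \<Longrightarrow> \<alpha> v + t * \<mu> v \<ge> 0"
proof -
  define D where "D = {v \<in> \<sigma>. \<mu> v < 0}"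
  have D: "finite D" "D \<noteq> {}" using assms by (auto simp: D_def)
  define ratio where "ratio v = \<alpha> v / - \<mu> v" for v
  define u where "u = arg_min_on ratio D"
  have "u \<in> D" "\<And>v. v \<in> D \<Longrightarrow> ratio u \<le> ratio v"
    unfolding u_def using arg_min_if_finite(1)[OF D] arg_min_least[OF D] by auto
  then have u: "u \<in> D" "\<And>v. v \<in> D \<Longrightarrow> \<alpha> u / - \<mu> u \<le> \<alpha> v / - \<mu> v"
    by (auto simp: ratio_def)
  define t where "t = \<alpha> u / - \<mu> u"
  have t: "t > 0" using u(1) assms(5)[of u] by (auto simp: t_def D_def divide_pos_neg)
  show ?thesis
  proof (rule that[of t u])
    show "\<alpha> u + t * \<mu> u = 0" using u(1) by (simp add: t_def D_def)
    show "\<alpha> v + t * \<mu> v \<ge> 0" if "v \<in> \<sigma>" for v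
    proof (cases "\<mu> v < 0")
      case True
      then have "t \<le> \<alpha> v / - \<mu> v" using u(2) that by (auto simp: D_def t_def)
      then show ?thesis using True by (simp add: field_simps)
    next
      case False
      then show ?thesis using t assms(2) that by simp
    qed
  qed (use u t in \<open>auto simp: D_def\<close>)
qed


text \<open>
  Moving from a solution \<open>\<alpha>\<close> in the direction \<open>\<mu>\<close> until a coefficient becomes zero, as in
  the simplex method. The vertex \<open>p\<close> ends up with a positive coefficient, so the result can be normalized.
\<close>
lemma pivot:
  assumes fin: "finite \<sigma>" and \<alpha>: "\<forall>v\<in>\<sigma>. \<alpha> v \<ge> 0" "relation_upto F k \<sigma> \<alpha>"
    and \<mu>: "relation_upto F k \<sigma> \<mu>" "u0 \<in> \<sigma>" "\<mu> u0 < 0" "\<And>v. v \<in> \<sigma> \<Longrightarrow> \<mu> v < 0 \<Longrightarrow> \<alpha> v > 0"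
    and p: "p \<in> \<sigma>" "\<mu> p \<ge> 0" "\<alpha> p > 0 \<or> \<mu> p > 0"
  obtains \<beta> u where "convex_weights \<sigma> \<beta>" "relation_upto F k \<sigma> \<beta>" "u \<in> \<sigma>" "\<mu> u < 0" "\<beta> u = 0"
proof -
  obtain t u where t: "t > 0" "u \<in> \<sigma>" "\<mu> u < 0" "\<alpha> u + t * \<mu> u = 0" "\<And>v. v \<in> \<sigma> \<Longrightarrow> \<alpha> v + t * \<mu> v \<ge> 0"
    by (rule pivot_step[of \<sigma> \<alpha> u0 \<mu>]) (use fin \<alpha>(1) \<mu>(2,3,4) in auto)
  define \<gamma> where "\<gamma> v = \<alpha> v + t * \<mu> v" for v
  have \<gamma>: "relation_upto F k \<sigma> \<gamma>"
    using relation_upto_combine[OF \<alpha>(2) \<mu>(1), of 1 t] by (simp add: \<gamma>_def[abs_def])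
  have "\<gamma> p > 0"
    using p t(1) \<alpha>(1) by (auto simp: \<gamma>_def add_pos_nonneg add_nonneg_pos)
  then have *: "sum \<gamma> \<sigma> > 0" "convex_weights \<sigma> (\<lambda>v. \<gamma> v / sum \<gamma> \<sigma>)"
    using convex_weights_normalize[of \<sigma> \<gamma> p] t(5) p fin by (auto simp: \<gamma>_def)
  show ?thesis
  proof (rule that[OF *(2) _ t(2,3)])
    show "relation_upto F k \<sigma> (\<lambda>v. \<gamma> v / sum \<gamma> \<sigma>)"
      using relation_upto_combine[OF \<gamma> \<gamma>, of "1 / sum \<gamma> \<sigma>" 0] by simp
  qed (use t(4) in \<open>simp add: \<gamma>_def\<close>)
qed

lemma convex_weights_positive_exists:
  assumes "convex_weights \<sigma> \<alpha>" shows "\<exists>v\<in>\<sigma>. \<alpha> v > 0"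
proof (rule ccontr)
  assume "\<not> ?thesis"
  then have "sum \<alpha> \<sigma> \<le> 0" by (intro sum_nonpos) (auto simp: not_less)
  then show False using assms by (simp add: convex_weights_def)
qed

lemma convex_weights_subset:
  assumes "finite \<tau>" "v \<in> \<tau>" "convex_weights \<tau> \<alpha>" "\<alpha> v = 0"
  shows "convex_weights (\<tau> - {v}) \<alpha>"
  using assms by (simp add: convex_weights_def sum.remove[of \<tau> v])

lemma facet_weights:
  assumes "finite \<tau>" "v \<in> \<tau>" "convex_weights (\<tau> - {v}) \<alpha>" "relation_upto F k (\<tau> - {v}) \<alpha>"
  shows "\<exists>\<beta>. convex_weights \<tau> \<beta> \<and> relation_upto F k \<tau> \<beta> \<and> \<beta> v = 0 \<and>
    (\<forall>j. (\<Sum>u\<in>\<tau>. \<beta> u * F u j) = (\<Sum>u\<in>\<tau> - {v}. \<alpha> u * F u j))"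
proof -
  define \<beta> where "\<beta> = \<alpha>(v := 0)"
  have *: "(\<Sum>u\<in>\<tau>. \<beta> u * F u j) = (\<Sum>u\<in>\<tau> - {v}. \<alpha> u * F u j)" for j
    using assms by (subst sum.remove[of _ v]) (auto simp: \<beta>_def intro!: sum.cong)
  have "sum \<beta> \<tau> = sum \<alpha> (\<tau> - {v})"
    using assms by (subst sum.remove[of _ v]) (auto simp: \<beta>_def intro!: sum.cong)
  then show ?thesis
    using assms * by (intro exI[of _ \<beta>]) (auto simp: convex_weights_def relation_upto_def \<beta>_def)
qed

text \<open>
  The convex weights on \<open>\<tau>\<close> that satisfy the first \<open>k\<close> equations form the empty set or a segment: there are
  \<open>k + 2\<close> weights, and by genericity the solution space has dimension exactly 2. Also by genericity, each end of the
  segment has exactly one zero weight, so each end lies on exactly one facet, and the linear form \<open>G\<close> given by coordinate \<open>k\<close> does not vanish there.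
  Now \<open>\<tau>\<close> crosses the subspace of codimension \<open>k + 1\<close> if and only if \<open>G\<close> has a zero on the segment, hence if and only if
  \<open>G\<close> is positive at exactly one of the two ends.
\<close>
lemma crosses_parity:
  assumes fin: "finite \<tau>" and card: "card \<tau> = k + 2" and "k < d" and gen: "generic F d \<tau>"
  shows "(of_bool (crosses F (Suc k) \<tau>) :: bit) = (\<Sum>v\<in>\<tau>. of_bool (crosses_above F k (\<tau> - {v})))"
proof -
  \<comment> \<open>The segment, and the linear form whose sign is compared at its ends.\<close>
  define Z where "Z = {\<alpha>. convex_weights \<tau> \<alpha> \<and> relation_upto F k \<tau> \<alpha>}"
  define G where "G \<alpha> = (\<Sum>v\<in>\<tau>. \<alpha> v * F v k)" for \<alpha>
  have above: "crosses_above F k (\<tau> - {v}) \<longleftrightarrow> (\<exists>\<alpha>\<in>Z. \<alpha> v = 0 \<and> G \<alpha> > 0)" if "v \<in> \<tau>" for v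
  proof
    assume "crosses_above F k (\<tau> - {v})"
    then obtain \<alpha> where \<alpha>: "convex_weights (\<tau> - {v}) \<alpha>" "relation_upto F k (\<tau> - {v}) \<alpha>"
      "(\<Sum>u\<in>\<tau> - {v}. \<alpha> u * F u k) > 0"
      unfolding crosses_above_def by blast
    obtain \<beta> where "convex_weights \<tau> \<beta>" "relation_upto F k \<tau> \<beta>" "\<beta> v = 0"
      "\<forall>j. (\<Sum>u\<in>\<tau>. \<beta> u * F u j) = (\<Sum>u\<in>\<tau> - {v}. \<alpha> u * F u j)"
      using facet_weights[OF fin \<open>v \<in> \<tau>\<close> \<alpha>(1,2)] by blast
    with \<alpha>(3) show "\<exists>\<alpha>\<in>Z. \<alpha> v = 0 \<and> G \<alpha> > 0"
      by (intro bexI[of _ \<beta>]) (auto simp: Z_def G_def)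
  next
    assume "\<exists>\<alpha>\<in>Z. \<alpha> v = 0 \<and> G \<alpha> > 0"
    then obtain \<alpha> where \<alpha>: "\<alpha> \<in> Z" "\<alpha> v = 0" "G \<alpha> > 0" by blast
    have "convex_weights (\<tau> - {v}) \<alpha>"
      using \<alpha> that fin by (intro convex_weights_subset) (auto simp: Z_def)
    moreover have "relation_upto F k (\<tau> - {v}) \<alpha>"
      using \<alpha> that fin by (subst relation_upto_support[of \<tau>]) (auto simp: Z_def)
    moreover have "(\<Sum>u\<in>\<tau> - {v}. \<alpha> u * F u k) = G \<alpha>"
      using \<alpha> that fin by (simp add: G_def sum.remove[of \<tau> v])
    ultimately show "crosses_above F k (\<tau> - {v})"
      using \<alpha> unfolding crosses_above_def by auto
  qed
  have below: "crosses F (Suc k) \<tau> \<longleftrightarrow> (\<exists>\<alpha>\<in>Z. G \<alpha> = 0)"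
    by (auto simp: crosses_def Z_def G_def relation_upto_def less_Suc_eq)
  have two_zeros: "\<alpha> w = 0" if "relation_upto F k \<tau> \<alpha>" "u \<in> \<tau>" "v \<in> \<tau>" "u \<noteq> v" "\<alpha> u = 0" "\<alpha> v = 0" "w \<in> \<tau>"
    for \<alpha> u v w
    by (rule generic_vanish[OF gen fin, of k \<alpha> "{u, v}" w]) (use that \<open>k < d\<close> card in auto)
  have pos: "\<alpha> w > 0" if "\<alpha> \<in> Z" "u \<in> \<tau>" "\<alpha> u = 0" "w \<in> \<tau>" "w \<noteq> u" for \<alpha> u w
  proof -
    have "\<alpha> w \<ge> 0" using that by (auto simp: Z_def convex_weights_def)
    moreover have "\<alpha> w \<noteq> 0"
    proof
      assume "\<alpha> w = 0"
      then have "\<forall>v\<in>\<tau>. \<alpha> v = 0" using two_zeros[of \<alpha> u w] that by (auto simp: Z_def)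
      then show False using that convex_weights_positive_exists[of \<tau> \<alpha>] by (auto simp: Z_def)
    qed
    ultimately show ?thesis by simp
  qed
  have G_nonzero: "G \<alpha> \<noteq> 0" if "\<alpha> \<in> Z" "u \<in> \<tau>" "\<alpha> u = 0" for \<alpha> u
  proof
    assume "G \<alpha> = 0"
    then have R: "relation_upto F (Suc k) \<tau> \<alpha>"
      using that by (auto simp: Z_def G_def relation_upto_def less_Suc_eq)
    have "\<forall>v\<in>\<tau>. \<alpha> v = 0"
      by (rule ballI, rule generic_vanish[OF gen fin, of "Suc k" \<alpha> "{u}"]) (use R that \<open>k < d\<close> card in auto)
    then show False using that convex_weights_positive_exists[of \<tau> \<alpha>] by (auto simp: Z_def)
  qed
  have kernel: "\<exists>\<mu>. relation_upto F k \<tau> \<mu> \<and> \<mu> u = 0 \<and> \<mu> w > 0" if "u \<in> \<tau>" "w \<in> \<tau>" "u \<noteq> w" for u w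
  proof -
    obtain \<mu> where \<mu>: "\<forall>j\<in>{..<k}. (\<Sum>v\<in>\<tau> - {u}. \<mu> v * F v j) = 0" "\<exists>v\<in>\<tau> - {u}. \<mu> v \<noteq> 0"
      using nontrivial_solution[of "{..<k}" "\<tau> - {u}" F] fin card \<open>u \<in> \<tau>\<close> by auto
    define \<nu> where "\<nu> = \<mu>(u := 0)"
    have "relation_upto F k (\<tau> - {u}) \<nu>"
      using \<mu>(1) by (auto simp: relation_upto_def \<nu>_def)
    then have \<nu>: "relation_upto F k \<tau> \<nu>"
      using that fin by (subst (asm) relation_upto_support[of \<tau>]) (auto simp: \<nu>_def)
    obtain v where v: "v \<in> \<tau>" "v \<noteq> u" "\<mu> v \<noteq> 0" using \<mu>(2) by auto
    have "\<nu> w \<noteq> 0"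
      using two_zeros[OF \<nu>, of u w v] that v by (auto simp: \<nu>_def)
    then have "sgn (\<nu> w) * \<nu> w > 0" by (simp add: sgn_if)
    moreover have "relation_upto F k \<tau> (\<lambda>v. sgn (\<nu> w) * \<nu> v)"
      using relation_upto_combine[OF \<nu> \<nu>, of "sgn (\<nu> w)" 0] by simp
    moreover have "sgn (\<nu> w) * \<nu> u = 0" by (simp add: \<nu>_def)
    ultimately show ?thesis by (intro exI[of _ "\<lambda>v. sgn (\<nu> w) * \<nu> v"]) simp
  qed
  have other: "\<exists>u\<in>\<tau>. u \<noteq> w" for w
  proof (rule ccontr)
    assume "\<not> ?thesis"
    then have "\<tau> \<subseteq> {w}" by auto
    from card_mono[OF _ this] card show False by simp
  qed
  have end_exists: "\<exists>\<beta>\<in>Z. \<exists>v\<in>\<tau>. \<beta> v = 0" if "\<alpha> \<in> Z" for \<alpha>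
  proof (rule ccontr)
    assume no: "\<not> ?thesis"
    then have \<alpha>_pos: "\<alpha> v > 0" if "v \<in> \<tau>" for v
      using \<open>\<alpha> \<in> Z\<close> that by (force simp: Z_def convex_weights_def less_le)
    have "\<tau> \<noteq> {}" using card by auto
    then obtain u w where uw: "u \<in> \<tau>" "w \<in> \<tau>" "u \<noteq> w"
      using other by blast
    obtain \<mu> where \<mu>: "relation_upto F k \<tau> \<mu>" "\<mu> u = 0" "\<mu> w > 0" using kernel[OF uw] by blast
    have neg: "relation_upto F k \<tau> (\<lambda>v. - \<mu> v)"
      using relation_upto_combine[OF \<mu>(1) \<mu>(1), of "-1" 0] by simp
    obtain \<beta> u' where "convex_weights \<tau> \<beta>" "relation_upto F k \<tau> \<beta>" "u' \<in> \<tau>" "\<beta> u' = 0"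
      by (rule pivot[of \<tau> \<alpha> F k "\<lambda>v. - \<mu> v" w u])
        (use fin \<open>\<alpha> \<in> Z\<close> \<alpha>_pos neg \<mu> uw in \<open>auto simp: Z_def convex_weights_def\<close>)
    then show False using no by (auto simp: Z_def)
  qed
  show ?thesis
  proof (cases "\<exists>\<alpha>\<in>Z. \<exists>v\<in>\<tau>. \<alpha> v = 0")
    case False
    then have "Z = {}" using end_exists by blast
    then show ?thesis using above below by simp
  next
    case True
    then obtain \<alpha>0 v0 where 0: "\<alpha>0 \<in> Z" "v0 \<in> \<tau>" "\<alpha>0 v0 = 0" by blast
    have "\<exists>\<alpha>1 v1. \<alpha>1 \<in> Z \<and> v1 \<in> \<tau> \<and> \<alpha>1 v1 = 0 \<and> v1 \<noteq> v0"
    proof -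
      obtain u where u: "u \<in> \<tau>" "u \<noteq> v0"
        using other by blast
      obtain \<mu> where \<mu>: "relation_upto F k \<tau> \<mu>" "\<mu> u = 0" "\<mu> v0 > 0" using kernel[OF u(1) 0(2) u(2)] by blast
      show ?thesis
      proof (cases "\<forall>v\<in>\<tau>. \<mu> v \<ge> 0")
        case True
        define \<beta> where "\<beta> v = \<mu> v / sum \<mu> \<tau>" for v
        have "convex_weights \<tau> \<beta>"
          using convex_weights_normalize[OF fin True 0(2) \<mu>(3)] by (simp add: \<beta>_def[abs_def])
        moreover have "relation_upto F k \<tau> \<beta>"
          using relation_upto_combine[OF \<mu>(1) \<mu>(1), of "1 / sum \<mu> \<tau>" 0] by (simp add: \<beta>_def[abs_def])
        ultimately show ?thesis
          using u \<mu>(2) by (intro exI[of _ \<beta>] exI[of _ u]) (auto simp: Z_def \<beta>_def)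
      next
        case False
        then obtain w where w: "w \<in> \<tau>" "\<mu> w < 0" by (auto simp: not_le)
        have \<alpha>0_pos: "\<alpha>0 v > 0" if "v \<in> \<tau>" "\<mu> v < 0" for v
          using pos[OF 0, of v] that \<mu>(3) by fastforce
        obtain \<beta> u' where "convex_weights \<tau> \<beta>" "relation_upto F k \<tau> \<beta>" "u' \<in> \<tau>" "\<mu> u' < 0" "\<beta> u' = 0"
          by (rule pivot[of \<tau> \<alpha>0 F k \<mu> w v0])
            (use fin 0 \<alpha>0_pos \<mu> w in \<open>auto simp: Z_def convex_weights_def\<close>)
        then show ?thesis using \<mu>(3) by (intro exI[of _ \<beta>] exI[of _ u']) (auto simp: Z_def)
      qed
    qed
    then obtain \<alpha>1 v1 where 1: "\<alpha>1 \<in> Z" "v1 \<in> \<tau>" "\<alpha>1 v1 = 0" "v1 \<noteq> v0" by blast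
    have \<alpha>01: "\<alpha>1 v0 > 0" "\<alpha>0 v1 > 0"
      using pos[OF 1(1-3) 0(2)] pos[OF 0 1(2)] 1(4) by auto
    have segment: "\<exists>s\<ge>0. s \<le> 1 \<and> (\<forall>v\<in>\<tau>. \<beta> v = (1 - s) * \<alpha>0 v + s * \<alpha>1 v)" if "\<beta> \<in> Z" for \<beta>
    proof -
      \<comment> \<open>This parameter makes the difference \<open>\<nu>\<close> vanish at \<open>v0\<close>; it is then a multiple of \<open>\<alpha>0\<close> with sum 0.\<close>
      define s where "s = \<beta> v0 / \<alpha>1 v0"
      define \<nu> where "\<nu> v = 1 * \<beta> v + (-1) * ((1 - s) * \<alpha>0 v + s * \<alpha>1 v)" for v
      have mix: "relation_upto F k \<tau> (\<lambda>v. (1 - s) * \<alpha>0 v + s * \<alpha>1 v)"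
        by (rule relation_upto_combine) (use 0 1 in \<open>auto simp: Z_def\<close>)
      have \<nu>: "relation_upto F k \<tau> \<nu>"
        unfolding \<nu>_def[abs_def] by (rule relation_upto_combine[OF _ mix]) (use that in \<open>auto simp: Z_def\<close>)
      have \<nu>0: "\<nu> v0 = 0" using 0(3) \<alpha>01 by (simp add: \<nu>_def s_def)
      have "sum \<nu> \<tau> = sum \<beta> \<tau> - ((1 - s) * sum \<alpha>0 \<tau> + s * sum \<alpha>1 \<tau>)"
        by (simp add: \<nu>_def[abs_def] sum_subtractf sum.distrib sum_distrib_left sum_negf)
      also have "\<dots> = 0" using that 0 1 by (simp add: Z_def convex_weights_def)
      finally have sum0: "sum \<nu> \<tau> = 0" .
      define c where "c = \<nu> v1 / \<alpha>0 v1"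
      have "relation_upto F k \<tau> (\<lambda>v. 1 * \<nu> v + (- c) * \<alpha>0 v)"
        by (rule relation_upto_combine[OF \<nu>]) (use 0 in \<open>auto simp: Z_def\<close>)
      then have "1 * \<nu> v + (- c) * \<alpha>0 v = 0" if "v \<in> \<tau>" for v
        using two_zeros[of "\<lambda>v. 1 * \<nu> v + (- c) * \<alpha>0 v" v0 v1 v] 0 1 \<nu>0 \<alpha>01 that by (simp add: c_def)
      then have c: "\<nu> v = c * \<alpha>0 v" if "v \<in> \<tau>" for v using that by simp
      have "sum \<nu> \<tau> = c * sum \<alpha>0 \<tau>" by (simp add: c sum_distrib_left)
      then have "c = 0" using sum0 0 by (simp add: Z_def convex_weights_def)
      then have eq: "\<beta> v = (1 - s) * \<alpha>0 v + s * \<alpha>1 v" if "v \<in> \<tau>" for v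
        using c[OF that] by (simp add: \<nu>_def)
      have "\<beta> v0 \<ge> 0" "\<beta> v1 \<ge> 0" using that 0 1 by (auto simp: Z_def convex_weights_def)
      then have "s \<ge> 0" "(1 - s) * \<alpha>0 v1 \<ge> 0" using \<alpha>01 eq[of v1] 1 by (auto simp: s_def)
      then show ?thesis using eq \<alpha>01 by (intro exI[of _ s]) (auto simp: zero_le_mult_iff)
    qed
    have G_comb: "G \<beta> = (1 - s) * G \<alpha>0 + s * G \<alpha>1" if "\<forall>v\<in>\<tau>. \<beta> v = (1 - s) * \<alpha>0 v + s * \<alpha>1 v" for \<beta> s
    proof -
      have "G \<beta> = (\<Sum>v\<in>\<tau>. ((1 - s) * \<alpha>0 v + s * \<alpha>1 v) * F v k)"
        unfolding G_def using that by (intro sum.cong) auto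
      also have "\<dots> = (1 - s) * G \<alpha>0 + s * G \<alpha>1"
        by (simp only: G_def distrib_right sum.distrib sum_distrib_left mult.assoc)
      finally show ?thesis .
    qed
    have at0: "G \<beta> = G \<alpha>0" if "\<beta> \<in> Z" "\<beta> v0 = 0" for \<beta>
    proof -
      obtain s where s: "\<forall>v\<in>\<tau>. \<beta> v = (1 - s) * \<alpha>0 v + s * \<alpha>1 v" using segment \<open>\<beta> \<in> Z\<close> by blast
      then have "s = 0" using 0 \<alpha>01 that by auto
      then show ?thesis using G_comb[OF s] by simp
    qed
    have at1: "G \<beta> = G \<alpha>1" if "\<beta> \<in> Z" "\<beta> v1 = 0" for \<beta>
    proof -
      obtain s where s: "\<forall>v\<in>\<tau>. \<beta> v = (1 - s) * \<alpha>0 v + s * \<alpha>1 v" using segment \<open>\<beta> \<in> Z\<close> by blast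
      then have "s = 1" using 1 \<alpha>01 that by auto
      then show ?thesis using G_comb[OF s] by simp
    qed
    have only: "v = v0 \<or> v = v1" if "\<beta> \<in> Z" "\<beta> v = 0" "v \<in> \<tau>" for \<beta> v
    proof (rule ccontr)
      assume v: "\<not> ?thesis"
      obtain s where s: "s \<ge> 0" "s \<le> 1" "\<forall>v\<in>\<tau>. \<beta> v = (1 - s) * \<alpha>0 v + s * \<alpha>1 v" using segment \<open>\<beta> \<in> Z\<close> by blast
      have "\<alpha>0 v > 0" "\<alpha>1 v > 0" using pos[OF 0, of v] pos[OF 1(1-3), of v] that v by auto
      then have "(1 - s) * \<alpha>0 v + s * \<alpha>1 v > 0"
        using s by (cases "s = 0") (auto simp: add_nonneg_pos)
      then show False using s that by simp
    qed
    have c01: "crosses_above F k (\<tau> - {v0}) \<longleftrightarrow> G \<alpha>0 > 0" "crosses_above F k (\<tau> - {v1}) \<longleftrightarrow> G \<alpha>1 > 0"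
      unfolding above[OF 0(2)] above[OF 1(2)] using at0 0(1,3) at1 1(1,3) by metis+
    have "(\<Sum>v\<in>\<tau>. of_bool (crosses_above F k (\<tau> - {v}))) = (\<Sum>v\<in>{v0, v1}. of_bool (crosses_above F k (\<tau> - {v})) :: bit)"
      using 0 1 fin above only by (intro sum.mono_neutral_right) auto
    also have "\<dots> = of_bool (G \<alpha>0 > 0) + of_bool (G \<alpha>1 > 0)"
      using c01 1(4) by (simp add: eq_commute)
    also have "\<dots> = of_bool (\<exists>\<alpha>\<in>Z. G \<alpha> = 0)"
    proof -
      have nz: "G \<alpha>0 \<noteq> 0" "G \<alpha>1 \<noteq> 0" using G_nonzero 0 1 by blast+
      have "(\<exists>\<alpha>\<in>Z. G \<alpha> = 0) \<longleftrightarrow> (G \<alpha>0 > 0 \<longleftrightarrow> \<not> G \<alpha>1 > 0)"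
      proof
        assume "\<exists>\<alpha>\<in>Z. G \<alpha> = 0"
        then obtain \<beta> where \<beta>: "\<beta> \<in> Z" "G \<beta> = 0" by blast
        then obtain s where s: "s \<ge> 0" "s \<le> 1" "\<forall>v\<in>\<tau>. \<beta> v = (1 - s) * \<alpha>0 v + s * \<alpha>1 v"
          using segment by blast
        have s0: "(1 - s) * G \<alpha>0 + s * G \<alpha>1 = 0"
          using G_comb[OF s(3)] \<beta>(2) by simp
        show "G \<alpha>0 > 0 \<longleftrightarrow> \<not> G \<alpha>1 > 0"
        proof (rule ccontr)
          assume "\<not> ?thesis"
          then consider "G \<alpha>0 > 0" "G \<alpha>1 > 0" | "G \<alpha>0 < 0" "G \<alpha>1 < 0" using nz by fastforce
          then show False
          proof cases
            case 1
            then have "(1 - s) * G \<alpha>0 + s * G \<alpha>1 > 0"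
              using s by (cases "s = 0") (auto simp: add_nonneg_pos)
            then show False using s0 by simp
          next
            case 2
            then have "(1 - s) * G \<alpha>0 + s * G \<alpha>1 < 0"
              using s by (cases "s = 0") (auto simp: add_nonpos_neg mult_nonneg_nonpos mult_pos_neg)
            then show False using s0 by simp
          qed
        qed
      next
        assume opp: "G \<alpha>0 > 0 \<longleftrightarrow> \<not> G \<alpha>1 > 0"
        define s where "s = G \<alpha>0 / (G \<alpha>0 - G \<alpha>1)"
        have ne: "G \<alpha>0 - G \<alpha>1 \<noteq> 0" using opp nz by auto
        have s: "s \<ge> 0" "s \<le> 1"
          using opp nz by (auto simp: s_def divide_simps)
        define \<beta> where "\<beta> v = (1 - s) * \<alpha>0 v + s * \<alpha>1 v" for v
        have "relation_upto F k \<tau> \<beta>"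
          unfolding \<beta>_def[abs_def] by (rule relation_upto_combine) (use 0 1 in \<open>auto simp: Z_def\<close>)
        moreover have "sum \<beta> \<tau> = 1"
          using 0 1 by (simp add: \<beta>_def[abs_def] sum.distrib Z_def convex_weights_def flip: sum_distrib_left)
        moreover have "\<forall>v\<in>\<tau>. \<beta> v \<ge> 0"
          using 0 1 s by (auto simp: \<beta>_def Z_def convex_weights_def)
        ultimately have "\<beta> \<in> Z" by (auto simp: Z_def convex_weights_def)
        moreover have "G \<beta> = (1 - s) * G \<alpha>0 + s * G \<alpha>1" by (rule G_comb) (simp add: \<beta>_def)
        moreover have "(1 - s) * G \<alpha>0 + s * G \<alpha>1 = G \<alpha>0 - s * (G \<alpha>0 - G \<alpha>1)" by (simp add: algebra_simps)
        ultimately show "\<exists>\<alpha>\<in>Z. G \<alpha> = 0" using ne by (intro bexI[of _ \<beta>]) (auto simp: s_def)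
      qed
      then show ?thesis by auto
    qed
    finally show ?thesis using below by simp
  qed
qed

lemma sum_facets_reindex:
  fixes h :: "'v set \<Rightarrow> 'v \<Rightarrow> 'a::comm_monoid_add"
  assumes "finite V"
  shows "(\<Sum>\<sigma>\<in>Pow V. \<Sum>v\<in>\<sigma>. h \<sigma> v) = (\<Sum>f\<in>Pow V. \<Sum>v\<in>V - f. h (insert v f) v)"
proof -
  have fin: "finite \<sigma>" if "\<sigma> \<in> Pow V" for \<sigma>
    using that assms finite_subset by auto
  have "(\<Sum>\<sigma>\<in>Pow V. \<Sum>v\<in>\<sigma>. h \<sigma> v) = (\<Sum>(\<sigma>, v)\<in>Sigma (Pow V) (\<lambda>\<sigma>. \<sigma>). h \<sigma> v)"
    using assms fin by (intro sum.Sigma) auto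
  also have "\<dots> = (\<Sum>(f, v)\<in>Sigma (Pow V) (\<lambda>f. V - f). h (insert v f) v)"
    by (rule sum.reindex_bij_witness[of _ "\<lambda>(f, v). (insert v f, v)" "\<lambda>(\<sigma>, v). (\<sigma> - {v}, v)"])
      (auto simp: insert_absorb)
  also have "\<dots> = (\<Sum>f\<in>Pow V. \<Sum>v\<in>V - f. h (insert v f) v)"
    using assms by (intro sum.Sigma[symmetric]) auto
  finally show ?thesis .
qed

text \<open>
  A generic simplex with \<open>k + 1\<close> vertices has at most one convex combination on the subspace of codimension \<open>k\<close>, and its next
  coordinate is not zero. If it is negative, it becomes positive on the antipodal simplex.
\<close>
lemma crosses_split:
  assumes fin: "finite \<sigma>" and card: "card \<sigma> = Suc k" and "k < d" and gen: "generic F d \<sigma>"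
    and opp: "inj_on opp \<sigma>" "\<And>v j. v \<in> \<sigma> \<Longrightarrow> F (opp v) j = - F v j"
  shows "(of_bool (crosses_above F k \<sigma>) + of_bool (crosses_above F k (opp ` \<sigma>)) :: bit) = of_bool (crosses F k \<sigma>)"
proof -
  define Z where "Z = {\<alpha>. convex_weights \<sigma> \<alpha> \<and> relation_upto F k \<sigma> \<alpha>}"
  define G where "G \<alpha> = (\<Sum>v\<in>\<sigma>. \<alpha> v * F v k)" for \<alpha>
  have unique: "G \<alpha> = G \<beta>" if "\<alpha> \<in> Z" "\<beta> \<in> Z" for \<alpha> \<beta>
  proof -
    obtain u where u: "u \<in> \<sigma>" "\<beta> u > 0"
      using convex_weights_positive_exists[of \<sigma> \<beta>] \<open>\<beta> \<in> Z\<close> by (auto simp: Z_def)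
    define c where "c = \<alpha> u / \<beta> u"
    have R: "relation_upto F k \<sigma> (\<lambda>v. 1 * \<alpha> v + (- c) * \<beta> v)"
      by (rule relation_upto_combine) (use that in \<open>auto simp: Z_def\<close>)
    have "1 * \<alpha> v + (- c) * \<beta> v = 0" if "v \<in> \<sigma>" for v
      by (rule generic_vanish[OF gen fin, of k "\<lambda>v. 1 * \<alpha> v + (- c) * \<beta> v" "{u}"])
        (use R u card \<open>k < d\<close> that in \<open>auto simp: c_def\<close>)
    then have eq: "\<alpha> v = c * \<beta> v" if "v \<in> \<sigma>" for v using that by simp
    have "sum \<alpha> \<sigma> = c * sum \<beta> \<sigma>" by (simp add: eq sum_distrib_left)
    then have "c = 1" using that by (simp add: Z_def convex_weights_def)
    then show ?thesis by (simp add: G_def eq)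
  qed
  have nonzero: "G \<alpha> \<noteq> 0" if "\<alpha> \<in> Z" for \<alpha>
  proof
    assume "G \<alpha> = 0"
    then have R: "relation_upto F (Suc k) \<sigma> \<alpha>"
      using that by (auto simp: Z_def G_def relation_upto_def less_Suc_eq)
    have "\<alpha> v = 0" if "v \<in> \<sigma>" for v
      by (rule generic_vanish[OF gen fin, of "Suc k" \<alpha> "{}"]) (use R card \<open>k < d\<close> that in auto)
    then show False
      using convex_weights_positive_exists[of \<sigma> \<alpha>] \<open>\<alpha> \<in> Z\<close> by (auto simp: Z_def)
  qed
  have 1: "crosses_above F k \<sigma> \<longleftrightarrow> (\<exists>\<alpha>\<in>Z. G \<alpha> > 0)"
    by (auto simp: crosses_above_def Z_def G_def)
  have 2: "crosses_above F k (opp ` \<sigma>) \<longleftrightarrow> (\<exists>\<alpha>\<in>Z. G \<alpha> < 0)"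
  proof
    assume "crosses_above F k (opp ` \<sigma>)"
    then obtain \<alpha> where \<alpha>: "convex_weights (opp ` \<sigma>) \<alpha>" "relation_upto F k (opp ` \<sigma>) \<alpha>" "(\<Sum>v\<in>opp ` \<sigma>. \<alpha> v * F v k) > 0"
      unfolding crosses_above_def by blast
    have "(\<Sum>v\<in>opp ` \<sigma>. \<alpha> v * F v j) = - (\<Sum>v\<in>\<sigma>. (\<alpha> \<circ> opp) v * F v j)" for j
      using opp by (simp add: sum.reindex sum_negf)
    with \<alpha> show "\<exists>\<alpha>\<in>Z. G \<alpha> < 0"
      using opp(1) by (intro bexI[of _ "\<alpha> \<circ> opp"])
        (auto simp: Z_def G_def convex_weights_def relation_upto_def sum.reindex)
  next
    assume "\<exists>\<alpha>\<in>Z. G \<alpha> < 0"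
    then obtain \<alpha> where \<alpha>: "\<alpha> \<in> Z" "G \<alpha> < 0" by blast
    define \<beta> where "\<beta> = \<alpha> \<circ> inv_into \<sigma> opp"
    have \<beta>: "\<beta> (opp v) = \<alpha> v" if "v \<in> \<sigma>" for v
      using opp(1) that by (simp add: \<beta>_def)
    have "(\<Sum>v\<in>opp ` \<sigma>. \<beta> v * F v j) = - (\<Sum>v\<in>\<sigma>. \<alpha> v * F v j)" for j
      using opp \<beta> by (simp add: sum.reindex sum_negf)
    moreover have "sum \<beta> (opp ` \<sigma>) = sum \<alpha> \<sigma>"
      using opp(1) \<beta> by (simp add: sum.reindex)
    ultimately show "crosses_above F k (opp ` \<sigma>)"
      unfolding crosses_above_def using \<alpha> \<beta>
      by (intro exI[of _ \<beta>]) (auto simp: Z_def G_def convex_weights_def relation_upto_def)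
  qed
  have 3: "crosses F k \<sigma> \<longleftrightarrow> Z \<noteq> {}" by (auto simp: crosses_def Z_def)
  show ?thesis
  proof (cases "Z = {}")
    case True
    then show ?thesis by (simp add: 1 2 3)
  next
    case False
    then obtain \<alpha> where \<alpha>: "\<alpha> \<in> Z" by blast
    have "(\<exists>\<alpha>\<in>Z. G \<alpha> > 0) \<longleftrightarrow> G \<alpha> > 0" "(\<exists>\<alpha>\<in>Z. G \<alpha> < 0) \<longleftrightarrow> G \<alpha> < 0"
      using unique[OF \<alpha>] \<alpha> by (metis)+
    then show ?thesis
      using nonzero[OF \<alpha>] False unfolding 1 2 3 by (cases "G \<alpha> > 0") auto
  qed
qed

text \<open>
  Let \<open>n\<^sub>k\<close> be the number of simplices of \<open>c k\<close> that cross the subspace of codimension \<open>k\<close>. All numbers \<open>n\<^sub>k\<close>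
  are odd. Indeed \<open>n\<^sub>0\<close> is the number of vertices of \<open>c 0\<close>, and by \<open>crosses_parity\<close> the number \<open>n\<^sub>k\<^sub>+\<^sub>1\<close> has the parity
  of the number of simplices in the boundary of \<open>c (k + 1)\<close> that cross above. This boundary is \<open>c k\<close> plus its antipode, so
  \<open>crosses_split\<close> gives \<open>n\<^sub>k\<close>.
\<close>
lemma generic_simplex_crosses:
  fixes c :: "nat \<Rightarrow> 'v set \<Rightarrow> bit"
  assumes V: "finite V" and opp: "\<And>v. opp (opp v) = v" "opp ` V = V" "\<And>v j. v \<in> V \<Longrightarrow> F (opp v) j = - F v j"
    and supp: "\<And>k \<sigma>. k \<le> d \<Longrightarrow> c k \<sigma> \<noteq> 0 \<Longrightarrow> \<sigma> \<subseteq> V \<and> card \<sigma> = Suc k \<and> generic F d \<sigma>"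
    and c0: "bd V (c 0) {} = 1"
    and cSuc: "\<And>k \<sigma>. k < d \<Longrightarrow> bd V (c (Suc k)) \<sigma> = c k \<sigma> + c k (opp ` \<sigma>)"
  shows "\<exists>\<sigma>. c d \<sigma> \<noteq> 0 \<and> crosses F d \<sigma>"
proof -
  have finsub: "finite \<sigma>" if "\<sigma> \<subseteq> V" for \<sigma> using that V finite_subset by blast
  have inj: "inj opp" using opp(1) by (metis injI)
  have count: "(\<Sum>\<sigma>\<in>Pow V. c k \<sigma> * of_bool (crosses F k \<sigma>)) = 1" if "k \<le> d" for k
    using that
  proof (induction k)
    case 0
    have "(\<Sum>\<sigma>\<in>Pow V. c 0 \<sigma> * of_bool (crosses F 0 \<sigma>)) = (\<Sum>\<sigma>\<in>(\<lambda>v. {v}) ` V. c 0 \<sigma> * of_bool (crosses F 0 \<sigma>))"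
    proof (intro sum.mono_neutral_right)
      show "\<forall>\<sigma>\<in>Pow V - (\<lambda>v. {v}) ` V. c 0 \<sigma> * of_bool (crosses F 0 \<sigma>) = 0"
      proof
        fix \<sigma> assume \<sigma>: "\<sigma> \<in> Pow V - (\<lambda>v. {v}) ` V"
        have "c 0 \<sigma> = 0"
        proof (rule ccontr)
          assume "c 0 \<sigma> \<noteq> 0"
          from supp[OF _ this] have "card \<sigma> = 1" by simp
          then show False using \<sigma> by (auto simp: card_1_singleton_iff)
        qed
        then show "c 0 \<sigma> * of_bool (crosses F 0 \<sigma>) = 0" by simp
      qed
    qed (use V in auto)
    also have "\<dots> = (\<Sum>v\<in>V. c 0 {v} * of_bool (crosses F 0 {v}))"
      by (subst sum.reindex) (auto simp: o_def)
    also have "crosses F 0 {v}" for v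
      by (auto simp: crosses_def convex_weights_def relation_upto_def intro!: exI[of _ "\<lambda>_. 1"])
    then have "(\<Sum>v\<in>V. c 0 {v} * of_bool (crosses F 0 {v})) = bd V (c 0) {}"
      by (simp add: bd_def)
    finally show ?case using c0 by simp
  next
    case (Suc k)
    then have k: "k < d" by simp
    have "(\<Sum>\<sigma>\<in>Pow V. c (Suc k) \<sigma> * of_bool (crosses F (Suc k) \<sigma>))
        = (\<Sum>\<sigma>\<in>Pow V. \<Sum>v\<in>\<sigma>. c (Suc k) \<sigma> * of_bool (crosses_above F k (\<sigma> - {v})))"
    proof (rule sum.cong[OF refl])
      fix \<sigma> assume "\<sigma> \<in> Pow V"
      show "c (Suc k) \<sigma> * of_bool (crosses F (Suc k) \<sigma>) = (\<Sum>v\<in>\<sigma>. c (Suc k) \<sigma> * of_bool (crosses_above F k (\<sigma> - {v})))"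
      proof (cases "c (Suc k) \<sigma> = 0")
        case False
        from supp[OF Suc.prems this] have "card \<sigma> = k + 2" "generic F d \<sigma>" "\<sigma> \<subseteq> V" by auto
        then show ?thesis
          using crosses_parity[OF finsub _ k, of \<sigma>] by (simp flip: sum_distrib_left)
      qed simp
    qed
    also have "\<dots> = (\<Sum>f\<in>Pow V. \<Sum>v\<in>V - f. c (Suc k) (insert v f) * of_bool (crosses_above F k (insert v f - {v})))"
      by (rule sum_facets_reindex[OF V])
    also have "\<dots> = (\<Sum>f\<in>Pow V. bd V (c (Suc k)) f * of_bool (crosses_above F k f))"
      unfolding bd_def sum_distrib_right by (intro sum.cong refl) auto
    also have "\<dots> = (\<Sum>f\<in>Pow V. c k f * of_bool (crosses_above F k f)) + (\<Sum>f\<in>Pow V. c k (opp ` f) * of_bool (crosses_above F k f))"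
      using cSuc[OF k] by (simp add: distrib_right sum.distrib)
    also have "(\<Sum>f\<in>Pow V. c k (opp ` f) * of_bool (crosses_above F k f)) = (\<Sum>f\<in>Pow V. c k f * of_bool (crosses_above F k (opp ` f)))"
      using opp(2) by (intro sum.reindex_bij_witness[of _ "(`) opp" "(`) opp"]) (auto simp: image_image opp(1))
    also have "(\<Sum>f\<in>Pow V. c k f * of_bool (crosses_above F k f)) + \<dots> = (\<Sum>f\<in>Pow V. c k f * of_bool (crosses F k f))"
      unfolding sum.distrib[symmetric] distrib_left[symmetric]
    proof (rule sum.cong[OF refl])
      fix f assume "f \<in> Pow V"
      show "c k f * (of_bool (crosses_above F k f) + of_bool (crosses_above F k (opp ` f))) = c k f * of_bool (crosses F k f)"
      proof (cases "c k f = 0")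
        case False
        have "f \<subseteq> V" "card f = Suc k" "generic F d f" using supp[OF _ False] k by auto
        then show ?thesis
          using crosses_split[OF finsub _ k, of f F opp] inj opp(3) by (metis inj_on_subset subsetD subset_UNIV)
      qed simp
    qed
    finally show ?case using Suc by simp
  qed
  have "\<exists>\<sigma>\<in>Pow V. c d \<sigma> * of_bool (crosses F d \<sigma>) \<noteq> 0"
    using sum.not_neutral_contains_not_neutral[of "\<lambda>\<sigma>. c d \<sigma> * of_bool (crosses F d \<sigma>)" "Pow V"] count[of d] by auto
  then show ?thesis by (auto split: if_splits)
qed

section \<open>From generic to arbitrary positions\<close>

text \<open>
  Add the hyperplanes one at a time: if \<open>x\<close> lies on the new one, a small change \<open>\<delta>\<close> of a coordinate with a nonzero
  coefficient leaves it, and all but finitely many \<open>\<delta>\<close> avoid meeting an old hyperplane again.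
\<close>
lemma avoid_hyperplanes:
  fixes x0 :: "nat \<Rightarrow> real"
  assumes "finite M" "\<forall>(k, n)\<in>M. \<exists>j<k. n j \<noteq> 0" "\<epsilon> > 0"
  shows "\<exists>x. (\<forall>j. \<bar>x j - x0 j\<bar> < \<epsilon>) \<and> (\<forall>(k, n)\<in>M. (\<Sum>j<k. n j * x j) \<noteq> 0)"
  using assms
proof (induction M arbitrary: \<epsilon> rule: finite_induct)
  case empty
  then show ?case by (intro exI[of _ x0]) auto
next
  case (insert kn M)
  obtain k n where kn: "kn = (k, n)" by (cases kn)
  have pos: "\<epsilon> > 0" "\<epsilon> / 2 > 0" and M: "\<forall>(k, n)\<in>M. \<exists>j<k. n j \<noteq> 0"
    using insert.prems by auto
  obtain x where x: "\<forall>j. \<bar>x j - x0 j\<bar> < \<epsilon> / 2" "\<forall>(k, n)\<in>M. (\<Sum>j<k. n j * x j) \<noteq> 0"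
    using insert.IH[OF M pos(2)] by blast
  show ?case
  proof (cases "(\<Sum>j<k. n j * x j) = 0")
    case False
    have "\<bar>x j - x0 j\<bar> < \<epsilon>" for j using x(1)[rule_format, of j] pos by linarith
    with False x(2) show ?thesis by (intro exI[of _ x]) (auto simp: kn)
  next
    case True
    obtain i where i: "i < k" "n i \<noteq> 0" using insert.prems(1) by (auto simp: kn)
    define bad where "bad = (\<lambda>(k', m). - (\<Sum>j<k'. m j * x j) / m i) ` M"
    have "infinite {0<..<\<epsilon> / 2}" using pos by (simp add: infinite_Ioo)
    then have "infinite ({0<..<\<epsilon> / 2} - bad)" using insert.hyps by (simp add: bad_def)
    then obtain \<delta> where \<delta>: "0 < \<delta>" "\<delta> < \<epsilon> / 2" "\<delta> \<notin> bad"
      by (metis DiffE finite.emptyI greaterThanLessThan_iff ex_in_conv)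
    define y where "y = x(i := x i + \<delta>)"
    have sum_y: "(\<Sum>j<k'. m j * y j) = (\<Sum>j<k'. m j * x j) + (if i < k' then m i * \<delta> else 0)" for k' m
    proof -
      have "(\<Sum>j<k'. m j * y j) = (\<Sum>j<k'. m j * x j + (if j = i then m i * \<delta> else 0))"
        by (intro sum.cong) (auto simp: y_def algebra_simps)
      then show ?thesis by (simp add: sum.distrib)
    qed
    have "(\<Sum>j<k'. m j * y j) \<noteq> 0" if "(k', m) \<in> M" for k' m
    proof
      assume 0: "(\<Sum>j<k'. m j * y j) = 0"
      have nz: "(\<Sum>j<k'. m j * x j) \<noteq> 0" using x(2) that by auto
      then have "m i \<noteq> 0" "(\<Sum>j<k'. m j * x j) + m i * \<delta> = 0"
        using 0 unfolding sum_y by (auto split: if_splits)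
      then have "\<delta> = - (\<Sum>j<k'. m j * x j) / m i" by (simp add: field_simps)
      then show False using \<delta>(3) that by (force simp: bad_def)
    qed
    moreover have "(\<Sum>j<k. n j * y j) \<noteq> 0"
      using sum_y True i \<delta> by simp
    moreover have "\<bar>y j - x0 j\<bar> < \<epsilon>" for j
    proof (cases "j = i")
      case True
      have "\<bar>x i + \<delta> - x0 i\<bar> < \<epsilon>" using x(1)[rule_format, of i] \<delta> by linarith
      then show ?thesis using True by (simp add: y_def)
    next
      case False
      have "\<bar>x j - x0 j\<bar> < \<epsilon>" using x(1)[rule_format, of j] pos by linarith
      then show ?thesis using False by (simp add: y_def)
    qed
    ultimately show ?thesis by (intro exI[of _ y]) (auto simp: kn)
  qed
qed

lemma relation_upto_cong:
  "(\<And>v j. v \<in> \<sigma> \<Longrightarrow> F v j = F' v j) \<Longrightarrow> relation_upto F k \<sigma> \<alpha> = relation_upto F' k \<sigma> \<alpha>"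
  by (simp add: relation_upto_def)

text \<open>
  The vectors are perturbed one after another. A new vector has to avoid the span of any \<open>k - 1\<close> earlier ones
  within the first \<open>k\<close> coordinates, and such a span is contained in a hyperplane, with normal vector \<open>n \<rho> k\<close>.
\<close>
lemma generic_perturbation:
  fixes G :: "'b \<Rightarrow> nat \<Rightarrow> real"
  assumes "finite B" "\<epsilon> > 0"
  shows "\<exists>G'. (\<forall>b j. \<bar>G' b j - G b j\<bar> < \<epsilon>) \<and> generic G' d B"
  using assms(1)
proof (induction B rule: finite_induct)
  case empty
  show ?case using assms(2) by (intro exI[of _ G]) (auto simp: generic_def)
next
  case (insert b B)
  obtain G' where G': "\<forall>b j. \<bar>G' b j - G b j\<bar> < \<epsilon>" "generic G' d B" using insert.IH by blast
  have "\<exists>\<mu>. (\<forall>v\<in>\<rho>. (\<Sum>j<k. \<mu> j * G' v j) = 0) \<and> (\<exists>j<k. \<mu> j \<noteq> 0)" if "\<rho> \<subseteq> B" "card \<rho> < k" for \<rho> k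
    using nontrivial_solution[of \<rho> "{..<k}" "\<lambda>j v. G' v j"] that insert.hyps(1) finite_subset[of \<rho> B] by auto
  then obtain n where n: "\<And>\<rho> k. \<rho> \<subseteq> B \<Longrightarrow> card \<rho> < k \<Longrightarrow>
      (\<forall>v\<in>\<rho>. (\<Sum>j<k. n \<rho> k j * G' v j) = 0) \<and> (\<exists>j<k. n \<rho> k j \<noteq> 0)" by metis
  define M where "M = (\<lambda>(\<rho>, k). (k, n \<rho> k)) ` {(\<rho>, k). \<rho> \<subseteq> B \<and> k \<le> d \<and> card \<rho> < k}"
  have "finite {(\<rho>, k). \<rho> \<subseteq> B \<and> k \<le> d \<and> card \<rho> < k}"
    by (rule finite_subset[of _ "Pow B \<times> {..d}"]) (use insert.hyps in auto)
  then have "finite M" by (simp add: M_def)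
  moreover have "\<forall>(k, n)\<in>M. \<exists>j<k. n j \<noteq> 0" using n by (auto simp: M_def)
  ultimately obtain x where x: "\<forall>j. \<bar>x j - G b j\<bar> < \<epsilon>" "\<forall>(k, n)\<in>M. (\<Sum>j<k. n j * x j) \<noteq> 0"
    using avoid_hyperplanes[of M \<epsilon> "G b"] assms(2) by blast
  define H where "H = G'(b := x)"
  have "generic H d (insert b B)"
    unfolding generic_def
  proof (intro allI impI)
    fix k \<rho> \<alpha>
    assume k: "k \<le> d" and \<rho>: "\<rho> \<subseteq> insert b B" "card \<rho> \<le> k" and rel: "relation_upto H k \<rho> \<alpha>"
    have old: "\<forall>v\<in>\<rho>'. \<alpha> v = 0" if "\<rho>' \<subseteq> B" "card \<rho>' \<le> k" "relation_upto H k \<rho>' \<alpha>" for \<rho>'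
    proof -
      have "relation_upto G' k \<rho>' \<alpha> = relation_upto H k \<rho>' \<alpha>"
        by (rule relation_upto_cong) (use that insert.hyps(2) in \<open>auto simp: H_def\<close>)
      then show ?thesis using G'(2) k that unfolding generic_def by blast
    qed
    show "\<forall>v\<in>\<rho>. \<alpha> v = 0"
    proof (cases "b \<in> \<rho>")
      case False
      then show ?thesis using old[of \<rho>] \<rho> rel by auto
    next
      case True
      define \<rho>' where "\<rho>' = \<rho> - {b}"
      have fin: "finite \<rho>" using \<rho>(1) insert.hyps(1) finite_subset by blast
      have \<rho>': "\<rho>' \<subseteq> B" "card \<rho>' < k" "\<rho> = insert b \<rho>'" "b \<notin> \<rho>'" "finite \<rho>'"
        using True \<rho> fin card_gt_0_iff[of \<rho>] by (auto simp: \<rho>'_def)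
      let ?n = "n \<rho>' k"
      have "(k, ?n) \<in> M" using \<rho>' k by (auto simp: M_def image_iff)
      then have nx: "(\<Sum>j<k. ?n j * x j) \<noteq> 0" using x(2) by auto
      have "0 = (\<Sum>j<k. ?n j * (\<Sum>v\<in>\<rho>. \<alpha> v * H v j))"
        using rel by (simp add: relation_upto_def)
      also have "\<dots> = (\<Sum>v\<in>\<rho>. \<Sum>j<k. ?n j * (\<alpha> v * H v j))"
        unfolding sum_distrib_left by (rule sum.swap)
      also have "\<dots> = (\<Sum>v\<in>\<rho>. \<alpha> v * (\<Sum>j<k. ?n j * H v j))"
        by (simp add: sum_distrib_left algebra_simps)
      also have "\<dots> = \<alpha> b * (\<Sum>j<k. ?n j * x j) + (\<Sum>v\<in>\<rho>'. \<alpha> v * (\<Sum>j<k. ?n j * H v j))"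
        using \<rho>' by (simp add: H_def)
      also have "(\<Sum>v\<in>\<rho>'. \<alpha> v * (\<Sum>j<k. ?n j * H v j)) = (\<Sum>v\<in>\<rho>'. \<alpha> v * (\<Sum>j<k. ?n j * G' v j))"
        using \<rho>'(4) by (intro sum.cong refl) (auto simp: H_def)
      also have "\<dots> = 0"
        using n[OF \<rho>'(1,2)] by (intro sum.neutral) auto
      finally have "\<alpha> b = 0" using nx by simp
      moreover have "relation_upto H k \<rho>' \<alpha>"
        using rel \<open>\<alpha> b = 0\<close> \<rho>' by (subst relation_upto_support[of \<rho>]) auto
      ultimately show ?thesis using old[of \<rho>'] \<rho>' by auto
    qed
  qed
  moreover have "\<forall>b' j. \<bar>H b' j - G b' j\<bar> < \<epsilon>" using G' x by (auto simp: H_def)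
  ultimately show ?case by blast
qed

definition signed :: "('b \<Rightarrow> nat \<Rightarrow> real) \<Rightarrow> 'b \<times> bool \<Rightarrow> nat \<Rightarrow> real"
  where "signed G v j = (if snd v then G (fst v) j else - G (fst v) j)"

definition flip :: "'b \<times> bool \<Rightarrow> 'b \<times> bool"
  where "flip v = (fst v, \<not> snd v)"

lemma flip_flip [simp]: "flip (flip v) = v"
  by (simp add: flip_def)

lemma signed_flip: "signed G (flip v) j = - signed G v j"
  by (simp add: signed_def flip_def)

lemma generic_signed:
  assumes gen: "generic G d B" and inj: "inj_on fst \<sigma>" and sub: "fst ` \<sigma> \<subseteq> B"
  shows "generic (signed G) d \<sigma>"
  unfolding generic_def
proof (intro allI impI ballI)
  fix k \<rho> \<alpha> v
  assume k: "k \<le> d" and \<rho>: "\<rho> \<subseteq> \<sigma>" "card \<rho> \<le> k" and rel: "relation_upto (signed G) k \<rho> \<alpha>" and v: "v \<in> \<rho>"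
  have inj\<rho>: "inj_on fst \<rho>" using inj \<rho>(1) inj_on_subset by blast
  define s where "s v = (if snd v then 1 else - 1 :: real)" for v :: "'a \<times> bool"
  define \<beta> where "\<beta> b = (let v = inv_into \<rho> fst b in s v * \<alpha> v)" for b
  have \<beta>: "\<beta> (fst v) = s v * \<alpha> v" if "v \<in> \<rho>" for v
    using inj\<rho> that by (simp add: \<beta>_def)
  have "(\<Sum>b\<in>fst ` \<rho>. \<beta> b * G b j) = (\<Sum>v\<in>\<rho>. \<alpha> v * signed G v j)" for j
    unfolding sum.reindex[OF inj\<rho>] o_def by (intro sum.cong refl) (auto simp: \<beta> s_def signed_def)
  then have "relation_upto G k (fst ` \<rho>) \<beta>"
    using rel by (simp add: relation_upto_def)
  moreover have "card (fst ` \<rho>) \<le> k" using \<rho>(2) card_image[OF inj\<rho>] by simp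
  moreover have "fst ` \<rho> \<subseteq> B" using sub \<rho>(1) by blast
  ultimately have "\<beta> (fst v) = 0" using gen k v unfolding generic_def by blast
  then show "\<alpha> v = 0" using \<beta>[OF v] by (simp add: s_def split: if_splits)
qed

text \<open>
  The weights form a compact simplex, on which the size \<open>g\<close> of the combined vector has a positive minimum when
  the origin is not in the convex hull.
\<close>
lemma not_crosses_robust:
  fixes F :: "'v \<Rightarrow> nat \<Rightarrow> real"
  assumes fin: "finite \<sigma>" and no: "\<not> crosses F d \<sigma>"
  shows "\<exists>\<epsilon>>0. \<forall>F'. (\<forall>v\<in>\<sigma>. \<forall>j. \<bar>F' v j - F v j\<bar> < \<epsilon>) \<longrightarrow> \<not> crosses F' d \<sigma>"
proof -
  define box where "box = PiE UNIV (\<lambda>v. if v \<in> \<sigma> then {0..1} else {0::real})"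
  define K where "K = box \<inter> {\<alpha>. sum \<alpha> \<sigma> = 1}"
  define g where "g \<alpha> = (\<Sum>j<d. \<bar>\<Sum>v\<in>\<sigma>. \<alpha> v * F v j\<bar>)" for \<alpha>
  have "compactin (product_topology (\<lambda>_. euclidean) UNIV) box"
    unfolding box_def by (subst compactin_PiE) simp
  then have "compact box" by (simp add: euclidean_product_topology)
  moreover have "continuous_on UNIV (\<lambda>\<alpha>::'v \<Rightarrow> real. \<Sum>v\<in>\<sigma>. \<alpha> v)"
    by (intro continuous_on_sum continuous_on_product_coordinates)
  then have "closed {\<alpha>::'v \<Rightarrow> real. sum \<alpha> \<sigma> = 1}"
    using closed_Collect_eq[of "\<lambda>\<alpha>. \<Sum>v\<in>\<sigma>. \<alpha> v" "\<lambda>_. 1::real"] by simp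
  ultimately have "compact K" unfolding K_def by (rule compact_Int_closed)
  have K: "\<exists>\<alpha>'\<in>K. \<forall>v\<in>\<sigma>. \<alpha>' v = \<alpha> v" if "convex_weights \<sigma> \<alpha>" for \<alpha>
  proof (intro bexI[of _ "\<lambda>v. if v \<in> \<sigma> then \<alpha> v else 0"])
    have "\<alpha> v \<le> 1" if "v \<in> \<sigma>" for v
      using member_le_sum[of v \<sigma> \<alpha>] that fin \<open>convex_weights \<sigma> \<alpha>\<close> by (auto simp: convex_weights_def)
    then show "(\<lambda>v. if v \<in> \<sigma> then \<alpha> v else 0) \<in> K"
      using that by (auto simp: K_def box_def convex_weights_def)
  qed auto
  have K_weights: "convex_weights \<sigma> \<alpha>" if "\<alpha> \<in> K" for \<alpha>
    using that by (fastforce simp: K_def box_def convex_weights_def PiE_iff split: if_splits)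
  show ?thesis
  proof (cases "K = {}")
    case True
    then have "\<not> crosses F' d \<sigma>" for F' using K unfolding crosses_def by blast
    then show ?thesis by (intro exI[of _ 1]) auto
  next
    case False
    have "continuous_on K (\<lambda>\<alpha>. \<alpha> v * F v j)" for v j
      by (intro continuous_on_mult_right continuous_on_subset[OF continuous_on_product_coordinates]) auto
    then have "continuous_on K g"
      unfolding g_def[abs_def] by (intro continuous_on_sum continuous_on_rabs)
    then obtain \<alpha>0 where \<alpha>0: "\<alpha>0 \<in> K" "\<And>\<alpha>. \<alpha> \<in> K \<Longrightarrow> g \<alpha>0 \<le> g \<alpha>"
      using continuous_attains_inf[OF \<open>compact K\<close> False] by blast
    have "g \<alpha>0 \<ge> 0" by (auto simp: g_def intro: sum_nonneg)
    moreover have "g \<alpha>0 \<noteq> 0"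
    proof
      assume "g \<alpha>0 = 0"
      then have "relation_upto F d \<sigma> \<alpha>0"
        by (auto simp: g_def relation_upto_def sum_nonneg_eq_0_iff)
      then show False using no K_weights[OF \<alpha>0(1)] by (auto simp: crosses_def)
    qed
    ultimately have g0: "g \<alpha>0 > 0" by simp
    define \<epsilon> where "\<epsilon> = g \<alpha>0 / (real d + 1)"
    have \<epsilon>: "\<epsilon> > 0" "real d * \<epsilon> < g \<alpha>0" using g0 by (auto simp: \<epsilon>_def field_simps)
    have "\<not> crosses F' d \<sigma>" if close: "\<forall>v\<in>\<sigma>. \<forall>j. \<bar>F' v j - F v j\<bar> < \<epsilon>" for F'
    proof
      assume "crosses F' d \<sigma>"
      then obtain \<beta> where \<beta>: "convex_weights \<sigma> \<beta>" "relation_upto F' d \<sigma> \<beta>" unfolding crosses_def by blast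
      obtain \<alpha> where \<alpha>: "\<alpha> \<in> K" "\<forall>v\<in>\<sigma>. \<alpha> v = \<beta> v" using K[OF \<beta>(1)] by blast
      have rel: "relation_upto F' d \<sigma> \<alpha>" using \<beta>(2) \<alpha>(2) by (simp add: relation_upto_def)
      have w: "convex_weights \<sigma> \<alpha>" using K_weights[OF \<alpha>(1)] .
      have "\<bar>\<Sum>v\<in>\<sigma>. \<alpha> v * F v j\<bar> \<le> \<epsilon>" if "j < d" for j
      proof -
        have "(\<Sum>v\<in>\<sigma>. \<alpha> v * F v j) = (\<Sum>v\<in>\<sigma>. \<alpha> v * (F v j - F' v j))"
          using rel that by (simp add: relation_upto_def algebra_simps sum_subtractf)
        also have "\<bar>\<dots>\<bar> \<le> (\<Sum>v\<in>\<sigma>. \<bar>\<alpha> v * (F v j - F' v j)\<bar>)" by (rule sum_abs)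
        also have "\<dots> \<le> (\<Sum>v\<in>\<sigma>. \<alpha> v * \<epsilon>)"
        proof (rule sum_mono)
          fix v assume v: "v \<in> \<sigma>"
          have "\<bar>F v j - F' v j\<bar> \<le> \<epsilon>" using close v by (metis abs_minus_commute less_imp_le)
          then show "\<bar>\<alpha> v * (F v j - F' v j)\<bar> \<le> \<alpha> v * \<epsilon>"
            using w v by (simp add: convex_weights_def abs_mult mult_left_mono)
        qed
        also have "\<dots> = \<epsilon>" using w by (simp add: convex_weights_def flip: sum_distrib_right)
        finally show ?thesis .
      qed
      then have "g \<alpha> \<le> (\<Sum>j<d. \<epsilon>)" unfolding g_def by (intro sum_mono) auto
      then show False using \<alpha>0(2)[OF \<alpha>(1)] \<epsilon>(2) by simp
    qed
    then show ?thesis using \<epsilon>(1) by blast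
  qed
qed

text \<open>
  The chain form of the Borsuk-Ulam theorem. The chains \<open>c k\<close> play the role of hemispheres of dimension \<open>k\<close>, each bounded by the
  sphere made of the previous hemisphere and its antipode. By \<open>not_crosses_robust\<close> a sufficiently small perturbation to generic position
  makes none of the finitely many simplices of \<open>c d\<close> cross that did not cross before.
\<close>
lemma odd_chains_cross_origin:
  fixes c :: "nat \<Rightarrow> ('b \<times> bool) set \<Rightarrow> bit"
  assumes "finite B"
    and supp: "\<And>k \<sigma>. k \<le> d \<Longrightarrow> c k \<sigma> \<noteq> 0 \<Longrightarrow> \<sigma> \<subseteq> B \<times> UNIV \<and> card \<sigma> = Suc k \<and> inj_on fst \<sigma>"
    and c0: "bd (B \<times> UNIV) (c 0) {} = 1"
    and cSuc: "\<And>k \<sigma>. k < d \<Longrightarrow> bd (B \<times> UNIV) (c (Suc k)) \<sigma> = c k \<sigma> + c k (flip ` \<sigma>)"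
  shows "\<exists>\<sigma>. c d \<sigma> \<noteq> 0 \<and> crosses (signed G) d \<sigma>"
proof (rule ccontr)
  assume none: "\<not> ?thesis"
  define S where "S = {\<sigma>. c d \<sigma> \<noteq> 0}"
  have fin: "finite \<sigma>" if "\<sigma> \<in> S" for \<sigma>
  proof -
    have "card \<sigma> = Suc d" using supp[of d \<sigma>] that by (simp add: S_def)
    then show ?thesis by (simp add: card_ge_0_finite)
  qed
  have "S \<subseteq> Pow (B \<times> UNIV)" using supp[of d] by (auto simp: S_def)
  then have finS: "finite S" by (rule finite_subset) (use assms(1) in auto)
  have "\<exists>\<epsilon>>0. \<forall>F'. (\<forall>v\<in>\<sigma>. \<forall>j. \<bar>F' v j - signed G v j\<bar> < \<epsilon>) \<longrightarrow> \<not> crosses F' d \<sigma>" if "\<sigma> \<in> S" for \<sigma>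
    using not_crosses_robust[OF fin[OF that]] none that by (auto simp: S_def)
  then obtain e where e: "\<And>\<sigma>. \<sigma> \<in> S \<Longrightarrow> e \<sigma> > 0"
    "\<And>\<sigma> F'. \<sigma> \<in> S \<Longrightarrow> \<forall>v\<in>\<sigma>. \<forall>j. \<bar>F' v j - signed G v j\<bar> < e \<sigma> \<Longrightarrow> \<not> crosses F' d \<sigma>"
    by metis
  define \<epsilon> where "\<epsilon> = Min (insert 1 (e ` S))"
  have \<epsilon>: "\<epsilon> > 0" "\<And>\<sigma>. \<sigma> \<in> S \<Longrightarrow> \<epsilon> \<le> e \<sigma>"
    using finS e(1) by (auto simp: \<epsilon>_def)
  obtain G' where G': "\<forall>b j. \<bar>G' b j - G b j\<bar> < \<epsilon>" "generic G' d B"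
    using generic_perturbation[OF assms(1) \<epsilon>(1)] by blast
  have "\<exists>\<sigma>. c d \<sigma> \<noteq> 0 \<and> crosses (signed G') d \<sigma>"
  proof (rule generic_simplex_crosses[where opp = flip and V = "B \<times> UNIV"])
    show "flip ` (B \<times> UNIV) = B \<times> UNIV"
      by (auto simp: flip_def image_iff)
    show "\<sigma> \<subseteq> B \<times> UNIV \<and> card \<sigma> = Suc k \<and> generic (signed G') d \<sigma>" if "k \<le> d" "c k \<sigma> \<noteq> 0" for k \<sigma>
    proof -
      note \<sigma> = supp[OF that]
      then have "fst ` \<sigma> \<subseteq> B" by auto
      with \<sigma> generic_signed[OF G'(2)] show ?thesis by blast
    qed
  qed (use assms in \<open>auto simp: signed_flip\<close>)
  then obtain \<sigma> where \<sigma>: "\<sigma> \<in> S" "crosses (signed G') d \<sigma>" by (auto simp: S_def)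
  have "\<bar>signed G' v j - signed G v j\<bar> < e \<sigma>" for v j
    using G'(1)[rule_format, of "fst v" j] \<epsilon>(2)[OF \<sigma>(1)] by (auto simp: signed_def abs_minus_commute)
  then show False using e(2)[OF \<sigma>(1)] \<sigma>(2) by blast
qed

section \<open>An antipodal cell structure on the sphere\<close>

lemma sum_involution_eq_0:
  fixes g :: "'a \<Rightarrow> 'w \<Rightarrow> bit"
  assumes "finite T" and "\<And>t. t \<in> T \<Longrightarrow> \<iota> t \<in> T \<and> \<iota> (\<iota> t) = t \<and> \<iota> t \<noteq> t \<and> g (\<iota> t) = g t"
  shows "sum g T = 0"
  using assms
proof (induction T rule: finite_psubset_induct)
  case (psubset T)
  show ?case
  proof (cases "T = {}")
    case False
    then obtain t where t: "t \<in> T" by blast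
    define R where "R = T - {t, \<iota> t}"
    have R: "T = insert t (insert (\<iota> t) R)" "t \<notin> insert (\<iota> t) R" "\<iota> t \<notin> R" "finite R" "R \<subset> T"
      using t psubset.prems[OF t] psubset.hyps by (auto simp: R_def)
    have inv: "\<iota> u \<in> R \<and> \<iota> (\<iota> u) = u \<and> \<iota> u \<noteq> u \<and> g (\<iota> u) = g u" if "u \<in> R" for u
      using psubset.prems[of u] psubset.prems[of t] t that by (auto simp: R_def)
    have "sum g R = 0"
      using psubset.IH[OF R(5)] inv by blast
    then have "sum g T = g t + g (\<iota> t)"
      using R by simp
    then show ?thesis using psubset.prems[OF t] by simp
  qed simp
qed

lemma sum_off_diagonal_eq_0:
  fixes g :: "'a \<Rightarrow> 'a \<Rightarrow> 'w \<Rightarrow> bit"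
  assumes "finite I" and "\<And>i j. g i j = g j i"
  shows "(\<Sum>i\<in>I. \<Sum>j\<in>I - {i}. g i j) = 0"
proof -
  have "(\<Sum>i\<in>I. \<Sum>j\<in>I - {i}. g i j) = (\<Sum>(i, j)\<in>Sigma I (\<lambda>i. I - {i}). g i j)"
    using assms(1) by (intro sum.Sigma) auto
  also have "\<dots> = 0"
    using assms by (intro sum_involution_eq_0[where \<iota> = prod.swap]) auto
  finally show ?thesis .
qed

text \<open>
  Cells of the integer cubical grid in doubled coordinates: an even entry of \<open>c\<close> is a vertex of the line, an
  odd entry \<open>a\<close> is the edge between \<open>a - 1\<close> and \<open>a + 1\<close>. So the odd entries are the directions of the cell, their
  number is its dimension, and the facets arise by changing one odd entry by \<open>1\<close>. The antipode of \<open>c\<close> is \<open>- c\<close>.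
\<close>
definition odd_coords :: "(nat \<Rightarrow> int) \<Rightarrow> nat set"
  where "odd_coords c = {j. odd (c j)}"

definition rim :: "((nat \<Rightarrow> int) \<Rightarrow> 'a) \<Rightarrow> (nat \<Rightarrow> int) \<Rightarrow> ('a :: comm_monoid_add)"
  where "rim \<phi> c = (\<Sum>j\<in>odd_coords c. \<Sum>s\<in>{1, -1}. \<phi> (c(j := c j + s)))"

lemma odd_coords_face:
  "j \<in> odd_coords c \<Longrightarrow> s \<in> {1, -1} \<Longrightarrow> odd_coords (c(j := c j + s)) = odd_coords c - {j}"
  by (auto simp: odd_coords_def)

lemma odd_coords_uminus [simp]: "odd_coords (- c) = odd_coords c"
  by (simp add: odd_coords_def)

text \<open>The square of the boundary is zero: each face of codimension 2 is reached in two orders.\<close>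
lemma rim_rim:
  fixes \<phi> :: "(nat \<Rightarrow> int) \<Rightarrow> 'w \<Rightarrow> bit"
  assumes "finite (odd_coords c)"
  shows "rim (rim \<phi>) c = 0"
proof -
  define g where "g j i = (\<Sum>s\<in>{1, -1}. \<Sum>t\<in>{1, -1}. \<phi> (c(j := c j + s, i := c i + t)))" for j i
  have "rim (rim \<phi>) c = (\<Sum>j\<in>odd_coords c. \<Sum>i\<in>odd_coords c - {j}. g j i)"
    unfolding rim_def[of "rim \<phi>"]
  proof (rule sum.cong[OF refl])
    fix j assume j: "j \<in> odd_coords c"
    have "(\<Sum>s\<in>{1, -1}. rim \<phi> (c(j := c j + s)))
        = (\<Sum>s\<in>{1, -1}. \<Sum>i\<in>odd_coords c - {j}. \<Sum>t\<in>{1, -1}. \<phi> (c(j := c j + s, i := c i + t)))"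
      unfolding rim_def by (intro sum.cong refl) (auto simp: odd_coords_face[OF j])
    also have "\<dots> = (\<Sum>i\<in>odd_coords c - {j}. g j i)"
      unfolding g_def by (rule sum.swap)
    finally show "(\<Sum>s\<in>{1, -1}. rim \<phi> (c(j := c j + s))) = (\<Sum>i\<in>odd_coords c - {j}. g j i)" .
  qed
  also have "\<dots> = 0"
  proof (rule sum_off_diagonal_eq_0[OF assms])
    fix i j
    show "g i j = g j i"
    proof (cases "i = j")
      case False
      have "g i j = (\<Sum>t\<in>{1, -1}. \<Sum>s\<in>{1, -1}. \<phi> (c(i := c i + s, j := c j + t)))"
        unfolding g_def by (rule sum.swap)
      also have "\<dots> = g j i"
        unfolding g_def using False by (intro sum.cong refl arg_cong[of _ _ \<phi>]) (rule fun_upd_twist)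
      finally show ?thesis .
    qed simp
  qed
  finally show ?thesis .
qed

text \<open>The boundary of a cube with half side \<open>N\<close>. For even \<open>N\<close> it is a union of cells.\<close>
definition sphere_cells :: "nat \<Rightarrow> int \<Rightarrow> (nat \<Rightarrow> int) set"
  where "sphere_cells d N = {c. (\<forall>j>d. c j = 0) \<and> (\<forall>j. \<bar>c j\<bar> \<le> N) \<and> (\<exists>j. \<bar>c j\<bar> = N)}"

lemma finite_odd_coords: "c \<in> sphere_cells d N \<Longrightarrow> finite (odd_coords c)"
  by (rule finite_subset[of _ "{..d}"]) (auto simp: sphere_cells_def odd_coords_def not_le[symmetric])

lemma face_in_sphere_cells:
  assumes "even N" "c \<in> sphere_cells d N" "j \<in> odd_coords c" "s \<in> {1, -1}"
  shows "c(j := c j + s) \<in> sphere_cells d N"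
proof -
  have j: "odd (c j)" using assms by (simp add: odd_coords_def)
  have N: "\<bar>c j\<bar> \<noteq> N" using j \<open>even N\<close> by auto
  then have "\<bar>c j\<bar> < N" using assms(2) by (auto simp: sphere_cells_def less_le)
  then have "\<bar>c j + s\<bar> \<le> N" using assms(4) by auto
  moreover obtain i where "\<bar>c i\<bar> = N" using assms(2) by (auto simp: sphere_cells_def)
  moreover have "j \<le> d" using assms(2) j by (force simp: sphere_cells_def not_le[symmetric])
  ultimately show ?thesis using assms(2) N by (auto simp: sphere_cells_def intro!: exI[of _ i])
qed

lemma uminus_in_sphere_cells: "c \<in> sphere_cells d N \<Longrightarrow> - c \<in> sphere_cells d N"
  by (simp add: sphere_cells_def)

text \<open>
  The top-dimensional cells of the upper half of the boundary of the \<open>(k+1)\<close>-dimensional cube: exactly one entry, of absolute value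
  \<open>N\<close>, is even, and the last entry is not negative.
\<close>
definition hemisphere :: "int \<Rightarrow> nat \<Rightarrow> (nat \<Rightarrow> int) set"
  where "hemisphere N k = {c. (\<forall>j>k. c j = 0) \<and> c k \<ge> 0 \<and>
    (\<exists>i\<le>k. \<bar>c i\<bar> = N \<and> (\<forall>j\<le>k. j \<noteq> i \<longrightarrow> odd (c j) \<and> \<bar>c j\<bar> < N))}"

lemma finite_hemisphere: "finite (hemisphere N k)"
proof -
  have "hemisphere N k \<subseteq> {c. \<forall>j. (j \<in> {..k} \<longrightarrow> c j \<in> {-N..N}) \<and> (j \<notin> {..k} \<longrightarrow> c j = 0)}"
  proof (intro subsetI CollectI allI conjI impI)
    fix c j assume c: "c \<in> hemisphere N k" and "j \<in> {..k}"
    then have "\<bar>c j\<bar> \<le> N" by (auto simp: hemisphere_def)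
    then show "c j \<in> {-N..N}" by auto
  qed (auto simp: hemisphere_def)
  moreover have "finite {c :: nat \<Rightarrow> int. \<forall>j. (j \<in> {..k} \<longrightarrow> c j \<in> {-N..N}) \<and> (j \<notin> {..k} \<longrightarrow> c j = 0)}"
    by (intro finite_set_of_finite_funs) auto
  ultimately show ?thesis by (rule finite_subset)
qed

lemma hemisphere_odd_coords:
  assumes "even N" "c \<in> hemisphere N k"
  obtains i where "i \<le> k" "\<bar>c i\<bar> = N" "odd_coords c = {..k} - {i}" "(LEAST i. even (c i)) = i"
    "\<And>j. j \<le> k \<Longrightarrow> j \<noteq> i \<Longrightarrow> odd (c j) \<and> \<bar>c j\<bar> < N"
proof -
  obtain i where i: "i \<le> k" "\<bar>c i\<bar> = N" "\<And>j. j \<le> k \<Longrightarrow> j \<noteq> i \<Longrightarrow> odd (c j) \<and> \<bar>c j\<bar> < N"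
    using assms by (auto simp: hemisphere_def)
  have ev: "even (c i)" using i(2) \<open>even N\<close> by (metis dvd_abs_iff)
  show ?thesis
  proof (rule that[OF i(1,2) _ _ i(3)])
    show "odd_coords c = {..k} - {i}"
    proof (intro set_eqI iffI)
      fix j assume "j \<in> odd_coords c"
      then have o: "odd (c j)" by (simp add: odd_coords_def)
      have "j \<le> k" using assms(2) o by (force simp: hemisphere_def not_le[symmetric])
      then show "j \<in> {..k} - {i}" using ev o by auto
    qed (use i in \<open>auto simp: odd_coords_def\<close>)
    show "(LEAST i. even (c i)) = i"
      by (rule Least_equality) (use ev i in \<open>auto simp: not_le[symmetric] dest: order.trans\<close>, metis i(1,3) nat_le_linear order.trans)
  qed
qed

lemma hemisphere_subset_sphere_cells:
  assumes "even N" "N > 0" "k \<le> d" "c \<in> hemisphere N k"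
  shows "c \<in> sphere_cells d N" "card (odd_coords c) = k"
proof -
  obtain i where i: "i \<le> k" "\<bar>c i\<bar> = N" "odd_coords c = {..k} - {i}" "\<And>j. j \<le> k \<Longrightarrow> j \<noteq> i \<Longrightarrow> odd (c j) \<and> \<bar>c j\<bar> < N"
    using hemisphere_odd_coords[OF assms(1,4)] by metis
  have "\<bar>c j\<bar> \<le> N" for j
    using i(2) i(4)[of j] assms by (cases "j \<le> k"; cases "j = i") (auto simp: hemisphere_def)
  then show "c \<in> sphere_cells d N"
    using assms i by (auto simp: sphere_cells_def hemisphere_def)
  show "card (odd_coords c) = k" using i by simp
qed


text \<open>
  The boundary of a hemisphere is the sphere of the next lower dimension. In the sum over all facets of all cells of the hemisphere, the facets off the equator
  cancel in pairs by the involution \<open>\<iota>\<close>: a facet in the interior of a side of the cube is shared with the next cell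
  in the same direction, and a facet on an edge between two sides is shared with a cell on the other side. The
  facets on the equator, with \<open>k\<close>-th entry of either sign, form the lower hemisphere and its antipode.
\<close>
lemma hemisphere_rim:
  fixes \<phi> :: "(nat \<Rightarrow> int) \<Rightarrow> 'w \<Rightarrow> bit"
  assumes N: "even N" "N > 0"
  shows "(\<Sum>c\<in>hemisphere N (Suc k). rim \<phi> c) = (\<Sum>c\<in>hemisphere N k. \<phi> c + \<phi> (- c))"
proof -
  let ?H = "hemisphere N (Suc k)"
  define T where "T = Sigma ?H (\<lambda>c. odd_coords c \<times> {1, -1 :: int})"
  define face where "face = (\<lambda>(c :: nat \<Rightarrow> int, j, s). c(j := c j + s))"
  define equator where "equator = {t \<in> T. fst (snd t) = Suc k \<and> face t (Suc k) = 0}"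
  \<comment> \<open>Cross the facet \<open>f\<close> to the neighbouring cell. If \<open>f\<close> lies on an edge of the cube, the even entry \<open>i\<close> of \<open>c\<close> becomes the new direction.\<close>
  define \<iota> where "\<iota> = (\<lambda>(c :: nat \<Rightarrow> int, j, s). let f = c(j := c j + s); i = (LEAST i. even (c i)) in
    if \<bar>f j\<bar> < N then (f(j := f j + s), j, - s) else (f(i := f i - sgn (f i)), i, sgn (f i)))"
  have \<iota>_along: "\<iota> (c, j, s) = (c(j := c j + s + s), j, - s)" if "\<bar>c j + s\<bar> < N" for c j s
    using that by (simp add: \<iota>_def Let_def)
  have \<iota>_corner: "\<iota> (c, j, s) = (f(i := f i - sgn (f i)), i, sgn (f i))"
    if "\<not> \<bar>c j + s\<bar> < N" "f = c(j := c j + s)" "(LEAST i. even (c i)) = i" for c j s f i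
    using that by (simp add: \<iota>_def Let_def)
  have fin_odd: "finite (odd_coords c)" if c: "c \<in> ?H" for c
    by (rule hemisphere_odd_coords[OF N(1) c]) simp
  have finT: "finite T"
    unfolding T_def by (intro finite_SigmaI finite_cartesian_product finite_hemisphere fin_odd) auto
  have "(\<Sum>c\<in>?H. rim \<phi> c) = (\<Sum>t\<in>T. \<phi> (face t))"
  proof -
    have "rim \<phi> c = (\<Sum>(j, s)\<in>odd_coords c \<times> {1, -1}. \<phi> (face (c, j, s)))" for c
      unfolding rim_def sum.cartesian_product by (simp add: face_def)
    then have "(\<Sum>c\<in>?H. rim \<phi> c) = (\<Sum>c\<in>?H. \<Sum>js\<in>odd_coords c \<times> {1, -1}. \<phi> (face (c, js)))"
      by (simp add: case_prod_unfold)
    also have "\<dots> = (\<Sum>t\<in>T. \<phi> (face t))"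
      unfolding T_def
      by (subst sum.Sigma) (auto simp: case_prod_unfold finite_hemisphere fin_odd)
    finally show ?thesis .
  qed
  also have "\<dots> = (\<Sum>t\<in>T - equator. \<phi> (face t)) + (\<Sum>t\<in>equator. \<phi> (face t))"
    using finT by (intro sum.subset_diff) (auto simp: equator_def)
  also have "(\<Sum>t\<in>T - equator. \<phi> (face t)) = 0"
  proof (rule sum_involution_eq_0[where \<iota> = \<iota>])
    fix t assume t: "t \<in> T - equator"
    obtain c j s where tcjs: "t = (c, j, s)" by (cases t)
    have c: "c \<in> ?H" and j: "j \<in> odd_coords c" and s: "s = 1 \<or> s = -1"
      using t by (auto simp: tcjs T_def)
    obtain i where i: "i \<le> Suc k" "\<bar>c i\<bar> = N" "odd_coords c = {..Suc k} - {i}" "(LEAST i. even (c i)) = i"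
      and odd: "\<And>j. j \<le> Suc k \<Longrightarrow> j \<noteq> i \<Longrightarrow> odd (c j) \<and> \<bar>c j\<bar> < N"
      using hemisphere_odd_coords[OF N(1) c] by metis
    have ji: "j \<le> Suc k" "j \<noteq> i" using j i(3) by auto
    have cj: "odd (c j)" "\<bar>c j\<bar> < N" using odd[OF ji] by auto
    have zero: "\<forall>j>Suc k. c j = 0" and top: "c (Suc k) \<ge> 0" using c by (auto simp: hemisphere_def)
    define f where "f = c(j := c j + s)"
    have off: "\<not> (j = Suc k \<and> f (Suc k) = 0)"
      using t by (auto simp: equator_def tcjs face_def f_def)
    have fj: "f j = c j + s" "f i = c i" "even (f j)" using ji s cj by (auto simp: f_def)
    have mk: "(c', j', s') \<in> T - equator"
      if "c' \<in> ?H" "j' \<in> odd_coords c'" "s' \<in> {1, -1}" "c' j' + s' = f j'" "j' = Suc k \<Longrightarrow> f (Suc k) \<noteq> 0" for c' j' s'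
      using that by (auto simp: T_def equator_def face_def)
    show "\<iota> t \<in> T - equator \<and> \<iota> (\<iota> t) = t \<and> \<iota> t \<noteq> t \<and> \<phi> (face (\<iota> t)) = \<phi> (face t)"
    proof (cases "\<bar>f j\<bar> < N")
      case True
      define c' where "c' = f(j := f j + s)"
      have \<iota>t: "\<iota> t = (c', j, - s)"
        using \<iota>_along[of c j s] True by (simp add: tcjs f_def c'_def)
      have c'j: "odd (c' j)" "\<bar>c' j\<bar> < N"
      proof -
        show o: "odd (c' j)" using fj s by (auto simp: c'_def)
        have "\<bar>c' j\<bar> \<le> N" using True s by (auto simp: c'_def)
        moreover have "\<bar>c' j\<bar> \<noteq> N" using o N(1) by auto
        ultimately show "\<bar>c' j\<bar> < N" by simp
      qed
      have c'_other: "c' l = c l" if "l \<noteq> j" for l using that by (simp add: c'_def f_def)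
      have "c' (Suc k) \<ge> 0"
      proof (cases "j = Suc k")
        case True
        have "c j \<noteq> 0" using cj(1) by auto
        then have "c j > 0" using top True by simp
        then have "f j \<noteq> 0" "f j \<ge> 0" using off fj(1) s True by auto
        then show ?thesis using True s by (auto simp: c'_def)
      qed (use top c'_other in auto)
      moreover have "\<exists>i\<le>Suc k. \<bar>c' i\<bar> = N \<and> (\<forall>l\<le>Suc k. l \<noteq> i \<longrightarrow> odd (c' l) \<and> \<bar>c' l\<bar> < N)"
      proof (intro exI[of _ i] conjI allI impI)
        show "odd (c' l)" "\<bar>c' l\<bar> < N" if "l \<le> Suc k" "l \<noteq> i" for l
          using that c'j odd[OF that] c'_other[of l] by (cases "l = j"; simp)+
      qed (use i c'_other ji in auto)
      moreover have "\<forall>l>Suc k. c' l = 0"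
        using zero c'_other ji by auto
      ultimately have "c' \<in> ?H" by (simp add: hemisphere_def)
      then have "\<iota> t \<in> T - equator"
        unfolding \<iota>t using c'j s off by (intro mk) (auto simp: odd_coords_def c'_def)
      moreover have "\<iota> (c', j, - s) = (c, j, s)"
        using \<iota>_along[of c' j "- s"] True by (simp add: c'_def f_def)
      moreover have "face (c', j, - s) = face (c, j, s)"
        by (simp add: face_def c'_def f_def add.commute)
      ultimately show ?thesis using s unfolding \<iota>t unfolding tcjs by auto
    next
      case False
      have fjN: "\<bar>f j\<bar> = N" using False fj(1) cj s by auto
      define c' where "c' = f(i := f i - sgn (f i))"
      have \<iota>t: "\<iota> t = (c', i, sgn (f i))"
        using \<iota>_corner[of c j s f i] False i(4) fj(1) by (simp add: tcjs f_def c'_def)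
      have fiN: "\<bar>f i\<bar> = N" using fj i by simp
      have evN: "even (f i)" using fiN N(1) by (metis dvd_abs_iff)
      have sgn_i: "sgn (f i) = 1 \<or> sgn (f i) = -1" using fiN N(2) by (auto simp: sgn_if)
      have c'i: "odd (c' i)" "\<bar>c' i\<bar> < N"
        using evN sgn_i fiN N(2) by (auto simp: c'_def sgn_if split: if_splits)
      have c'_j: "c' j = f j" using ji by (simp add: c'_def)
      have c'_other: "c' l = c l" if "l \<noteq> j" "l \<noteq> i" for l using that by (simp add: c'_def f_def)
      have odd': "odd (c' l) \<and> \<bar>c' l\<bar> < N" if "l \<le> Suc k" "l \<noteq> j" for l
        using that c'i odd[of l] c'_other[of l] by (cases "l = i") auto
      have "c' (Suc k) \<ge> 0"
      proof -
        consider "j = Suc k" | "i = Suc k" | "j \<noteq> Suc k" "i \<noteq> Suc k" by blast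
        then show ?thesis
        proof cases
          case 1
          have "c j \<noteq> 0" using cj(1) by auto
          then have "f j \<ge> 0" using fj(1) top s 1 by auto
          then show ?thesis using 1 c'_j by simp
        next
          case 2
          then have "f i = N" using fiN fj(2) top by auto
          then show ?thesis using 2 N by (simp add: c'_def)
        qed (use top c'_other in auto)
      qed
      moreover have "\<forall>l>Suc k. c' l = 0"
        using zero c'_other ji i(1) by auto
      ultimately have c'H: "c' \<in> ?H"
        using ji(1) fjN c'_j odd' by (auto simp: hemisphere_def intro!: exI[of _ j])
      obtain j' where j': "j' \<le> Suc k" "\<bar>c' j'\<bar> = N" "(LEAST i. even (c' i)) = j'"
        using hemisphere_odd_coords[OF N(1) c'H] by metis
      have "j' = j" using j'(1,2) odd'[of j'] by force
      then have least: "(LEAST i. even (c' i)) = j" using j' by simp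
      have sgn_j: "sgn (f j) = s"
        using fjN fj(1) cj(2) s N(2) by (auto simp: sgn_if)
      have c'_back: "c'(i := c' i + sgn (f i)) = f" by (simp add: c'_def)
      have "f i \<noteq> 0" using fiN N(2) by auto
      then have "\<iota> t \<in> T - equator"
        unfolding \<iota>t using c'H c'i sgn_i by (intro mk) (auto simp: odd_coords_def c'_def)
      moreover have "\<iota> (c', i, sgn (f i)) = (c, j, s)"
        using \<iota>_corner[of c' i "sgn (f i)" f j] fiN c'_back least sgn_j by (simp add: c'_def) (simp add: f_def)
      moreover have "face (c', i, sgn (f i)) = face (c, j, s)"
        by (simp add: face_def c'_back) (simp add: f_def)
      ultimately show ?thesis using ji unfolding \<iota>t unfolding tcjs by auto
    qed
  qed (use finT in auto)
  also have "0 + (\<Sum>t\<in>equator. \<phi> (face t)) = (\<Sum>f\<in>hemisphere N k \<union> uminus ` hemisphere N k. \<phi> f)"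
  proof -
    have "(\<Sum>t\<in>equator. \<phi> (face t)) = (\<Sum>f\<in>hemisphere N k \<union> uminus ` hemisphere N k. \<phi> f)"
    proof (rule sum.reindex_bij_witness[of _ "\<lambda>f. (f(Suc k := 1), Suc k, - 1)" face])
      fix t assume t: "t \<in> equator"
      obtain c s where tcs: "t = (c, Suc k, s)" and c: "c \<in> ?H" and s: "s = 1 \<or> s = -1" and cs: "c (Suc k) + s = 0"
        and jodd: "Suc k \<in> odd_coords c"
        using t by (auto simp: equator_def T_def face_def)
      obtain i where i: "i \<le> Suc k" "\<bar>c i\<bar> = N" "odd_coords c = {..Suc k} - {i}"
        and odd: "\<And>j. j \<le> Suc k \<Longrightarrow> j \<noteq> i \<Longrightarrow> odd (c j) \<and> \<bar>c j\<bar> < N"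
        using hemisphere_odd_coords[OF N(1) c] by metis
      have zero: "\<forall>j>Suc k. c j = 0" and top: "c (Suc k) \<ge> 0" using c by (auto simp: hemisphere_def)
      have s1: "s = -1" "c (Suc k) = 1" using top s cs by auto
      show "(\<lambda>f. (f(Suc k := 1), Suc k, - 1)) (face t) = t"
        using s1 by (auto simp: face_def tcs)
      have f: "face t = c(Suc k := 0)" using s1 by (simp add: face_def tcs)
      have ik: "i \<le> k" using i jodd by (auto simp: le_Suc_eq)
      have zero': "\<forall>j>k. (c(Suc k := 0)) j = 0" using zero by auto
      show "face t \<in> hemisphere N k \<union> uminus ` hemisphere N k"
      proof (cases "c k \<ge> 0")
        case True
        then have "face t \<in> hemisphere N k"
          unfolding f hemisphere_def using zero' ik i odd by (auto intro!: exI[of _ i])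
        then show ?thesis ..
      next
        case False
        then have "- face t \<in> hemisphere N k"
          unfolding f hemisphere_def using zero' ik i odd by (auto intro!: exI[of _ i])
        then have "face t \<in> uminus ` hemisphere N k"
          by (intro image_eqI[of _ _ "- face t"]) auto
        then show ?thesis ..
      qed
    next
      fix f assume f: "f \<in> hemisphere N k \<union> uminus ` hemisphere N k"
      then obtain i where i: "\<forall>j>k. f j = 0" "i \<le> k" "\<bar>f i\<bar> = N" "\<And>j. j \<le> k \<Longrightarrow> j \<noteq> i \<Longrightarrow> odd (f j) \<and> \<bar>f j\<bar> < N"
        by (auto simp: hemisphere_def)
      have N1: "N > 1" using N by (cases "N = 1") auto
      have "f(Suc k := 1) \<in> ?H"
        unfolding hemisphere_def using i N1 by (auto intro!: exI[of _ i] simp: le_Suc_eq)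
      then show "(f(Suc k := 1), Suc k, - 1) \<in> equator"
        by (auto simp: equator_def T_def face_def odd_coords_def)
      show "face (f(Suc k := 1), Suc k, - 1) = f"
        using i(1) by (auto simp: face_def)
    qed simp
    then show ?thesis by simp
  qed
  also have "\<dots> = (\<Sum>f\<in>hemisphere N k. \<phi> f) + (\<Sum>f\<in>uminus ` hemisphere N k. \<phi> f)"
  proof (rule sum.union_disjoint)
    have "c k \<noteq> 0" if "c \<in> hemisphere N k" for c
      using that N(2) by (auto simp: hemisphere_def)
    moreover have "c k \<ge> 0" if "c \<in> hemisphere N k" for c
      using that by (simp add: hemisphere_def)
    ultimately have pos: "c k > 0" if "c \<in> hemisphere N k" for c
      using that by (metis less_le)
    have "- c \<notin> hemisphere N k" if "c \<in> hemisphere N k" for c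
      using pos[OF that] pos[of "- c"] by auto
    then show "hemisphere N k \<inter> uminus ` hemisphere N k = {}"
      by auto
  qed (auto simp: finite_hemisphere)
  also have "(\<Sum>f\<in>uminus ` hemisphere N k. \<phi> f) = (\<Sum>f\<in>hemisphere N k. \<phi> (- f))"
    by (rule sum.reindex_cong[of uminus]) (auto simp: inj_on_def)
  finally show ?thesis by (simp only: sum.distrib)
qed

section \<open>Equivariant chain maps\<close>

lemma bd_sum: "bd V (sum f A) = (\<Sum>a\<in>A. bd V (f a))"
  by (induction A rule: infinite_finite_induct) (simp_all only: sum.infinite sum.empty sum.insert bd_add bd_0 not_False_eq_True)

lemma chain_space_sum:
  "(\<And>a. a \<in> A \<Longrightarrow> f a \<in> chain_space K k) \<Longrightarrow> sum f A \<in> chain_space K k"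
proof (induction A rule: infinite_finite_induct)
  case (insert a A)
  then have "f a + sum f A \<in> chain_space K k" by (intro chain_space_add) blast+
  then show ?case using insert.hyps by (simp only: sum.insert not_False_eq_True)
qed (simp_all add: chain_space_def)

definition pull :: "('v \<Rightarrow> 'v) \<Rightarrow> ('v set \<Rightarrow> bit) \<Rightarrow> 'v set \<Rightarrow> bit"
  where "pull opp z \<sigma> = z (opp ` \<sigma>)"

lemma pull_add: "pull opp (y + z) = pull opp y + pull opp z"
  by (simp add: fun_eq_iff pull_def)

lemma pull_0: "pull opp 0 = 0"
  by (simp add: fun_eq_iff pull_def)

lemma pull_sum: "pull opp (sum f A) = (\<Sum>a\<in>A. pull opp (f a))"
  by (induction A rule: infinite_finite_induct) (simp_all only: sum.infinite sum.empty sum.insert pull_add pull_0 not_False_eq_True)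

lemma bd_pull:
  assumes "\<And>v. opp (opp v) = v" "opp ` V = V"
  shows "bd V (pull opp z) = pull opp (bd V z)"
proof (rule ext)
  fix f
  have "bij_betw opp (V - f) (V - opp ` f)"
    using assms by (intro bij_betw_byWitness[of _ opp]) (auto, metis imageI, metis imageI)
  then have "(\<Sum>v\<in>V - f. z (insert (opp v) (opp ` f))) = (\<Sum>v\<in>V - opp ` f. z (insert v (opp ` f)))"
    by (rule sum.reindex_bij_betw)
  then show "bd V (pull opp z) f = pull opp (bd V z) f"
    by (simp add: bd_def pull_def)
qed

definition empty_simplex :: "'v set \<Rightarrow> bit"
  where "empty_simplex \<sigma> = of_bool (\<sigma> = {})"

text \<open>
  The chain that the image of the cell \<open>c\<close> has to bound. For a vertex this is the empty simplex of the augmented complex, so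
  the image of a vertex has odd parity.
\<close>
definition attaching :: "((nat \<Rightarrow> int) \<Rightarrow> 'v set \<Rightarrow> bit) \<Rightarrow> (nat \<Rightarrow> int) \<Rightarrow> 'v set \<Rightarrow> bit"
  where "attaching \<phi> c = (if odd_coords c = {} then empty_simplex else rim \<phi> c)"

text \<open>A choice of one cell from each antipodal pair.\<close>
definition positive_cell :: "(nat \<Rightarrow> int) \<Rightarrow> bool"
  where "positive_cell c \<longleftrightarrow> c (LEAST j. c j \<noteq> 0) > 0"

lemma positive_cell_uminus:
  assumes "c j \<noteq> 0" shows "positive_cell (- c) \<longleftrightarrow> \<not> positive_cell c"
proof -
  have "c (LEAST j. c j \<noteq> 0) \<noteq> 0" using assms by (rule LeastI)
  then show ?thesis by (auto simp: positive_cell_def)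
qed

lemma rim_uminus: "rim \<phi> (- c) = rim (\<lambda>c. \<phi> (- c)) c"
proof -
  have "(\<Sum>s\<in>{1, -1}. \<phi> ((- c)(j := (- c) j + s))) = (\<Sum>s\<in>{1, -1}. \<phi> (- (c(j := c j + s))))" for j
  proof -
    have "(- c)(j := (- c) j + s) = - (c(j := c j + - s))" for s
      by (auto simp: fun_eq_iff)
    then show ?thesis by (simp add: add.commute)
  qed
  then show ?thesis by (simp add: rim_def)
qed

text \<open>
  The method of acyclic carriers, with an involution. The chain map is built by induction on the dimension of the cells. The
  attaching chain of a cell is a cycle in the complex of labels \<open>Q c\<close>, hence bounds there by acyclicity. The filling is chosen
  on positive cells and transported to their antipodes, which is consistent because no cell is its own antipode.
\<close>
lemma equivariant_acyclic_carrier: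
  fixes opp :: "'q \<Rightarrow> 'q" and sq :: "'q \<Rightarrow> 'x \<times> 'y" and Q :: "(nat \<Rightarrow> int) \<Rightarrow> 'q set"
  assumes V: "finite V" "opp ` V = V" and opp: "\<And>v. opp (opp v) = v" and sq: "\<And>v. sq (opp v) = sq v"
    and N: "even N" "N > 0"
    and Q_acyclic: "\<And>c. c \<in> sphere_cells d N \<Longrightarrow> acyclic_upto V sq (Suc d) (Q c)"
    and Q_mono: "\<And>c j s. c \<in> sphere_cells d N \<Longrightarrow> j \<in> odd_coords c \<Longrightarrow> s \<in> {1, -1} \<Longrightarrow> Q (c(j := c j + s)) \<subseteq> Q c"
    and Q_opp: "\<And>c. Q (- c) = opp ` Q c"
  shows "\<exists>\<phi>. \<forall>c\<in>sphere_cells d N. card (odd_coords c) \<le> d \<longrightarrow>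
    \<phi> c \<in> chain_space (rooks sq (Q c)) (Suc (card (odd_coords c))) \<and>
    \<phi> (- c) = pull opp (\<phi> c) \<and> bd V (\<phi> c) = attaching \<phi> c"
proof -
  let ?good = "\<lambda>\<phi> c. \<phi> c \<in> chain_space (rooks sq (Q c)) (Suc (card (odd_coords c))) \<and>
    \<phi> (- c) = pull opp (\<phi> c) \<and> bd V (\<phi> c) = attaching \<phi> c"
  have pull_pull: "pull opp (pull opp z) = z" for z
    by (auto simp: fun_eq_iff pull_def image_image opp)
  have pull_chain: "pull opp z \<in> chain_space (rooks sq (Q (- c))) k" if "z \<in> chain_space (rooks sq (Q c)) k" for z c k
  proof -
    have "\<sigma> \<in> rooks sq (Q (- c)) \<and> finite \<sigma> \<and> card \<sigma> = k" if nz: "pull opp z \<sigma> \<noteq> 0" for \<sigma>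
    proof -
      have \<tau>: "opp ` \<sigma> \<in> rooks sq (Q c)" "finite (opp ` \<sigma>)" "card (opp ` \<sigma>) = k"
        using \<open>z \<in> _\<close> nz by (auto simp: chain_space_def pull_def)
      have inj: "inj_on opp \<sigma>" by (metis inj_onI opp)
      have \<sigma>: "\<sigma> = opp ` (opp ` \<sigma>)" by (simp add: image_image opp)
      have "\<sigma> \<subseteq> opp ` Q c" using \<tau>(1) \<sigma> by (auto simp: rooks_def)
      moreover have "nonattacking (sq u) (sq v)" if "u \<in> \<sigma>" "v \<in> \<sigma>" "u \<noteq> v" for u v
      proof -
        have "opp u \<noteq> opp v" using that opp by metis
        then have "nonattacking (sq (opp u)) (sq (opp v))"
          using \<tau>(1) that by (auto simp: rooks_def pairwise_def)
        then show ?thesis by (simp add: sq)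
      qed
      ultimately show ?thesis
        using \<tau> inj by (auto simp: rooks_def Q_opp pairwise_def card_image dest: finite_imageD)
    qed
    then show ?thesis by (auto simp: chain_space_def)
  qed
  have "\<exists>\<phi>. \<forall>c\<in>sphere_cells d N. card (odd_coords c) < k \<longrightarrow> ?good \<phi> c" if "k \<le> Suc d" for k
    using that
  proof (induction k)
    case 0
    show ?case by simp
  next
    case (Suc k)
    have "k \<le> Suc d" using Suc.prems by simp
    from Suc.IH[OF this] obtain \<phi> where \<phi>: "\<And>c. c \<in> sphere_cells d N \<Longrightarrow> card (odd_coords c) < k \<Longrightarrow> ?good \<phi> c"
      by blast
    define C where "C = {c \<in> sphere_cells d N. card (odd_coords c) = k}"
    have face: "c(j := c j + s) \<in> sphere_cells d N \<and> odd_coords (c(j := c j + s)) = odd_coords c - {j} \<and>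
        card (odd_coords c) = Suc (card (odd_coords (c(j := c j + s))))"
      if "c \<in> sphere_cells d N" "j \<in> odd_coords c" "s \<in> {1, -1}" for c j s
      using face_in_sphere_cells[OF N(1) that] odd_coords_face[OF that(2,3)]
        card.remove[OF finite_odd_coords[OF that(1)] that(2)] by metis
    have goodface: "?good \<phi> (c(j := c j + s))" if "c \<in> C" "j \<in> odd_coords c" "s \<in> {1, -1}" for c j s
      using face[OF _ that(2,3)] that(1) by (intro \<phi>) (auto simp: C_def)
    have att_chain: "attaching \<phi> c \<in> chain_space (rooks sq (Q c)) k" if c: "c \<in> C" for c
    proof (cases "odd_coords c = {}")
      case True
      then have "k = 0" using c by (simp add: C_def)
      then show ?thesis using True by (auto simp: attaching_def empty_simplex_def chain_space_def rooks_def)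
    next
      case False
      have "\<phi> (c(j := c j + s)) \<in> chain_space (rooks sq (Q c)) k" if "j \<in> odd_coords c" "s \<in> {1, -1}" for j s
      proof (rule chain_space_mono)
        have "Suc (card (odd_coords (c(j := c j + s)))) = k"
          using face[OF _ that] c by (simp add: C_def)
        then show "\<phi> (c(j := c j + s)) \<in> chain_space (rooks sq (Q (c(j := c j + s)))) k"
          using goodface[OF c that] by metis
        show "rooks sq (Q (c(j := c j + s))) \<subseteq> rooks sq (Q c)"
          using Q_mono[OF _ that] c by (intro rooks_mono) (auto simp: C_def)
      qed
      then have "rim \<phi> c \<in> chain_space (rooks sq (Q c)) k"
        unfolding rim_def by (intro chain_space_sum) blast
      then show ?thesis using False by (simp only: attaching_def if_False)
    qed
    have att_cycle: "bd V (attaching \<phi> c) = 0" if c: "c \<in> C" for c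
    proof (cases "odd_coords c = {}")
      case True
      then show ?thesis by (simp add: attaching_def fun_eq_iff bd_def empty_simplex_def)
    next
      case False
      have "bd V (attaching \<phi> c) = (\<Sum>j\<in>odd_coords c. \<Sum>s\<in>{1, -1}. bd V (\<phi> (c(j := c j + s))))"
        using False by (simp only: attaching_def rim_def bd_sum if_False)
      also have "\<dots> = (\<Sum>j\<in>odd_coords c. \<Sum>s\<in>{1, -1}. attaching \<phi> (c(j := c j + s)))"
        using goodface[OF c] by (intro sum.cong refl) blast
      also have "\<dots> = 0"
      proof (cases "\<exists>j. odd_coords c = {j}")
        case True
        then obtain j where j: "odd_coords c = {j}" by blast
        then have "attaching \<phi> (c(j := c j + s)) = empty_simplex" if "s \<in> {1, -1}" for s
          using odd_coords_face[of j c s] that by (simp add: attaching_def)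
        then show ?thesis using j by simp
      next
        case more: False
        have "attaching \<phi> (c(j := c j + s)) = rim \<phi> (c(j := c j + s))" if "j \<in> odd_coords c" "s \<in> {1, -1}" for j s
        proof -
          have "odd_coords c - {j} \<noteq> {}" using more that(1) by blast
          then show ?thesis using odd_coords_face[OF that] by (simp add: attaching_def)
        qed
        then have "(\<Sum>j\<in>odd_coords c. \<Sum>s\<in>{1, -1}. attaching \<phi> (c(j := c j + s))) = rim (rim \<phi>) c"
          unfolding rim_def[of "rim \<phi>"] by (intro sum.cong refl) blast
        also have "\<dots> = 0" using c by (intro rim_rim finite_odd_coords) (auto simp: C_def)
        finally show ?thesis .
      qed
      finally show ?thesis .
    qed
    have "\<exists>y\<in>chain_space (rooks sq (Q c)) (Suc k). bd V y = attaching \<phi> c" if c: "c \<in> C" for c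
    proof -
      have "acyclic_upto V sq (Suc d) (Q c)" using Q_acyclic c by (simp add: C_def)
      then show ?thesis
        using att_chain[OF c] att_cycle[OF c] Suc.prems unfolding acyclic_upto_def by auto
    qed
    then obtain y where y: "\<And>c. c \<in> C \<Longrightarrow> y c \<in> chain_space (rooks sq (Q c)) (Suc k)"
      "\<And>c. c \<in> C \<Longrightarrow> bd V (y c) = attaching \<phi> c" by metis
    define \<psi> where "\<psi> c = (if card (odd_coords c) < k then \<phi> c else if positive_cell c then y c else pull opp (y (- c)))" for c
    have att_\<psi>: "attaching \<psi> c = attaching \<phi> c" if c: "c \<in> sphere_cells d N" "card (odd_coords c) \<le> k" for c
    proof -
      have "\<psi> (c(j := c j + s)) = \<phi> (c(j := c j + s))" if "j \<in> odd_coords c" "s \<in> {1, -1}" for j s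
        using face[OF c(1) that] c(2) by (simp add: \<psi>_def)
      then have "rim \<psi> c = rim \<phi> c" unfolding rim_def by (intro sum.cong refl) blast
      then show ?thesis by (simp add: attaching_def)
    qed
    have att_opp: "attaching \<phi> (- c) = pull opp (attaching \<phi> c)" if c: "c \<in> C" for c
    proof -
      have "rim \<phi> (- c) = (\<Sum>j\<in>odd_coords c. \<Sum>s\<in>{1, -1}. pull opp (\<phi> (c(j := c j + s))))"
        unfolding rim_uminus unfolding rim_def using goodface[OF c] by (intro sum.cong refl) blast
      also have "\<dots> = pull opp (rim \<phi> c)"
        by (simp only: rim_def pull_sum)
      finally have rim_opp: "rim \<phi> (- c) = pull opp (rim \<phi> c)" .
      have empty_opp: "pull opp (empty_simplex :: 'q set \<Rightarrow> bit) = empty_simplex"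
        by (simp add: fun_eq_iff pull_def empty_simplex_def)
      show ?thesis
        unfolding attaching_def odd_coords_uminus rim_opp by (cases "odd_coords c = {}") (simp_all only: empty_opp if_True if_False refl)
    qed
    have "?good \<psi> c" if c: "c \<in> sphere_cells d N" "card (odd_coords c) < Suc k" for c
    proof (cases "card (odd_coords c) < k")
      case True
      then show ?thesis using \<phi>[OF c(1) True] att_\<psi>[OF c(1)] by (simp add: \<psi>_def)
    next
      case False
      then have k: "card (odd_coords c) = k" using c(2) by simp
      then have cC: "c \<in> C" "- c \<in> C" using c(1) uminus_in_sphere_cells[OF c(1)] by (auto simp: C_def)
      obtain j where cj: "c j \<noteq> 0" using c(1) N(2) by (force simp: sphere_cells_def)
      note pos = positive_cell_uminus[of c j, OF cj]
      have mem: "\<psi> c \<in> chain_space (rooks sq (Q c)) (Suc k)"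
        using y(1)[OF cC(1)] pull_chain[OF y(1)[OF cC(2)]] k by (simp add: \<psi>_def)
      have opp_eq: "\<psi> (- c) = pull opp (\<psi> c)"
        using k pos by (auto simp: \<psi>_def pull_pull)
      have "bd V (pull opp (y (- c))) = attaching \<phi> c"
        using bd_pull[OF opp V(2)] y(2)[OF cC(2)] att_opp[OF cC(1)] by (simp add: pull_pull)
      then have "bd V (\<psi> c) = attaching \<psi> c"
        using y(2)[OF cC(1)] k att_\<psi>[OF c(1)] by (simp add: \<psi>_def)
      then show ?thesis using mem opp_eq k by simp
    qed
    then show ?case by blast
  qed
  from this[of "Suc d"] show ?thesis by (simp add: less_Suc_eq_le)
qed

text \<open>
  The images of the hemispheres under the equivariant chain map satisfy the hypotheses of
  \<open>odd_chains_cross_origin\<close>.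
\<close>
lemma crossing_rook_placement:
  fixes sq :: "'b \<Rightarrow> 'x \<times> 'y" and Q :: "(nat \<Rightarrow> int) \<Rightarrow> ('b \<times> bool) set"
  assumes B: "finite B" and N: "even N" "N > 0"
    and Q_sub: "\<And>c. Q c \<subseteq> B \<times> UNIV"
    and Q_dec: "\<And>c. c \<in> sphere_cells d N \<Longrightarrow> rook_decomposable (Suc d) ((sq \<circ> fst) ` Q c)"
    and Q_mono: "\<And>c j s. c \<in> sphere_cells d N \<Longrightarrow> j \<in> odd_coords c \<Longrightarrow> s \<in> {1, -1} \<Longrightarrow> Q (c(j := c j + s)) \<subseteq> Q c"
    and Q_opp: "\<And>c. Q (- c) = flip ` Q c"
  shows "\<exists>c\<in>sphere_cells d N. \<exists>\<sigma>\<in>rooks (sq \<circ> fst) (Q c). card \<sigma> = Suc d \<and> crosses (signed G) d \<sigma>"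
proof -
  let ?V = "B \<times> (UNIV :: bool set)"
  have flipV: "flip ` ?V = ?V"
    by (auto simp: flip_def image_iff)
  have acyclic: "acyclic_upto ?V (sq \<circ> fst) (Suc d) (Q c)" if "c \<in> sphere_cells d N" for c
    using B by (intro rook_decomposable_imp_acyclic[OF Q_dec[OF that] _ Q_sub]) auto
  have "\<exists>\<phi>. \<forall>c\<in>sphere_cells d N. card (odd_coords c) \<le> d \<longrightarrow>
      \<phi> c \<in> chain_space (rooks (sq \<circ> fst) (Q c)) (Suc (card (odd_coords c))) \<and>
      \<phi> (- c) = pull flip (\<phi> c) \<and> bd ?V (\<phi> c) = attaching \<phi> c"
    by (rule equivariant_acyclic_carrier[OF _ flipV _ _ N acyclic Q_mono Q_opp])
      (use B in \<open>simp_all add: flip_def\<close>)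
  then obtain \<phi> where \<phi>: "\<And>c. c \<in> sphere_cells d N \<Longrightarrow> card (odd_coords c) \<le> d \<Longrightarrow>
      \<phi> c \<in> chain_space (rooks (sq \<circ> fst) (Q c)) (Suc (card (odd_coords c))) \<and>
      \<phi> (- c) = pull flip (\<phi> c) \<and> bd ?V (\<phi> c) = attaching \<phi> c"
    by blast
  define e where "e k = (\<Sum>c\<in>hemisphere N k. \<phi> c)" for k
  have cell: "c \<in> sphere_cells d N" "card (odd_coords c) = k" if "c \<in> hemisphere N k" "k \<le> d" for c k
    using hemisphere_subset_sphere_cells[OF N that(2,1)] by auto
  have support: "\<exists>c\<in>hemisphere N k. \<sigma> \<in> rooks (sq \<circ> fst) (Q c) \<and> card \<sigma> = Suc k" if "k \<le> d" "e k \<sigma> \<noteq> 0" for k \<sigma>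
  proof -
    have "e k \<sigma> = (\<Sum>c\<in>hemisphere N k. \<phi> c \<sigma>)" unfolding e_def by (induction rule: infinite_finite_induct) auto
    then obtain c where c: "c \<in> hemisphere N k" "\<phi> c \<sigma> \<noteq> 0"
      using \<open>e k \<sigma> \<noteq> 0\<close> by (metis sum.not_neutral_contains_not_neutral)
    then show ?thesis
      using \<phi>[OF cell(1)[OF c(1) \<open>k \<le> d\<close>]] cell(2)[OF c(1) \<open>k \<le> d\<close>] \<open>k \<le> d\<close> by (auto simp: chain_space_def)
  qed
  have "\<exists>\<sigma>. e d \<sigma> \<noteq> 0 \<and> crosses (signed G) d \<sigma>"
  proof (rule odd_chains_cross_origin[OF B])
    show "\<sigma> \<subseteq> ?V \<and> card \<sigma> = Suc k \<and> inj_on fst \<sigma>" if k: "k \<le> d" "e k \<sigma> \<noteq> 0" for k \<sigma>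
    proof -
      obtain c where c: "\<sigma> \<in> rooks (sq \<circ> fst) (Q c)" "card \<sigma> = Suc k" using support[OF k] by blast
      have "inj_on fst \<sigma>"
      proof (rule inj_onI, rule ccontr)
        fix u v assume uv: "u \<in> \<sigma>" "v \<in> \<sigma>" "fst u = fst v" "u \<noteq> v"
        then have "nonattacking ((sq \<circ> fst) u) ((sq \<circ> fst) v)"
          using c(1) unfolding rooks_def pairwise_def by blast
        then show False using uv(3) by (simp add: nonattacking_def)
      qed
      then show ?thesis using c Q_sub[of c] unfolding rooks_def by blast
    qed
    show "bd ?V (e 0) {} = 1"
    proof -
      have "hemisphere N 0 = {(\<lambda>_. 0)(0 := N)}"
        using N(2) by (auto simp: hemisphere_def fun_eq_iff)
      then have e0: "e 0 = \<phi> ((\<lambda>_. 0)(0 := N))" and h: "(\<lambda>_. 0)(0 := N) \<in> hemisphere N 0"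
        by (auto simp: e_def)
      have "odd_coords ((\<lambda>_. 0)(0 := N)) = {}" using N(1) by (auto simp: odd_coords_def)
      then show ?thesis
        using \<phi>[OF cell(1)[OF h]] by (simp add: e0 attaching_def empty_simplex_def)
    qed
    show "bd ?V (e (Suc k)) \<sigma> = e k \<sigma> + e k (flip ` \<sigma>)" if k: "k < d" for k \<sigma>
    proof -
      have "bd ?V (e (Suc k)) = (\<Sum>c\<in>hemisphere N (Suc k). bd ?V (\<phi> c))"
        by (simp add: e_def bd_sum)
      also have "\<dots> = (\<Sum>c\<in>hemisphere N (Suc k). rim \<phi> c)"
      proof (rule sum.cong[OF refl])
        fix c assume c: "c \<in> hemisphere N (Suc k)"
        have "card (odd_coords c) = Suc k" "c \<in> sphere_cells d N" using cell[OF c] k by auto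
        then have "odd_coords c \<noteq> {}" "bd ?V (\<phi> c) = attaching \<phi> c" using \<phi>[of c] k by auto
        then show "bd ?V (\<phi> c) = rim \<phi> c" by (simp add: attaching_def)
      qed
      also have "\<dots> = (\<Sum>c\<in>hemisphere N k. \<phi> c + \<phi> (- c))"
        by (rule hemisphere_rim[OF N])
      also have "\<dots> = (\<Sum>c\<in>hemisphere N k. \<phi> c + pull flip (\<phi> c))"
        using \<phi> cell k by (intro sum.cong refl) (metis less_imp_le)
      also have "\<dots> = e k + pull flip (e k)"
        by (simp add: e_def sum.distrib pull_sum)
      finally show ?thesis by (simp add: pull_def)
    qed
  qed
  then obtain \<sigma> where \<sigma>: "e d \<sigma> \<noteq> 0" "crosses (signed G) d \<sigma>" by blast
  then show ?thesis using support[OF _ \<sigma>(1)] cell(1) by blast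
qed

section \<open>Passing to the limit\<close>

definition normalize_upto :: "nat \<Rightarrow> (nat \<Rightarrow> real) \<Rightarrow> nat \<Rightarrow> real"
  where "normalize_upto d v j = v j / sqrt (\<Sum>i\<le>d. (v i)\<^sup>2)"

lemma normalize_upto_uminus: "normalize_upto d (\<lambda>j. - v j) = - normalize_upto d v"
  by (simp add: fun_eq_iff normalize_upto_def)

lemma normalize_upto_scale:
  assumes "a > 0" shows "normalize_upto d (\<lambda>j. v j / a) = normalize_upto d v"
proof -
  have "sqrt (\<Sum>i\<le>d. (v i / a)\<^sup>2) = sqrt (\<Sum>i\<le>d. (v i)\<^sup>2) / a"
    using assms by (simp add: power_divide real_sqrt_divide flip: sum_divide_distrib)
  then show ?thesis using assms by (simp add: fun_eq_iff normalize_upto_def)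
qed

lemma normalize_upto_in_nsphere:
  assumes "\<And>j. j > d \<Longrightarrow> v j = 0" "(\<Sum>i\<le>d. (v i)\<^sup>2) > 0"
  shows "normalize_upto d v \<in> topspace (nsphere d)"
proof -
  have "(\<Sum>i\<le>d. (normalize_upto d v i)\<^sup>2) = 1"
    using assms(2) by (simp add: normalize_upto_def power_divide flip: sum_divide_distrib)
  then show ?thesis
    using assms(1) by (simp add: nsphere normalize_upto_def)
qed

lemma tendsto_fun_iff:
  fixes f :: "'b \<Rightarrow> 'a \<Rightarrow> real"
  shows "(f \<longlongrightarrow> l) F \<longleftrightarrow> (\<forall>i. ((\<lambda>n. f n i) \<longlongrightarrow> l i) F)"
proof -
  have "(f \<longlongrightarrow> l) F \<longleftrightarrow> limitin (product_topology (\<lambda>_. euclidean) UNIV) f l F"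
    by (simp add: euclidean_product_topology)
  then show ?thesis by (simp add: limitin_componentwise)
qed

text \<open>
  The labels of a cell \<open>c\<close> are those available at one of its grid vertices, projected to the sphere. The cubes of half side
  \<open>NN n\<close> give cells \<open>c n\<close> with crossing simplices \<open>\<sigma> n\<close> of labels. There are only finitely many simplices, so
  one of them occurs infinitely often, and along a further subsequence the cells, scaled to
  the unit cube, shrink to a point. Since the sets are closed, all labels of the simplex are available at
  the projection \<open>x\<close> of that point.
\<close>
lemma colored_antipodal_point:
  fixes B :: "'b set" and sq :: "'b \<Rightarrow> 'x \<times> 'y" and A :: "'b \<Rightarrow> (nat \<Rightarrow> real) set" and G :: "'b \<Rightarrow> nat \<Rightarrow> real"
  assumes B: "finite B" and closed: "\<And>b. b \<in> B \<Longrightarrow> closed (A b)"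
    and stairs: "\<And>x. x \<in> topspace (nsphere d) \<Longrightarrow> has_stair (Suc d) (sq ` {b \<in> B. x \<in> A b \<or> - x \<in> A b})"
  shows "\<exists>x\<in>topspace (nsphere d). \<exists>\<sigma>\<subseteq>B \<times> UNIV. card \<sigma> = Suc d \<and>
    pairwise (\<lambda>u v. nonattacking (sq (fst u)) (sq (fst v))) \<sigma> \<and> crosses (signed G) d \<sigma> \<and>
    (\<forall>(b, s)\<in>\<sigma>. (if s then x else - x) \<in> A b)"
proof -
  define pt where "pt v = normalize_upto d (\<lambda>j. real_of_int (v j))" for v :: "nat \<Rightarrow> int"
  define near where "near v c \<longleftrightarrow> (\<forall>j. even (v j) \<and> \<bar>v j - c j\<bar> \<le> 1)" for v c :: "nat \<Rightarrow> int"
  define Q where "Q c = {(b, s). b \<in> B \<and> (\<exists>v. near v c \<and> (if s then pt v else - pt v) \<in> A b)}" for c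
  have pt_uminus: "pt (- v) = - pt v" for v
    using normalize_upto_uminus[of d "\<lambda>j. real_of_int (v j)"] by (simp add: pt_def)
  have near_uminus: "near (- v) (- c) \<longleftrightarrow> near v c" for v c
    by (simp add: near_def abs_minus_commute)
  have step: "\<exists>c\<in>sphere_cells d N. \<exists>\<sigma>\<in>rooks (sq \<circ> fst) (Q c). card \<sigma> = Suc d \<and> crosses (signed G) d \<sigma>"
    if N: "even N" "N > 0" for N
  proof (rule crossing_rook_placement[OF B N])
    show "Q c \<subseteq> B \<times> UNIV" for c by (auto simp: Q_def)
    show "rook_decomposable (Suc d) ((sq \<circ> fst) ` Q c)" if c: "c \<in> sphere_cells d N" for c
    proof -
      \<comment> \<open>Any grid vertex of the cell serves; this one rounds the odd entries up.\<close>
      define v where "v j = (if even (c j) then c j else c j + 1)" for j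
      have v: "near v c" by (auto simp: near_def v_def)
      obtain i where i: "\<bar>c i\<bar> = N" using c by (auto simp: sphere_cells_def)
      then have "even (c i)" using N(1) by (metis dvd_abs_iff)
      then have vi: "v i \<noteq> 0" using i N(2) by (auto simp: v_def)
      have v0: "v j = 0" if "j > d" for j using c that by (auto simp: v_def sphere_cells_def)
      have "i \<le> d" using vi v0 by (metis not_le)
      then have "(\<Sum>i\<le>d. (real_of_int (v i))\<^sup>2) > 0"
        using vi by (intro sum_pos2[of _ i]) auto
      then have "pt v \<in> topspace (nsphere d)"
        unfolding pt_def using v0 by (intro normalize_upto_in_nsphere) auto
      from stairs[OF this] have "has_stair (Suc d) ((sq \<circ> fst) ` Q c)"
      proof (rule has_stair_mono)
        show "sq ` {b \<in> B. pt v \<in> A b \<or> - pt v \<in> A b} \<subseteq> (sq \<circ> fst) ` Q c"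
        proof
          fix y assume "y \<in> sq ` {b \<in> B. pt v \<in> A b \<or> - pt v \<in> A b}"
          then obtain b where b: "b \<in> B" "pt v \<in> A b \<or> - pt v \<in> A b" "y = sq b" by auto
          then have "(b, pt v \<in> A b) \<in> Q c" using v by (auto simp: Q_def)
          then show "y \<in> (sq \<circ> fst) ` Q c" using b(3) by force
        qed
      qed
      moreover have "finite (Q c)" by (rule finite_subset[of _ "B \<times> UNIV"]) (use B in \<open>auto simp: Q_def\<close>)
      ultimately show ?thesis by (intro has_stair_imp_rook_decomposable) auto
    qed
    show "Q (c(j := c j + s)) \<subseteq> Q c" if "c \<in> sphere_cells d N" "j \<in> odd_coords c" "s \<in> {1, -1}" for c j s
    proof -
      have "near v c" if "near v (c(j := c j + s))" for v
        unfolding near_def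
      proof (intro allI conjI)
        fix i
        have i: "even (v i)" "\<bar>v i - (c(j := c j + s)) i\<bar> \<le> 1" using that by (auto simp: near_def)
        show "even (v i)" by (rule i)
        show "\<bar>v i - c i\<bar> \<le> 1"
        proof (cases "i = j")
          case True
          have "even (v i - (c j + s))"
            using i(1) \<open>j \<in> odd_coords c\<close> \<open>s \<in> {1, -1}\<close> by (auto simp: odd_coords_def)
          moreover have "\<bar>v i - (c j + s)\<bar> \<le> 1" using i(2) True by simp
          moreover have "t = 0" if "even t" "\<bar>t\<bar> \<le> 1" for t :: int
            using that by (auto elim!: evenE)
          ultimately have "v i - (c j + s) = 0" by blast
          then show ?thesis using True \<open>s \<in> {1, -1}\<close> by auto
        qed (use i in auto)
      qed
      then show ?thesis by (auto simp: Q_def)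
    qed
    show "Q (- c) = flip ` Q c" for c
    proof -
      have "(b, s) \<in> Q (- c) \<longleftrightarrow> (b, \<not> s) \<in> Q c" for b s
      proof -
        have "(\<exists>v. near v (- c) \<and> (if s then pt v else - pt v) \<in> A b)
            \<longleftrightarrow> (\<exists>v. near v c \<and> (if \<not> s then pt v else - pt v) \<in> A b)"
        proof (intro iffI; elim exE conjE)
          fix v assume "near v (- c)" "(if s then pt v else - pt v) \<in> A b"
          then show "\<exists>v. near v c \<and> (if \<not> s then pt v else - pt v) \<in> A b"
            using near_uminus[of "- v" c] by (intro exI[of _ "- v"]) (auto simp: pt_uminus split: if_splits)
        next
          fix v assume "near v c" "(if \<not> s then pt v else - pt v) \<in> A b"
          then show "\<exists>v. near v (- c) \<and> (if s then pt v else - pt v) \<in> A b"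
            using near_uminus[of v c] by (intro exI[of _ "- v"]) (auto simp: pt_uminus split: if_splits)
        qed
        then show ?thesis by (simp add: Q_def)
      qed
      then show ?thesis by (force simp: flip_def image_iff)
    qed
  qed
  define NN where "NN n = 2 * (int n + 1)" for n
  have "\<exists>c \<sigma>. c \<in> sphere_cells d (NN n) \<and> \<sigma> \<in> rooks (sq \<circ> fst) (Q c) \<and> card \<sigma> = Suc d \<and> crosses (signed G) d \<sigma>" for n
    using step[of "NN n"] by (auto simp: NN_def)
  then obtain c \<sigma> where c: "\<And>n. c n \<in> sphere_cells d (NN n)"
    and \<sigma>: "\<And>n. \<sigma> n \<in> rooks (sq \<circ> fst) (Q (c n))" "\<And>n. card (\<sigma> n) = Suc d" "\<And>n. crosses (signed G) d (\<sigma> n)"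
    by metis
  have "\<sigma> n \<in> Pow (B \<times> UNIV)" for n using \<sigma>(1)[of n] by (auto simp: rooks_def Q_def)
  then have "finite (range \<sigma>)"
    by (intro finite_subset[of "range \<sigma>" "Pow (B \<times> UNIV)"]) (use B in auto)
  then obtain n0 where "infinite {n \<in> UNIV. \<sigma> n = \<sigma> n0}"
    using pigeonhole_infinite[of UNIV \<sigma>] by auto
  then obtain r :: "nat \<Rightarrow> nat" where r: "strict_mono r" "\<And>n. \<sigma> (r n) = \<sigma> n0"
    using infinite_enumerate[of "{n \<in> UNIV. \<sigma> n = \<sigma> n0}"] by auto
  define z where "z n j = real_of_int (c (r n) j) / real_of_int (NN (r n))" for n j
  have NNpos: "real_of_int (NN n) > 0" for n by (simp add: NN_def)
  have "compactin (product_topology (\<lambda>_. euclidean) UNIV) (PiE UNIV (\<lambda>_::nat. {-1..1::real}))"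
    by (subst compactin_PiE) simp
  then have "compact (PiE UNIV (\<lambda>_::nat. {-1..1::real}))"
    by (simp add: euclidean_product_topology)
  moreover have "z n \<in> PiE UNIV (\<lambda>_. {-1..1})" for n
  proof -
    have "\<bar>z n j\<bar> \<le> 1" for j
    proof -
      have "\<bar>c (r n) j\<bar> \<le> NN (r n)" using c[of "r n"] by (simp add: sphere_cells_def)
      then have "\<bar>real_of_int (c (r n) j)\<bar> \<le> real_of_int (NN (r n))" by linarith
      then show ?thesis using NNpos[of "r n"] by (simp add: z_def abs_divide)
    qed
    then show ?thesis by (auto simp: abs_le_iff minus_le_iff)
  qed
  ultimately obtain y and q :: "nat \<Rightarrow> nat" where q: "strict_mono q" "(z \<circ> q) \<longlonglongrightarrow> y"
    using compact_imp_seq_compact seq_compactE by metis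
  have zy: "(\<lambda>n. z (q n) j) \<longlonglongrightarrow> y j" for j
    using q(2) by (simp add: tendsto_fun_iff o_def)
  have y0: "y j = 0" if "j > d" for j
  proof (rule LIMSEQ_unique[OF zy])
    have "z (q n) j = 0" for n using c[of "r (q n)"] that by (simp add: z_def sphere_cells_def)
    then show "(\<lambda>n. z (q n) j) \<longlonglongrightarrow> 0" by simp
  qed
  have "(\<Sum>i\<le>d. (y i)\<^sup>2) \<ge> 1"
  proof (rule LIMSEQ_le_const)
    show "(\<lambda>n. \<Sum>i\<le>d. (z (q n) i)\<^sup>2) \<longlonglongrightarrow> (\<Sum>i\<le>d. (y i)\<^sup>2)"
      by (intro tendsto_sum tendsto_power zy)
    have "1 \<le> (\<Sum>i\<le>d. (z n i)\<^sup>2)" for n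
    proof -
      obtain i where i: "\<bar>c (r n) i\<bar> = NN (r n)" using c[of "r n"] by (auto simp: sphere_cells_def)
      have "i \<le> d"
      proof (rule ccontr)
        assume "\<not> i \<le> d"
        then have "c (r n) i = 0" using c[of "r n"] by (simp add: sphere_cells_def)
        then show False using i by (simp add: NN_def)
      qed
      have "\<bar>real_of_int (c (r n) i)\<bar> = real_of_int (NN (r n))" using i by linarith
      then have "\<bar>z n i\<bar> = 1" using NNpos[of "r n"] by (simp add: z_def abs_divide)
      then have "(z n i)\<^sup>2 = 1" by (simp add: power2_eq_1_iff abs_if split: if_splits)
      then show ?thesis using member_le_sum[of i "{..d}" "\<lambda>i. (z n i)\<^sup>2"] \<open>i \<le> d\<close> by simp
    qed
    then show "\<exists>N. \<forall>n\<ge>N. 1 \<le> (\<Sum>i\<le>d. (z (q n) i)\<^sup>2)" by blast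
  qed
  then have ypos: "(\<Sum>i\<le>d. (y i)\<^sup>2) > 0" by linarith
  define x where "x = normalize_upto d y"
  have x: "x \<in> topspace (nsphere d)"
    unfolding x_def using y0 ypos by (rule normalize_upto_in_nsphere)
  have rq: "filterlim (\<lambda>n. r (q n)) at_top sequentially"
    using strict_mono_o[OF r(1) q(1)] filterlim_subseq by (fastforce simp: o_def)
  have mesh: "(\<lambda>n. 1 / real_of_int (NN (r (q n)))) \<longlonglongrightarrow> 0"
  proof -
    have eq: "1 / real_of_int (NN n) = inverse (real (Suc n)) * (1 / 2)" for n
      by (simp add: NN_def field_simps)
    have "(\<lambda>n. inverse (real (Suc n)) * (1 / 2)) \<longlonglongrightarrow> 0"
      by (rule tendsto_mult_left_zero[OF LIMSEQ_inverse_real_of_nat])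
    then have "(\<lambda>n. 1 / real_of_int (NN n)) \<longlonglongrightarrow> 0"
      by (simp only: eq)
    then show ?thesis using rq by (rule filterlim_compose)
  qed
  have "(if s then x else - x) \<in> A b" if bs: "(b, s) \<in> \<sigma> n0" for b s
  proof -
    have "\<exists>v. near v (c (r (q n))) \<and> (if s then pt v else - pt v) \<in> A b" for n
    proof -
      have "(b, s) \<in> Q (c (r (q n)))"
        using \<sigma>(1)[of "r (q n)"] bs r(2)[of "q n"] by (auto simp: rooks_def)
      then show ?thesis by (simp only: Q_def mem_Collect_eq prod.case)
    qed
    then obtain v where v: "\<And>n. near (v n) (c (r (q n)))" "\<And>n. (if s then pt (v n) else - pt (v n)) \<in> A b"
      by metis
    have "b \<in> B" using \<sigma>(1)[of n0] bs by (auto simp: rooks_def Q_def)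
    define u where "u n j = real_of_int (v n j) / real_of_int (NN (r (q n)))" for n j
    have uy: "(\<lambda>n. u n j) \<longlonglongrightarrow> y j" for j
    proof -
      have "\<bar>u n j - z (q n) j\<bar> \<le> 1 / real_of_int (NN (r (q n)))" for n
      proof -
        have "\<bar>v n j - c (r (q n)) j\<bar> \<le> 1" using v(1)[of n] by (simp add: near_def)
        then have "\<bar>real_of_int (v n j) - real_of_int (c (r (q n)) j)\<bar> \<le> 1" by linarith
        moreover have "u n j - z (q n) j = (real_of_int (v n j) - real_of_int (c (r (q n)) j)) / real_of_int (NN (r (q n)))"
          by (simp add: u_def z_def diff_divide_distrib)
        ultimately show ?thesis
          using NNpos[of "r (q n)"] by (simp add: abs_divide divide_right_mono)
      qed
      then have "(\<lambda>n. u n j - z (q n) j) \<longlonglongrightarrow> 0"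
        by (intro tendsto_rabs_zero_cancel[OF tendsto_sandwich[OF _ _ tendsto_const mesh]] always_eventually allI) auto
      from tendsto_add[OF this zy[of j]] show ?thesis by simp
    qed
    have "(\<lambda>n. normalize_upto d (u n)) \<longlonglongrightarrow> x"
      unfolding x_def tendsto_fun_iff normalize_upto_def
    proof (intro allI tendsto_divide uy tendsto_real_sqrt tendsto_sum tendsto_power)
      show "sqrt (\<Sum>i\<le>d. (y i)\<^sup>2) \<noteq> 0" using ypos by simp
    qed
    moreover have "normalize_upto d (u n) = pt (v n)" for n
      using normalize_upto_scale[OF NNpos] by (simp add: u_def[abs_def] pt_def)
    ultimately have ptx: "(\<lambda>n. pt (v n)) \<longlonglongrightarrow> x" by simp
    have "(\<lambda>n. if s then pt (v n) else - pt (v n)) \<longlonglongrightarrow> (if s then x else - x)"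
    proof (cases s)
      case False
      have "(\<lambda>n. - pt (v n)) \<longlonglongrightarrow> - x"
        using ptx by (simp add: tendsto_fun_iff tendsto_minus)
      then show ?thesis using False by simp
    qed (use ptx in simp)
    then show ?thesis
      by (rule closed_sequentially[OF closed[OF \<open>b \<in> B\<close>] v(2)])
  qed
  then have "\<forall>(b, s)\<in>\<sigma> n0. (if s then x else - x) \<in> A b" by blast
  moreover have "\<sigma> n0 \<subseteq> B \<times> UNIV" "pairwise (\<lambda>u v. nonattacking (sq (fst u)) (sq (fst v))) (\<sigma> n0)"
    using \<sigma>(1)[of n0] by (auto simp: rooks_def Q_def)
  ultimately show ?thesis using x \<sigma>(2,3)[of n0] by blast
qed

section \<open>Rook placements with intersecting convex hulls\<close>

theorem corollary5:
  fixes d m :: nat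
    and X :: "'x set" and Y :: "'y set" and W :: "('x \<times> 'y) set"
    and p :: "'x \<times> 'y \<Rightarrow> nat \<Rightarrow> (nat \<Rightarrow> real)"
    and A :: "'x \<times> 'y \<Rightarrow> nat \<Rightarrow> (nat \<Rightarrow> real) set"
  assumes "d > 0" and "m > 0"
    and "finite X" and "finite Y"
    and "nu (int (card X)) (int (card Y)) \<ge> int d + 1"
    and "W = X \<times> Y"
    and points: "\<And>w i. w \<in> W \<Longrightarrow> i \<in> {1..m} \<Longrightarrow> p w i \<in> topspace (Euclidean_space (d - 1))"
    and closed: "\<And>w i. w \<in> W \<Longrightarrow> i \<in> {1..m} \<Longrightarrow> closedin (nsphere d) (A w i)"
    and cover: "\<And>W'. W' \<subseteq> W \<Longrightarrow>
        (\<And>a b S. a \<le> int (card X) \<Longrightarrow> b \<le> int (card Y) \<Longrightarrow> nu a b \<ge> int d + 1 \<Longrightarrow>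
            a \<le> 2 * int d + 1 \<Longrightarrow> b \<le> 2 * int d + 1 \<Longrightarrow> S \<subseteq> W \<Longrightarrow>
            isomorphic_to_stair a b (int d + 1) X Y S \<Longrightarrow> W' \<inter> S \<noteq> {}) \<Longrightarrow>
        topspace (nsphere d) = (\<Union>w\<in>W'. \<Union>i\<in>{1..m}. A w i \<union> uminus ` A w i)"
    and disjoint: "\<And>x y x' y' i. (x, y) \<in> W \<Longrightarrow> (x', y') \<in> W \<Longrightarrow> x \<noteq> x' \<Longrightarrow> y \<noteq> y' \<Longrightarrow>
        i \<in> {1..m} \<Longrightarrow> A (x, y) i \<inter> uminus ` A (x', y') i = {}"
  shows "\<exists>x \<in> topspace (nsphere d). \<exists>P N.
      P \<subseteq> W \<times> {1..m} \<and> N \<subseteq> W \<times> {1..m} \<and> P \<noteq> {} \<and> N \<noteq> {} \<and> P \<inter> N = {} \<and>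
      (convex hull ((\<lambda>(w, i). p w i) ` P)) \<inter> (convex hull ((\<lambda>(w, i). p w i) ` N)) \<noteq> {} \<and>
      x \<in> (\<Inter>(w, i)\<in>P. A w i) \<inter> (\<Inter>(w, i)\<in>N. uminus ` A w i) \<and>
      inj_on fst (P \<union> N) \<and> rook_placement (d + 1) X Y (fst ` (P \<union> N)) \<and>
      snd ` P \<inter> snd ` N = {}"
proof -
  define B where "B = W \<times> {1..m}"
  define A' where "A' = (\<lambda>(w, i). A w i)"
  \<comment> \<open>The points are lifted to height 1 in \<open>\<real>\<^sup>d\<close>, so that a linear relation between the signed lifts becomes a relation between convex combinations.\<close>
  define G where "G = (\<lambda>(w, i) j. if j < d - 1 then p w i j else 1)"
  have finB: "finite B" using assms(3,4) \<open>W = X \<times> Y\<close> by (simp add: B_def)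
  have closed_nsphere: "closed S" if S: "closedin (nsphere d) S" for S
  proof -
    have "closed {x :: nat \<Rightarrow> real. (\<Sum>i\<le>d. (x i)\<^sup>2) = 1}"
      by (intro closed_Collect_eq continuous_on_sum continuous_on_power continuous_on_product_coordinates continuous_on_const)
    moreover obtain T where "closedin (Euclidean_space (Suc d)) T" "S = T \<inter> {x. (\<Sum>i\<le>d. (x i)\<^sup>2) = 1}"
      using S unfolding nsphere_def closedin_subtopology by blast
    ultimately show ?thesis
      using closedin_Euclidean_imp_closed by (auto intro: closed_Int)
  qed
  have neg_mem: "x \<in> uminus ` S \<longleftrightarrow> - x \<in> S" for x :: "nat \<Rightarrow> real" and S
    by (metis (no_types, lifting) image_iff minus_minus)
  have stairs: "has_stair (Suc d) (fst ` {b \<in> B. x \<in> A' b \<or> - x \<in> A' b})" if x: "x \<in> topspace (nsphere d)" for x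
  proof (rule ccontr)
    let ?Wx = "fst ` {b \<in> B. x \<in> A' b \<or> - x \<in> A' b}"
    assume none: "\<not> has_stair (Suc d) ?Wx"
    \<comment> \<open>The squares that are not available at \<open>x\<close> would meet every stair, and so their sets would cover \<open>x\<close>.\<close>
    have "topspace (nsphere d) = (\<Union>w\<in>W - ?Wx. \<Union>i\<in>{1..m}. A w i \<union> uminus ` A w i)"
    proof (rule cover)
      fix a b S
      assume ab: "nu a b \<ge> int d + 1" "a \<le> 2 * int d + 1" "b \<le> 2 * int d + 1" and S: "S \<subseteq> W"
        and iso: "isomorphic_to_stair a b (int d + 1) X Y S"
      show "(W - ?Wx) \<inter> S \<noteq> {}"
      proof
        assume "(W - ?Wx) \<inter> S = {}"
        then have sub: "S \<subseteq> ?Wx" using S by blast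
        obtain \<alpha> \<beta> where \<alpha>\<beta>: "inj_on \<alpha> {1..a}" "inj_on \<beta> {1..b}" "S = (\<lambda>(i, j). (\<alpha> i, \<beta> j)) ` stair a b (int d + 1)"
          using iso unfolding isomorphic_to_stair_def by blast
        have "has_stair (Suc d) ?Wx"
          unfolding has_stair_def
        proof (intro exI conjI)
          show "int (Suc d) \<le> nu a b" "a \<le> 2 * int (Suc d) - 1" "b \<le> 2 * int (Suc d) - 1" using ab by auto
          show "inj_on \<alpha> {1..a}" "inj_on \<beta> {1..b}" by (rule \<alpha>\<beta>)+
          have Suc_d: "int (Suc d) = int d + 1" by simp
          have "(\<alpha> i, \<beta> j) \<in> ?Wx" if "(i, j) \<in> stair a b (int d + 1)" for i j
          proof (rule subsetD[OF sub])
            show "(\<alpha> i, \<beta> j) \<in> S"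
              unfolding \<alpha>\<beta>(3) using that by (rule rev_image_eqI) simp
          qed
          then show "\<forall>(i, j)\<in>stair a b (int (Suc d)). (\<alpha> i, \<beta> j) \<in> ?Wx"
            unfolding Suc_d by blast
        qed
        with none show False ..
      qed
    qed auto
    then obtain w i where w: "w \<in> W - ?Wx" "i \<in> {1..m}" "x \<in> A w i \<union> uminus ` A w i"
      using x by blast
    then have "(w, i) \<in> {b \<in> B. x \<in> A' b \<or> - x \<in> A' b}"
      by (auto simp: B_def A'_def neg_mem)
    then have "w \<in> ?Wx" by (rule rev_image_eqI) simp
    then show False using w(1) by blast
  qed
  have closedA: "closed (A' b)" if "b \<in> B" for b
    using that closed closed_nsphere by (auto simp: B_def A'_def)
  obtain x \<sigma> where x: "x \<in> topspace (nsphere d)" and \<sigma>: "\<sigma> \<subseteq> B \<times> UNIV" "card \<sigma> = Suc d"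
    and rook: "pairwise (\<lambda>u v. nonattacking (fst (fst u)) (fst (fst v))) \<sigma>"
    and cross: "crosses (signed G) d \<sigma>" and mem: "\<forall>(b, s)\<in>\<sigma>. (if s then x else - x) \<in> A' b"
    using colored_antipodal_point[of B A' d fst G, OF finB closedA stairs] by blast
  have fin\<sigma>: "finite \<sigma>" using \<sigma>(2) by (simp add: card_ge_0_finite)
  have apart: "fst (fst (fst u)) \<noteq> fst (fst (fst v)) \<and> snd (fst (fst u)) \<noteq> snd (fst (fst v))"
    if "u \<in> \<sigma>" "v \<in> \<sigma>" "u \<noteq> v" for u v
    using rook that by (auto simp: pairwise_def nonattacking_def)
  define P where "P = {b. (b, True) \<in> \<sigma>}"
  define N where "N = {b. (b, False) \<in> \<sigma>}"
  have finPN: "finite P" "finite N"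
    unfolding P_def N_def using fin\<sigma> by (auto intro!: finite_vimageI[of \<sigma> "\<lambda>b. (b, _)", unfolded vimage_def] simp: inj_on_def)
  have \<sigma>_eq: "\<sigma> = (\<lambda>b. (b, True)) ` P \<union> (\<lambda>b. (b, False)) ` N"
  proof (intro set_eqI iffI)
    fix u assume "u \<in> \<sigma>"
    then show "u \<in> (\<lambda>b. (b, True)) ` P \<union> (\<lambda>b. (b, False)) ` N"
      by (cases u; cases "snd u") (auto simp: P_def N_def)
  qed (auto simp: P_def N_def)
  have sum_\<sigma>: "sum h \<sigma> = (\<Sum>b\<in>P. h (b, True)) + (\<Sum>b\<in>N. h (b, False))" for h :: "_ \<Rightarrow> real"
    unfolding \<sigma>_eq using finPN by (subst sum.union_disjoint) (auto simp: sum.reindex inj_on_def)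
  have PN: "P \<union> N = fst ` \<sigma>" by (auto simp: \<sigma>_eq image_Un image_image)
  have sub: "P \<subseteq> W \<times> {1..m}" "N \<subseteq> W \<times> {1..m}" using \<sigma>(1) by (auto simp: P_def N_def B_def)
  obtain \<alpha> where \<alpha>: "convex_weights \<sigma> \<alpha>" "relation_upto (signed G) d \<sigma> \<alpha>"
    using cross unfolding crosses_def by blast
  \<comment> \<open>The last coordinate of the positions shows that the positive and the negative weights both add up to \<open>1 / 2\<close>.\<close>
  define \<beta> where "\<beta> b = 2 * \<alpha> (b, True)" for b
  define \<gamma> where "\<gamma> b = 2 * \<alpha> (b, False)" for b
  have bal: "(\<Sum>b\<in>P. \<beta> b * G b j) = (\<Sum>b\<in>N. \<gamma> b * G b j)" if "j < d" for j
  proof -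
    have "(\<Sum>v\<in>\<sigma>. \<alpha> v * signed G v j) = 0" using \<alpha>(2) that by (simp add: relation_upto_def)
    then have "(\<Sum>b\<in>P. \<alpha> (b, True) * G b j) = (\<Sum>b\<in>N. \<alpha> (b, False) * G b j)"
      unfolding sum_\<sigma> by (simp add: signed_def sum_negf)
    then show ?thesis by (simp add: \<beta>_def \<gamma>_def mult.assoc flip: sum_distrib_left)
  qed
  have total: "sum \<beta> P + sum \<gamma> N = 2"
    using \<alpha>(1) unfolding convex_weights_def sum_\<sigma> by (simp add: \<beta>_def \<gamma>_def flip: sum_distrib_left)
  have "sum \<beta> P = sum \<gamma> N"
    using bal[of "d - 1"] \<open>d > 0\<close> by (simp add: G_def case_prod_unfold)
  then have one: "sum \<beta> P = 1" "sum \<gamma> N = 1" using total by auto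
  have nonneg: "\<beta> b \<ge> 0" if "b \<in> P" for b
    using that \<alpha>(1) by (simp add: \<beta>_def convex_weights_def P_def)
  have nonneg': "\<gamma> b \<ge> 0" if "b \<in> N" for b
    using that \<alpha>(1) by (simp add: \<gamma>_def convex_weights_def N_def)
  let ?p = "\<lambda>(w, i). p w i"
  have sum_at: "(\<Sum>b\<in>T. h b *\<^sub>R ?p b) j = (\<Sum>b\<in>T. h b * ?p b j)" for T h j
    by (induction T rule: infinite_finite_induct) (auto simp: scaleR_fun_def)
  have "(\<Sum>b\<in>P. \<beta> b *\<^sub>R ?p b) = (\<Sum>b\<in>N. \<gamma> b *\<^sub>R ?p b)"
  proof
    fix j
    show "(\<Sum>b\<in>P. \<beta> b *\<^sub>R ?p b) j = (\<Sum>b\<in>N. \<gamma> b *\<^sub>R ?p b) j"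
    proof (cases "j < d - 1")
      case True
      then show ?thesis
        using bal[of j] unfolding sum_at by (simp add: G_def case_prod_unfold)
    next
      case False
      have "?p b j = 0" if "b \<in> P \<union> N" for b
        using that sub points[of "fst b" "snd b"] False by (auto simp: topspace_Euclidean_space)
      then have "(\<Sum>b\<in>P. \<beta> b * ?p b j) = 0" "(\<Sum>b\<in>N. \<gamma> b * ?p b j) = 0"
        by (intro sum.neutral ballI; simp)+
      then show ?thesis unfolding sum_at by simp
    qed
  qed
  moreover have "(\<Sum>b\<in>P. \<beta> b *\<^sub>R ?p b) \<in> convex hull (?p ` P)"
    using finPN one nonneg by (intro convex_sum) (auto intro: hull_inc convex_convex_hull)
  moreover have "(\<Sum>b\<in>N. \<gamma> b *\<^sub>R ?p b) \<in> convex hull (?p ` N)"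
    using finPN one nonneg' by (intro convex_sum) (auto intro: hull_inc convex_convex_hull)
  ultimately have hulls: "(convex hull (?p ` P)) \<inter> (convex hull (?p ` N)) \<noteq> {}" by auto
  have nonempty: "P \<noteq> {}" "N \<noteq> {}" using one by auto
  have memP: "x \<in> A w i" if "(w, i) \<in> P" for w i using mem that by (auto simp: P_def A'_def)
  have memN: "- x \<in> A w i" if "(w, i) \<in> N" for w i using mem that by (auto simp: N_def A'_def)
  have inter: "x \<in> (\<Inter>(w, i)\<in>P. A w i) \<inter> (\<Inter>(w, i)\<in>N. uminus ` A w i)"
    using memP memN by (auto simp: neg_mem)
  have snds: "snd ` P \<inter> snd ` N = {}"
  proof (rule ccontr)
    assume "snd ` P \<inter> snd ` N \<noteq> {}"
    then obtain u w i where ui: "(u, i) \<in> P" and wi: "(w, i) \<in> N" by force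
    have "fst u \<noteq> fst w" "snd u \<noteq> snd w"
      using apart[of "((u, i), True)" "((w, i), False)"] ui wi by (auto simp: P_def N_def)
    moreover have "u \<in> W" "w \<in> W" "i \<in> {1..m}" using ui wi sub by auto
    ultimately have "A u i \<inter> uminus ` A w i = {}"
      using disjoint[of "fst u" "snd u" "fst w" "snd w" i] by simp
    then show False using memP[OF ui] memN[OF wi] by (auto simp: neg_mem)
  qed
  have inj: "inj_on fst (P \<union> N)"
    unfolding PN by (rule inj_onI) (use apart in fastforce)
  have inj2: "inj_on (fst \<circ> fst) \<sigma>"
    by (rule inj_onI) (use apart in fastforce)
  have "fst ` (P \<union> N) = (fst \<circ> fst) ` \<sigma>" unfolding PN by (simp add: image_comp)
  moreover have "rook_placement (d + 1) X Y ((fst \<circ> fst) ` \<sigma>)"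
    unfolding rook_placement_def
  proof (intro conjI)
    show "(fst \<circ> fst) ` \<sigma> \<subseteq> X \<times> Y" using \<sigma>(1) \<open>W = X \<times> Y\<close> by (auto simp: B_def)
    show "card ((fst \<circ> fst) ` \<sigma>) = d + 1" using card_image[OF inj2] \<sigma>(2) by simp
    show "inj_on fst ((fst \<circ> fst) ` \<sigma>)" "inj_on snd ((fst \<circ> fst) ` \<sigma>)"
      using apart by (auto intro!: inj_onI) (metis fst_conv snd_conv)+
  qed (use fin\<sigma> in simp)
  ultimately have placement: "rook_placement (d + 1) X Y (fst ` (P \<union> N))" by simp
  have "P \<inter> N = {}" using snds by auto
  then show ?thesis
    using x sub nonempty hulls inter inj placement snds by (intro bexI[of _ x] exI[of _ P] exI[of _ N]) simp_all
qed

end
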